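(* For an odd prime $p$ let $E(2)\subset\mathrm{SL}(2,\mathbb{F}_p)$ be the set of the four elementary matrices, i.e. matrices differing from the identity by $\pm1$ in exactly one off-diagonal entry. Let $$c_3=0.79622,\ c_5=0.61803,\ c_7=0.54119,\ c_{11}=0.43700,\ c_{13}=0.40302,\ c_{17}=0.38119,\ c_{19}=0.35021.$$ Then for each $p\in\{3,5,7,11,13,17,19\}$ the spectral gap of the unnormalized Laplace operator and the Kazhdan constant satisfy $$\lambda(\mathrm{SL}(2,\mathbb{F}_p),E(2))\;\ge\;2\,c_p^2,\qquad \kappa(\mathrm{SL}(2,\mathbb{F}_p),E(2))\;\ge\; c_p .$$
   Context: Let $G$ be a discrete group with a finite symmetric generating set $S$ ($S=S^{-1}$). The unnormalized Laplace operator is $\Delta_S=\frac12\sum_{g\in S}(1-g)^*(1-g)=|S|-\sum_{g\in S}g\in\mathbb{R}[G]$, where $^*$ is the linear involution with $g^*=g^{-1}$ for $g \in G$. For an orthogonal representation $\pi$ of $G$ on a real Hilbert space $\mathscr{H}$, let $\mathscr{H}^\pi$ be the closed subspace of $\pi$-invariant vectors, and put $$\kappa(G,S,\pi)=\inf\Big\{\sup_{g\in S}\|\pi(g)\xi-\xi\| : \xi\in(\mathscr{H}^\pi)^\perp,\ \|\xi\|=1\Big\}.$$ The Kazhdan constant $\kappa(G,S)$ is the infimum of $\kappa(G,S,\pi)$ over all orthogonal representations $\pi$ of $G$ (the infimum of the empty set being $+\infty$). The spectral gap $\lambda(G,S)$ is the infimum, over all orthogonal representations $\pi$ of $G$ with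 no non-zero invariant vectors, of the bottom of the spectrum of the operator $\pi(\Delta_S)$. *)

theory Defs
  imports "HOL-Analysis.Analysis" "HOL-Algebra.Group"
begin

section \<open>Orthogonal representations\<close>

definition orthogonal_group :: "('h::real_inner \<Rightarrow> 'h) monoid" where
  "orthogonal_group = \<lparr>carrier = {f. orthogonal_transformation f \<and> surj f}, mult = (\<circ>), one = id\<rparr>"

abbreviation orthogonal_reps :: "('g, 'b) monoid_scheme \<Rightarrow> ('g \<Rightarrow> 'h::real_inner \<Rightarrow> 'h) set" where
  "orthogonal_reps G \<equiv> hom G orthogonal_group"

definition invariant_vectors ::
    "('g, 'b) monoid_scheme \<Rightarrow> ('g \<Rightarrow> 'h::real_inner \<Rightarrow> 'h) \<Rightarrow> 'h set" where
  "invariant_vectors G \<pi> = {\<xi>. \<forall>g\<in>carrier G. \<pi> g \<xi> = \<xi>}"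

definition orth_complement :: "'h::real_inner set \<Rightarrow> 'h set" where
  "orth_complement W = {\<xi>. \<forall>\<eta>\<in>W. orthogonal \<eta> \<xi>}"


section \<open>Kazhdan constants\<close>

text \<open>
  Values are in \<^typ>\<open>ereal\<close>, so that the infimum of the empty set is \<open>\<infinity>\<close>.
  HOL cannot quantify over types inside a term. The infima over all orthogonal representations
  are therefore taken, for a type \<open>'h\<close>, over the representations on \<open>'h\<close>. A lower bound for
  the infimum over all Hilbert spaces is the same as that bound for every Hilbert space
  type \<open>'h\<close>, i.e. a theorem with \<open>'h\<close> left as a type variable.
\<close>

definition kazhdan_constant_rep ::
    "('g, 'b) monoid_scheme \<Rightarrow> 'g set \<Rightarrow> ('g \<Rightarrow> 'h::real_inner \<Rightarrow> 'h) \<Rightarrow> ereal" where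
  "kazhdan_constant_rep G S \<pi> =
     (INF \<xi>\<in>{\<xi> \<in> orth_complement (invariant_vectors G \<pi>). norm \<xi> = 1}.
        SUP g\<in>S. ereal (norm (\<pi> g \<xi> - \<xi>)))"

definition kazhdan_constant ::
    "'h::{real_inner, complete_space} itself \<Rightarrow> ('g, 'b) monoid_scheme \<Rightarrow> 'g set \<Rightarrow> ereal" where
  "kazhdan_constant (_ :: 'h itself) G S =
     (INF \<pi>\<in>(orthogonal_reps G :: ('g \<Rightarrow> 'h \<Rightarrow> 'h) set). kazhdan_constant_rep G S \<pi>)"


section \<open>Laplace operator and spectral gap\<close>

text \<open>
  An element of the real group ring is given by its coefficient function, of finite support
  contained in the carrier.
\<close>

definition laplacian :: "('g, 'b) monoid_scheme \<Rightarrow> 'g set \<Rightarrow> 'g \<Rightarrow> real" where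
  "laplacian G S = (\<lambda>x. real (card S) * indicator {\<one>\<^bsub>G\<^esub>} x - (\<Sum>g\<in>S. indicator {g} x))"

definition rep_group_ring ::
    "('g, 'b) monoid_scheme \<Rightarrow> ('g \<Rightarrow> 'h::real_vector \<Rightarrow> 'h) \<Rightarrow> ('g \<Rightarrow> real) \<Rightarrow> 'h \<Rightarrow> 'h" where
  "rep_group_ring G \<pi> a = (\<lambda>\<xi>. \<Sum>g\<in>{g \<in> carrier G. a g \<noteq> 0}. a g *\<^sub>R \<pi> g \<xi>)"

text \<open>
  The spectrum is taken over the reals: the operators \<open>\<pi>(\<Delta>\<^sub>S)\<close> for symmetric \<open>S\<close> are
  self-adjoint, so the spectrum of the complexification is real and coincides with this set.
\<close>

definition spectrum :: "('h::real_normed_vector \<Rightarrow> 'h) \<Rightarrow> real set" where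
  "spectrum T = {l. \<not> (\<exists>R. bounded_linear R \<and>
     (\<forall>x. R (T x - l *\<^sub>R x) = x) \<and> (\<forall>x. T (R x) - l *\<^sub>R R x = x))}"

definition spectral_gap ::
    "'h::{real_inner, complete_space} itself \<Rightarrow> ('g, 'b) monoid_scheme \<Rightarrow> 'g set \<Rightarrow> ereal" where
  "spectral_gap (_ :: 'h itself) G S =
     (INF \<pi>\<in>{\<pi> \<in> (orthogonal_reps G :: ('g \<Rightarrow> 'h \<Rightarrow> 'h) set). invariant_vectors G \<pi> = {0}}.
        INF l\<in>spectrum (rep_group_ring G \<pi> (laplacian G S)). ereal l)"

lemma rep_group_ring_laplacian:
  assumes "finite S" "S \<subseteq> carrier G" "\<one>\<^bsub>G\<^esub> \<in> carrier G" "\<pi> \<one>\<^bsub>G\<^esub> = id"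
  shows "rep_group_ring G \<pi> (laplacian G S) \<xi> = real (card S) *\<^sub>R \<xi> - (\<Sum>g\<in>S. \<pi> g \<xi>)"
proof -
  let ?a = "laplacian G S" and ?U = "insert \<one>\<^bsub>G\<^esub> S"
  have ind: "(\<Sum>g\<in>S. indicator {g} x) = (indicator S x :: real)" for x
    using assms(1) by (simp add: indicator_def)
  have "rep_group_ring G \<pi> ?a \<xi> = (\<Sum>g\<in>?U. ?a g *\<^sub>R \<pi> g \<xi>)"
    unfolding rep_group_ring_def
    using assms by (intro sum.mono_neutral_left) (auto simp: laplacian_def indicator_def)
  also have "\<dots> = (\<Sum>g\<in>?U. (real (card S) * indicator {\<one>\<^bsub>G\<^esub>} g) *\<^sub>R \<pi> g \<xi>)
                 - (\<Sum>g\<in>?U. (indicator S g :: real) *\<^sub>R \<pi> g \<xi>)"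
    by (simp only: laplacian_def ind scaleR_left_diff_distrib sum_subtractf)
  also have "(\<Sum>g\<in>?U. (real (card S) * indicator {\<one>\<^bsub>G\<^esub>} g) *\<^sub>R \<pi> g \<xi>)
      = (\<Sum>g\<in>{\<one>\<^bsub>G\<^esub>}. (real (card S) * indicator {\<one>\<^bsub>G\<^esub>} g) *\<^sub>R \<pi> g \<xi>)"
    using assms(1) by (intro sum.mono_neutral_right) auto
  also have "(\<Sum>g\<in>?U. (indicator S g :: real) *\<^sub>R \<pi> g \<xi>)
      = (\<Sum>g\<in>S. (indicator S g :: real) *\<^sub>R \<pi> g \<xi>)"
    using assms(1) by (intro sum.mono_neutral_right) auto
  finally show ?thesis
    using assms(4) by simp
qed


section \<open>Special linear groups and elementary matrices\<close>

definition SL :: "('k::comm_ring_1 ^ 'n ^ 'n) monoid" where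
  "SL = \<lparr>carrier = {A. det A = 1}, mult = (**), one = mat 1\<rparr>"

definition elementary_matrices :: "('k::comm_ring_1 ^ 'n ^ 'n) set" where
  "elementary_matrices =
     {A. \<exists>i j. i \<noteq> j \<and> (A $ i $ j = 1 \<or> A $ i $ j = -1) \<and>
        (\<forall>k l. (k, l) \<noteq> (i, j) \<longrightarrow> A $ k $ l = mat 1 $ k $ l)}"

lemma group_SL: "group (SL :: ('k::field ^ 'n ^ 'n) monoid)"
proof (rule groupI)
  fix A :: "'k ^ 'n ^ 'n"
  assume "A \<in> carrier SL"
  then have d: "det A = 1" by (simp add: SL_def)
  then obtain B where B: "A ** B = mat 1" "B ** A = mat 1"
    using invertible_det_nz[of A] unfolding invertible_def by auto
  have "det B = 1"
    using d B(1) by (metis det_I det_mul mult_1)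
  with B(2) show "\<exists>B\<in>carrier SL. B \<otimes>\<^bsub>SL\<^esub> A = \<one>\<^bsub>SL\<^esub>"
    by (auto simp: SL_def)
qed (auto simp: SL_def det_mul det_I matrix_mul_assoc)

lemma elementary_matrices_subset_SL:
  "(elementary_matrices :: ('k::comm_ring_1 ^ 2 ^ 2) set) \<subseteq> carrier SL"
proof
  fix A :: "'k ^ 2 ^ 2"
  assume "A \<in> elementary_matrices"
  then obtain i j where ij: "i \<noteq> j"
    and A: "\<And>k l. (k, l) \<noteq> (i, j) \<Longrightarrow> A $ k $ l = mat 1 $ k $ l"
    unfolding elementary_matrices_def by blast
  have "A $ 1 $ 1 = 1" "A $ 2 $ 2 = 1" "A $ 1 $ 2 = 0 \<or> A $ 2 $ 1 = 0"
    using ij A[of 1 1] A[of 2 2] A[of 1 2] A[of 2 1] by (auto simp: mat_def)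
  then show "A \<in> carrier SL"
    by (auto simp: SL_def det_2)
qed

end

theory Submission
  imports Defs "HOL-Number_Theory.Residues"
begin

text \<open>
  Let \<open>u\<close>, \<open>v\<close> be the upper and lower elementary matrices with entry 1 and \<open>A = u + u\<^sup>-\<^sup>1 + v + v\<^sup>-\<^sup>1\<close>, so that the
  Laplace operator is \<open>4 - A\<close>. Both claims follow from \<open>A \<le> 4 - 2 c\<^sup>2\<close> on the orthogonal complement of the
  invariant vectors (\<open>adjacency_op_upper_bound\<close>). Suppose this fails. The group is finite, so some
  finite-dimensional subrepresentation contains a unit eigenvector \<open>x\<close> of \<open>A\<close> with eigenvalue
  \<open>\<kappa> > 4 - 2 c\<^sup>2\<close>, and \<open>\<kappa> \<noteq> 4\<close> (\<open>exists_eigenvector\<close>). This is refuted in two parts, which correspond to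
  the principal series and the cuspidal representations.

  Principal series. If \<open>\<eta>\<close> is fixed by \<open>u\<close>, then \<open>g \<mapsto> x \<bullet> g \<eta>\<close> depends only on the first column of \<open>g\<close>. It
  is a \<open>\<kappa>\<close>-eigenfunction of the 4-regular graph on the nonzero vectors of the plane over the field with
  \<open>p\<close> elements, in which \<open>(a, b)\<close> is joined to \<open>(a \<plusminus> b, b)\<close> and \<open>(a, b \<plusminus> a)\<close>. The bound is sharp here up to the
  rounding of \<open>c\<close>, so the second eigenvalue of the graph is bounded by an exact computation: Gaussian
  elimination in integers with controlled rounding (\<open>gap_check_sound\<close>). For \<open>p \<ge> 11\<close> the graph is first
  divided by the quarter turn \<open>w = u v\<^sup>-\<^sup>1 u\<close>, which must fix \<open>x\<close>, since vectors that \<open>w\<close> moves far are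
  moved far by \<open>u\<close> or \<open>v\<close> (\<open>eigenvector_quarter_turn\<close>). It follows that \<open>x\<close> is orthogonal to all \<open>g \<eta>\<close>.

  Cuspidal part. Now neither \<open>u\<close> nor \<open>v\<close> fixes a nonzero vector in the span of its powers applied
  to \<open>x\<close>. Their eigenvalues there are nontrivial \<open>p\<close>-th roots of unity, hence \<open>\<kappa> \<le> 4 cos (2 \<pi> / p)\<close>
  (\<open>cuspidal_bound\<close>). This is below \<open>4 - 2 c\<^sup>2\<close> for \<open>p \<le> 13\<close> and narrowly fails for 17 and 19. There
  equality would mean that \<open>x\<close> has frequency \<open>\<plusminus>1\<close> for both \<open>u\<close> and \<open>v\<close>, and the relation
  \<open>v\<^sup>2 = t n t\<close>, with \<open>t\<close> the square root of \<open>u\<close> in its cyclic group and \<open>n\<close> a monomial matrix that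
  multiplies frequencies by 4, excludes even an approximate version of this
  (\<open>no_common_low_frequency_vector\<close>).
\<close>

section \<open>Certifying positivity of quadratic forms in integer arithmetic\<close>

fun dotp :: "int list \<Rightarrow> real list \<Rightarrow> real" where
  "dotp (c # cs) (x # xs) = of_int c * x + dotp cs xs"
| "dotp _ _ = 0"

text \<open>
  A quadratic form is stored by its rows on and above the diagonal; the entry at \<open>i < j\<close> is the whole
  coefficient of \<open>x\<^sub>i x\<^sub>j\<close>.
\<close>

fun tri_form :: "int list list \<Rightarrow> real list \<Rightarrow> real" where
  "tri_form ((d # c) # T) (x # xs) = of_int d * x\<^sup>2 + x * dotp c xs + tri_form T xs"
| "tri_form _ _ = 0"

fun tri_shape :: "int list list \<Rightarrow> bool" where
  "tri_shape [] = True"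
| "tri_shape (r # T) = (length r = Suc (length T) \<and> tri_shape T)"

fun full_form :: "int list list \<Rightarrow> real list \<Rightarrow> real list \<Rightarrow> real" where
  "full_form (r # R) (y # ys) xs = y * dotp r xs + full_form R ys xs"
| "full_form _ _ _ = 0"

fun add_lists :: "int list \<Rightarrow> int list \<Rightarrow> int list" where
  "add_lists (x # xs) (y # ys) = (x + y) # add_lists xs ys"
| "add_lists _ _ = []"

fun fold_tri :: "int list list \<Rightarrow> int list list" where
  "fold_tri [] = []"
| "fold_tri (r # R) = (hd r # add_lists (tl r) (map hd R)) # fold_tri (map tl R)"

text \<open>
  One elimination step subtracts \<open>u / 2 ^ K * (c \<bullet> x)\<^sup>2\<close> from a form. Entries stay integers: every
  correction is rounded down by dropping \<open>K\<close> bits, and each diagonal entry that is touched loses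
  a further \<open>n\<close>, which pays for the rounding. Zeros of \<open>c\<close> are skipped, so sparse forms stay cheap.
\<close>

fun sub_row :: "nat \<Rightarrow> int \<Rightarrow> int list \<Rightarrow> int list \<Rightarrow> int list" where
  "sub_row K a (c # cs) (r # rs) =
     (if c = 0 then r else r - drop_bit K (a * c)) # sub_row K a cs rs"
| "sub_row K a _ _ = []"

fun sub_square :: "nat \<Rightarrow> int \<Rightarrow> int \<Rightarrow> int list \<Rightarrow> int list list \<Rightarrow> int list list" where
  "sub_square K n u (c # cs) ((e # r) # T) =
     (if c = 0 then e # r
      else let a = c * u in (e - drop_bit K (a * c) - n) # sub_row K (2 * a) cs r)
     # sub_square K n u cs T"
| "sub_square K n u _ _ = []"

text \<open>
  A row touched by the step has at most as many rounded entries as \<open>c\<close> has nonzero ones, and each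
  error costs at most half of \<open>x\<^sub>i\<^sup>2 + x\<^sub>j\<^sup>2\<close>; so one more than the number of nonzero entries suffices.
\<close>

fun slack :: "int list \<Rightarrow> int" where
  "slack [] = 1"
| "slack (c # cs) = (if c = 0 then slack cs else 1 + slack cs)"

text \<open>
  Completing the square in \<open>d x\<^sup>2 + x (c \<bullet> y)\<close> leaves \<open>- (c \<bullet> y)\<^sup>2 / (4 d)\<close>. The integer below, divided
  by \<open>2 ^ K\<close>, exceeds \<open>1 / (4 d)\<close> for either sign of \<open>d\<close>, because rounding down and adding one does.
\<close>

definition eliminate :: "nat \<Rightarrow> int \<Rightarrow> int list \<Rightarrow> int list list \<Rightarrow> int list list" where
  "eliminate K d c T = sub_square K (slack c) (2 ^ K div (4 * d) + 1) c T"

lemma length_sub_square: "length (sub_square K n u c T) \<le> length T"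
  by (induction K n u c T rule: sub_square.induct) (auto simp: Let_def)

function psd_check :: "nat \<Rightarrow> int list list \<Rightarrow> bool" where
  "psd_check K [] = True"
| "psd_check K ([] # T) = False"
| "psd_check K ((d # c) # T) = (0 < d \<and> psd_check K (eliminate K d c T))"
  by pat_completeness auto
termination
  by (relation "inv_image less_than (length \<circ> snd)")
     (auto simp: eliminate_def length_sub_square le_imp_less_Suc)

text \<open>
  The variable at position \<open>i\<close> is a Lagrange multiplier \<open>t\<close>: it enters the form with coefficient
  zero on the diagonal and multiplies a linear condition on the other variables. Positivity is only
  wanted on the hyperplane where that condition holds, so it is enough that each choice of the
  other variables allows some \<open>t\<close> with a nonnegative value. Accordingly the pivot of \<open>t\<close> has to be
  negative, and \<open>t\<close> is chosen as the maximiser. Compared with adding a multiple of the squared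
  condition, this keeps the matrix sparse until \<open>t\<close> is eliminated.
\<close>

fun bordered_check :: "nat \<Rightarrow> nat \<Rightarrow> int list list \<Rightarrow> bool" where
  "bordered_check K i [] = False"
| "bordered_check K i ([] # T) = False"
| "bordered_check K i ((d # c) # T) =
     (case i of
        0 \<Rightarrow> d < 0 \<and> psd_check K (eliminate K d c T)
      | Suc j \<Rightarrow> 0 < d \<and> bordered_check K j (eliminate K d c T))"

fun nz_count :: "int list \<Rightarrow> nat" where
  "nz_count [] = 0"
| "nz_count (c # cs) = (if c = 0 then nz_count cs else Suc (nz_count cs))"

fun nz_sq :: "int list \<Rightarrow> real list \<Rightarrow> real" where
  "nz_sq (c # cs) (x # xs) = (if c = 0 then 0 else x\<^sup>2) + nz_sq cs xs"
| "nz_sq _ _ = 0"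

lemma nz_sq_nonneg: "0 \<le> nz_sq c xs"
  by (induction c xs rule: nz_sq.induct) auto

lemma slack_eq: "slack c = 1 + int (nz_count c)"
  by (induction c) auto

lemma drop_bit_bounds:
  fixes a :: int
  obtains f :: real where "of_int (drop_bit K a) = of_int a / 2 ^ K - f" "0 \<le> f" "f \<le> 1"
proof
  let ?f = "of_int (a mod 2 ^ K) / (2 ^ K :: real)"
  have "(of_int a :: real) = of_int (a div 2 ^ K * 2 ^ K + a mod 2 ^ K)"
    by (simp only: div_mult_mod_eq)
  also have "\<dots> = of_int (drop_bit K a) * 2 ^ K + of_int (a mod 2 ^ K)"
    unfolding drop_bit_eq_div of_int_add of_int_mult by simp
  finally show "of_int (drop_bit K a) = of_int a / 2 ^ K - ?f"
    by (simp add: field_simps)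
  show "0 \<le> ?f" by simp
  have "of_int (a mod 2 ^ K) \<le> (of_int (2 ^ K) :: real)"
    unfolding of_int_le_iff by (simp add: less_imp_le)
  then show "?f \<le> 1" by (simp add: field_simps)
qed

lemma frac_mult_le:
  fixes x y f :: real
  assumes "0 \<le> f" "f \<le> 1"
  shows "x * y * f \<le> (x\<^sup>2 + y\<^sup>2) / 2"
proof -
  have "x * y * f \<le> \<bar>x * y\<bar> * 1"
    using assms by (metis abs_ge_self abs_ge_zero abs_mult mult_mono abs_of_nonneg order_trans mult_left_mono)
  also have "\<dots> \<le> (x\<^sup>2 + y\<^sup>2) / 2"
    using sum_squares_bound[of "\<bar>x\<bar>" "\<bar>y\<bar>"] by (simp add: abs_mult)
  finally show ?thesis .
qed

lemma dotp_sub_row: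
  assumes "length cs = length rs" "length cs = length xs"
  shows "x * dotp (sub_row K a cs rs) xs
    \<le> x * dotp rs xs - x * (of_int a / 2 ^ K) * dotp cs xs
      + real (nz_count cs) / 2 * x\<^sup>2 + nz_sq cs xs / 2"
  using assms
proof (induction cs arbitrary: rs xs)
  case (Cons c cs)
  then obtain r rs' y ys where eq: "rs = r # rs'" "xs = y # ys"
    by (metis length_Suc_conv)
  have IH: "x * dotp (sub_row K a cs rs') ys
    \<le> x * dotp rs' ys - x * (of_int a / 2 ^ K) * dotp cs ys
      + real (nz_count cs) / 2 * x\<^sup>2 + nz_sq cs ys / 2"
    using Cons eq by simp
  show ?case
  proof (cases "c = 0")
    case True
    then show ?thesis using IH eq by (simp add: algebra_simps)
  next
    case False
    obtain f :: real where f: "of_int (drop_bit K (a * c)) = of_int (a * c) / 2 ^ K - f"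
      "0 \<le> f" "f \<le> 1" by (rule drop_bit_bounds)
    have "x * (of_int (r - drop_bit K (a * c)) * y)
      = x * (of_int r * y) - x * (of_int a / 2 ^ K) * (of_int c * y) + x * y * f"
      unfolding of_int_diff f(1) by (simp add: algebra_simps)
    also have "\<dots> \<le> x * (of_int r * y) - x * (of_int a / 2 ^ K) * (of_int c * y) + (x\<^sup>2 + y\<^sup>2) / 2"
      using frac_mult_le[OF f(2,3)] by simp
    finally show ?thesis using IH False eq by (simp add: algebra_simps add_divide_distrib)
  qed
qed auto

text \<open>
  The last term on the left is the reserve kept for rounding: \<open>n - 1\<close> from the diagonal, less half a
  unit for every nonzero entry of \<open>c\<close>. It decreases by exactly the half unit that a new row
  charges to the later variables, which makes the induction close.
\<close>

lemma tri_form_sub_square: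
  assumes "tri_shape T" "length c = length T" "length c = length xs" "n \<ge> slack c"
  shows "tri_form (sub_square K n u c T) xs + of_int u / 2 ^ K * (dotp c xs)\<^sup>2
      + (of_int n - 1 - real (nz_count c) / 2) * nz_sq c xs \<le> tri_form T xs"
  using assms
proof (induction c arbitrary: T xs)
  case (Cons c cs)
  then obtain row T' x ys where eq0: "T = row # T'" "xs = x # ys"
    by (metis length_Suc_conv)
  then obtain e r where eq: "T = (e # r) # T'" "xs = x # ys" "length r = length T'"
    using Cons.prems(1) by (cases row) auto
  let ?L = "dotp cs ys" and ?q = "of_int u / (2 ^ K :: real)"
  have IH: "tri_form (sub_square K n u cs T') ys + ?q * ?L\<^sup>2
      + (of_int n - 1 - real (nz_count cs) / 2) * nz_sq cs ys \<le> tri_form T' ys"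
    using Cons eq by (auto split: if_splits)
  show ?case
  proof (cases "c = 0")
    case True
    then show ?thesis using IH eq by simp
  next
    case False
    define a where "a = c * u"
    obtain f :: real where f: "of_int (drop_bit K (a * c)) = of_int (a * c) / 2 ^ K - f"
      "0 \<le> f" "f \<le> 1" by (rule drop_bit_bounds)
    have 1: "x * dotp (sub_row K (2 * a) cs r) ys
      \<le> x * dotp r ys - x * (of_int (2 * a) / 2 ^ K) * ?L
        + real (nz_count cs) / 2 * x\<^sup>2 + nz_sq cs ys / 2"
      by (rule dotp_sub_row) (use Cons.prems eq in auto)
    have "f * x\<^sup>2 \<le> 1 * x\<^sup>2"
      using f by (intro mult_right_mono) auto
    then have 2: "of_int (e - drop_bit K (a * c) - n) * x\<^sup>2
      \<le> of_int e * x\<^sup>2 - of_int (a * c) / 2 ^ K * x\<^sup>2 + x\<^sup>2 - of_int n * x\<^sup>2"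
      unfolding of_int_diff f(1) by (simp add: algebra_simps)
    have 3: "?q * (of_int c * x + ?L)\<^sup>2 = of_int (a * c) / 2 ^ K * x\<^sup>2
        + x * (of_int (2 * a) / 2 ^ K) * ?L + ?q * ?L\<^sup>2"
      by (simp add: a_def power2_eq_square algebra_simps add_divide_distrib)
    have 4: "(of_int n - 1 - real (Suc (nz_count cs)) / 2) * (x\<^sup>2 + nz_sq cs ys)
      = of_int n * x\<^sup>2 - x\<^sup>2 - real (nz_count cs) / 2 * x\<^sup>2 - x\<^sup>2 / 2
        + (of_int n - 1 - real (nz_count cs) / 2) * nz_sq cs ys - nz_sq cs ys / 2"
      by (simp add: algebra_simps add_divide_distrib)
    have 5: "0 \<le> x\<^sup>2" by simp
    have 6: "tri_form (sub_square K n u (c # cs) T) xs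
      = of_int (e - drop_bit K (a * c) - n) * x\<^sup>2 + x * dotp (sub_row K (2 * a) cs r) ys
        + tri_form (sub_square K n u cs T') ys"
      "tri_form T xs = of_int e * x\<^sup>2 + x * dotp r ys + tri_form T' ys"
      "dotp (c # cs) xs = of_int c * x + ?L" "nz_sq (c # cs) xs = x\<^sup>2 + nz_sq cs ys"
      "nz_count (c # cs) = Suc (nz_count cs)"
      using False eq by (simp_all add: a_def Let_def)
    show ?thesis
      unfolding 6 3 4 using 1 2 5 IH by linarith
  qed
qed auto

lemma tri_shape_sub_square:
  assumes "tri_shape T" "length c = length T"
  shows "tri_shape (sub_square K n u c T) \<and> length (sub_square K n u c T) = length T"
proof -
  have len: "length cs = length rs \<Longrightarrow> length (sub_row K a cs rs) = length rs" for a cs rs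
    by (induction cs rs rule: list_induct2) auto
  show ?thesis
    using assms
  proof (induction c arbitrary: T)
    case (Cons c cs)
    then obtain row T' where eq0: "T = row # T'" by (metis length_Suc_conv)
    then obtain e r where eq: "T = (e # r) # T'" "length r = length T'"
      using Cons.prems(1) by (cases row) auto
    then show ?case using Cons by (auto simp: len Let_def)
  qed auto
qed

lemma tri_form_eliminate:
  assumes "tri_shape ((d # c) # T)" "length xs = length T" "d \<noteq> 0"
  shows "tri_form (eliminate K d c T) xs + (dotp c xs)\<^sup>2 / (4 * of_int d) \<le> tri_form T xs"
proof -
  let ?u = "2 ^ K div (4 * d) + 1"
  have "of_int (2 ^ K) / of_int (4 * d) \<le> (of_int ?u :: real)"
    using real_of_int_div3[of "2 ^ K" "4 * d"] by linarith
  then have "1 / (4 * of_int d) * 2 ^ K \<le> (of_int ?u :: real)"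
    by simp
  then have "1 / (4 * of_int d) \<le> (of_int ?u / 2 ^ K :: real)"
    by (subst pos_le_divide_eq) auto
  then have "1 / (4 * of_int d) * (dotp c xs)\<^sup>2 \<le> of_int ?u / 2 ^ K * (dotp c xs)\<^sup>2"
    by (rule mult_right_mono) simp
  moreover have "0 \<le> (of_int (slack c) - 1 - real (nz_count c) / 2) * nz_sq c xs"
    by (intro mult_nonneg_nonneg nz_sq_nonneg) (simp add: slack_eq)
  moreover have "tri_form (eliminate K d c T) xs + of_int ?u / 2 ^ K * (dotp c xs)\<^sup>2
      + (of_int (slack c) - 1 - real (nz_count c) / 2) * nz_sq c xs \<le> tri_form T xs"
    unfolding eliminate_def by (rule tri_form_sub_square) (use assms in auto)
  ultimately show ?thesis by simp
qed

lemma tri_shape_eliminate: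
  assumes "tri_shape ((d # c) # T)"
  shows "tri_shape (eliminate K d c T)" "length (eliminate K d c T) = length T"
  using tri_shape_sub_square[of T c] assms by (auto simp: eliminate_def)

lemma complete_square:
  fixes d x L :: real
  assumes "d \<noteq> 0"
  shows "d * x\<^sup>2 + x * L + L\<^sup>2 / (4 * d) = d * (x + L / (2 * d))\<^sup>2"
  using assms by (simp add: power2_eq_square field_simps)

lemma psd_check_sound:
  assumes "psd_check K T" "tri_shape T" "length xs = length T"
  shows "0 \<le> tri_form T xs"
  using assms
proof (induction K T arbitrary: xs rule: psd_check.induct)
  case (3 K d c T)
  then obtain x ys where xs: "xs = x # ys" "length ys = length T" by (cases xs) auto
  have d: "0 < d" using 3 by simp
  have "0 \<le> tri_form (eliminate K d c T) ys"
    using 3 xs tri_shape_eliminate[OF 3(3)] by auto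
  also have "\<dots> \<le> tri_form T ys - (dotp c ys)\<^sup>2 / (4 * of_int d)"
    using tri_form_eliminate[OF 3(3) xs(2), of K] d by simp
  also have "\<dots> \<le> tri_form T ys - (dotp c ys)\<^sup>2 / (4 * of_int d)
      + of_int d * (x + dotp c ys / (2 * of_int d))\<^sup>2"
    using d by simp
  also have "\<dots> = tri_form ((d # c) # T) xs"
    using complete_square[of "of_int d" x "dotp c ys"] d xs by simp
  finally show ?case .
qed auto

lemma bordered_check_sound:
  assumes "bordered_check K i T" "tri_shape T" "Suc (length xs) = length T"
  shows "i \<le> length xs \<and> (\<exists>t. 0 \<le> tri_form T (take i xs @ t # drop i xs))"
  using assms
proof (induction K i T arbitrary: xs rule: bordered_check.induct)
  case (3 K i d c T)
  show ?case
  proof (cases i)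
    case 0
    then have d: "d < 0" using 3 by simp
    let ?t = "- dotp c xs / (2 * of_int d)"
    have "0 \<le> tri_form (eliminate K d c T) xs"
      using 3 0 tri_shape_eliminate[OF 3(3)] by (intro psd_check_sound[of K]) auto
    also have "\<dots> \<le> tri_form T xs - (dotp c xs)\<^sup>2 / (4 * of_int d)"
      using tri_form_eliminate[OF 3(3), of xs K] d 3 by simp
    also have "\<dots> = tri_form ((d # c) # T) (?t # xs)"
      using complete_square[of "of_int d" ?t "dotp c xs"] d by simp
    finally have "0 \<le> tri_form ((d # c) # T) (?t # xs)" .
    then have "\<exists>t. 0 \<le> tri_form ((d # c) # T) (t # xs)" by blast
    then show ?thesis using 0 by simp
  next
    case (Suc j)
    then have d: "0 < d" and chk: "bordered_check K j (eliminate K d c T)" using 3 by auto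
    have "T \<noteq> []"
    proof
      assume "T = []"
      then have "eliminate K d c T = []" using tri_shape_eliminate(2)[OF 3(3), of K] by simp
      then show False using chk by simp
    qed
    then obtain x ys where xs: "xs = x # ys" "Suc (length ys) = length T"
      using 3(4) by (cases xs) auto
    from 3(1)[OF Suc, of ys] chk tri_shape_eliminate[OF 3(3), of K] xs d
    obtain t where j: "j \<le> length ys"
      and t: "0 \<le> tri_form (eliminate K d c T) (take j ys @ t # drop j ys)" by auto
    let ?z = "take j ys @ t # drop j ys"
    have len: "length ?z = length T" using xs j by simp
    note t
    also have "tri_form (eliminate K d c T) ?z \<le> tri_form T ?z - (dotp c ?z)\<^sup>2 / (4 * of_int d)"
      using tri_form_eliminate[OF 3(3) len, of K] d by simp
    also have "\<dots> \<le> tri_form T ?z - (dotp c ?z)\<^sup>2 / (4 * of_int d)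
        + of_int d * (x + dotp c ?z / (2 * of_int d))\<^sup>2"
      using d by simp
    also have "\<dots> = tri_form ((d # c) # T) (x # ?z)"
      using complete_square[of "of_int d" x "dotp c ?z"] d by simp
    finally show ?thesis using Suc xs j by auto
  qed
qed auto

lemma dotp_add_lists:
  "length a = length b \<Longrightarrow> dotp (add_lists a b) xs = dotp a xs + dotp b xs"
proof (induction a b arbitrary: xs rule: list_induct2)
  case (Cons x xs y ys zs)
  then show ?case by (cases zs) (auto simp: algebra_simps)
qed auto

lemma full_form_Cons_column:
  assumes "\<forall>r\<in>set R. r \<noteq> []" "length R = length ys"
  shows "full_form R ys (x # xs) = x * dotp (map hd R) ys + full_form (map tl R) ys xs"
  using assms
proof (induction R arbitrary: ys)
  case (Cons r R)
  then obtain y zs where ys: "ys = y # zs" by (cases ys) auto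
  obtain a b where "r = a # b" using Cons.prems by (cases r) auto
  then show ?case using Cons ys by (simp add: algebra_simps)
qed auto

lemma tri_form_fold_tri:
  assumes "\<forall>r\<in>set R. length r = length xs" "length R = length xs"
  shows "tri_form (fold_tri R) xs = full_form R xs xs"
  using assms
proof (induction R arbitrary: xs rule: fold_tri.induct)
  case (2 r R)
  then obtain x ys where xs: "xs = x # ys" by (cases xs) auto
  obtain a b where r: "r = a # b" using 2 xs by (cases r) auto
  have "tri_form (fold_tri (map tl R)) ys = full_form (map tl R) ys ys"
    using 2 xs by auto
  moreover have "full_form R ys (x # ys) = x * dotp (map hd R) ys + full_form (map tl R) ys ys"
    using 2 xs by (intro full_form_Cons_column) auto
  moreover have "dotp (add_lists b (map hd R)) ys = dotp b ys + dotp (map hd R) ys"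
    using 2 xs r by (intro dotp_add_lists) auto
  ultimately show ?case using xs r by (simp add: power2_eq_square algebra_simps)
qed auto

lemma tri_shape_fold_tri:
  assumes "\<forall>r\<in>set R. length r = length R"
  shows "tri_shape (fold_tri R) \<and> length (fold_tri R) = length R"
proof -
  have len: "length a = length b \<Longrightarrow> length (add_lists a b) = length b" for a b
    by (induction a b rule: list_induct2) auto
  show ?thesis
    using assms by (induction R rule: fold_tri.induct) (auto simp: len)
qed

section \<open>The graph of nonzero vectors of the plane\<close>

text \<open>
  The vectors \<open>u\<^sup>\<plusminus>\<^sup>1 q\<close> and \<open>v\<^sup>\<plusminus>\<^sup>1 q\<close> in coordinates reduced modulo \<open>p\<close>.
\<close>

fun neighbours :: "nat \<Rightarrow> nat \<times> nat \<Rightarrow> (nat \<times> nat) list" where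
  "neighbours p (a, b) =
     [((a + b) mod p, b), ((a + (p - b)) mod p, b), (a, (b + a) mod p), (a, (b + (p - a)) mod p)]"

fun occurrences :: "nat \<times> nat \<Rightarrow> (nat \<times> nat) list \<Rightarrow> int" where
  "occurrences r [] = 0"
| "occurrences r (q # qs) =
     (if snd q = snd r \<and> fst q = fst r then 1 + occurrences r qs else occurrences r qs)"

text \<open>
  The form is \<open>m \<Sum> f(q)\<^sup>2 - s \<Sum> f(q) f(q')\<close> over pairs of neighbours, where vertices are identified
  by the map \<open>cls\<close>. The zero vector is not a vertex and no vertex has it as a neighbour; its slot
  is used for the multiplier of the condition that \<open>f\<close> has sum zero.
\<close>

definition graph_row ::
    "(nat \<times> nat \<Rightarrow> nat \<times> nat) \<Rightarrow> nat \<Rightarrow> int \<Rightarrow> int \<Rightarrow> (nat \<times> nat) list \<Rightarrow> nat \<times> nat \<Rightarrow> int list" where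
  "graph_row cls p m s rs q =
     (if q = (0, 0) then map (\<lambda>r. if r = (0, 0) then 0 else s) rs
      else let N = map cls (neighbours p q) in
        map (\<lambda>r. if r = (0, 0) then s else (if q = r then m else 0) - s * occurrences r N) rs)"

definition gap_check ::
    "(nat \<times> nat \<Rightarrow> nat \<times> nat) \<Rightarrow> nat \<Rightarrow> int \<Rightarrow> int \<Rightarrow> nat \<Rightarrow> nat \<Rightarrow> (nat \<times> nat) list \<Rightarrow> bool" where
  "gap_check cls p m s K i rs =
     (i < length rs \<and> rs ! i = (0, 0) \<and> distinct rs \<and>
      bordered_check K i (fold_tri (map (graph_row cls p m s rs) rs)))"

lemma dotp_map: "dotp (map g rs) (map f rs) = (\<Sum>r\<leftarrow>rs. of_int (g r) * f r)"
  by (induction rs) auto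

lemma full_form_map:
  "full_form (map G rs) (map f rs) xs = (\<Sum>q\<leftarrow>rs. f q * dotp (G q) xs)"
  by (induction rs) auto

lemma sum_occurrences:
  assumes "finite A" "set N \<subseteq> A"
  shows "(\<Sum>r\<in>A. of_int (occurrences r N) * f r) = (\<Sum>q\<leftarrow>N. f q :: real)"
  using assms
proof (induction N)
  case (Cons q N)
  have "(\<Sum>r\<in>A. of_int (occurrences r (q # N)) * f r)
      = (\<Sum>r\<in>A. (if r = q then f r else 0) + of_int (occurrences r N) * f r)"
    by (intro sum.cong refl) (auto simp: algebra_simps prod_eq_iff)
  also have "\<dots> = f q + (\<Sum>r\<in>A. of_int (occurrences r N) * f r)"
    using Cons.prems by (simp add: sum.distrib)
  finally show ?case using Cons by simp
qed auto

text \<open>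
  For an eigenfunction with eigenvalue \<open>\<kappa>\<close> and sum zero the form has the value
  \<open>(m - s \<kappa>) \<Sum> f(q)\<^sup>2\<close> for every multiplier. The check makes it nonnegative for some multiplier,
  although \<open>m < s \<kappa>\<close>.
\<close>

lemma gap_check_sound:
  fixes f :: "nat \<times> nat \<Rightarrow> real" and \<kappa> :: real
  assumes chk: "gap_check cls p m s K i rs"
    and D: "set rs = insert (0, 0) D" "(0, 0) \<notin> D"
    and cls: "\<And>q q'. q \<in> D \<Longrightarrow> q' \<in> set (neighbours p q) \<Longrightarrow> cls q' \<in> D \<and> f (cls q') = f q'"
    and eigen: "\<And>q. q \<in> D \<Longrightarrow> (\<Sum>q'\<leftarrow>neighbours p q. f q') = \<kappa> * f q"
    and mean: "(\<Sum>q\<in>D. f q) = 0"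
    and gap: "of_int m < of_int s * \<kappa>"
    and q: "q \<in> D"
  shows "f q = 0"
proof -
  have fin: "finite D" using D by (metis List.finite_set finite_insert)
  have dist: "distinct rs" and i: "i < length rs" "rs ! i = (0, 0)"
    using chk by (auto simp: gap_check_def)
  let ?R = "map (graph_row cls p m s rs) rs" and ?rs = "take i rs @ drop (Suc i) rs"
  have len: "length (graph_row cls p m s rs q) = length rs" for q
    by (simp add: graph_row_def Let_def)
  have shape: "tri_shape (fold_tri ?R)" "length (fold_tri ?R) = length rs"
    using tri_shape_fold_tri[of ?R] len by auto
  have rs: "rs = take i rs @ (0, 0) # drop (Suc i) rs"
    using i by (metis id_take_nth_drop)
  have bc: "bordered_check K i (fold_tri ?R)" using chk by (simp add: gap_check_def)
  have "Suc (length (map f ?rs)) = length (fold_tri ?R)"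
    using i shape by auto
  from bordered_check_sound[OF bc shape(1) this] obtain t where
    t: "0 \<le> tri_form (fold_tri ?R) (take i (map f ?rs) @ t # drop i (map f ?rs))"
    by blast
  \<comment> \<open>the value at the zero vector is free, so it can hold the multiplier\<close>
  define g where "g = f((0, 0) := t)"
  have g: "g r = f r" if "r \<in> D" for r using that D by (auto simp: g_def)
  have "(0, 0) \<notin> set (take i rs)" "(0, 0) \<notin> set (drop (Suc i) rs)"
    using dist rs by (metis distinct.simps(2) distinct_append IntI insertI1 list.set(2) empty_iff not_distinct_conv_prefix)+
  then have "map g (take i rs) = map f (take i rs)"
    "map g (drop (Suc i) rs) = map f (drop (Suc i) rs)"
    by (auto simp: g_def)
  then have "take i (map f ?rs) @ t # drop i (map f ?rs) = map g (take i rs @ (0, 0) # drop (Suc i) rs)"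
    using i by (simp add: g_def)
  also have "\<dots> = map g rs" using rs by simp
  finally have "0 \<le> tri_form (fold_tri ?R) (map g rs)" using t by simp
  also have "\<dots> = full_form ?R (map g rs) (map g rs)"
    by (rule tri_form_fold_tri) (auto simp: len)
  also have "\<dots> = (\<Sum>q\<in>set rs. g q * dotp (graph_row cls p m s rs q) (map g rs))"
    using dist by (simp add: full_form_map sum_list_distinct_conv_sum_set)
  also have "\<dots> = t * (of_int s * (\<Sum>r\<in>D. f r))
      + (\<Sum>q\<in>D. f q * (of_int s * t + of_int m * f q - of_int s * (\<kappa> * f q)))"
  proof -
    have 0: "dotp (graph_row cls p m s rs (0, 0)) (map g rs) = of_int s * (\<Sum>r\<in>D. f r)"
    proof -
      have "dotp (graph_row cls p m s rs (0, 0)) (map g rs)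
          = (\<Sum>r\<in>set rs. of_int (if r = (0, 0) then 0 else s) * g r)"
        using dist by (simp add: graph_row_def dotp_map sum_list_distinct_conv_sum_set)
      also have "\<dots> = (\<Sum>r\<in>D. of_int (if r = (0, 0) then 0 else s) * g r)"
        using fin D by simp
      also have "\<dots> = (\<Sum>r\<in>D. of_int s * f r)"
        using D(2) by (intro sum.cong) (auto simp: g)
      finally show ?thesis by (simp add: sum_distrib_left)
    qed
    have 1: "dotp (graph_row cls p m s rs q) (map g rs)
        = of_int s * t + of_int m * f q - of_int s * (\<kappa> * f q)" if q: "q \<in> D" for q
    proof -
      let ?N = "map cls (neighbours p q)"
      have N: "set ?N \<subseteq> D" using cls[OF q] by auto
      have q0: "q \<noteq> (0, 0)" using q D by auto
      have "dotp (graph_row cls p m s rs q) (map g rs)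
          = (\<Sum>r\<in>set rs. of_int (if r = (0, 0) then s else (if q = r then m else 0) - s * occurrences r ?N) * g r)"
        using dist q0
        by (simp add: graph_row_def Let_def dotp_map sum_list_distinct_conv_sum_set del: neighbours.simps)
      also have "\<dots> = of_int s * t
          + (\<Sum>r\<in>D. of_int (if r = (0, 0) then s else (if q = r then m else 0) - s * occurrences r ?N) * g r)"
        using fin D by (simp add: g_def)
      also have "(\<Sum>r\<in>D. of_int (if r = (0, 0) then s else (if q = r then m else 0) - s * occurrences r ?N) * g r)
          = (\<Sum>r\<in>D. (if r = q then of_int m * f r else 0) - of_int s * (of_int (occurrences r ?N) * f r))"
        using D(2) by (intro sum.cong) (auto simp: g algebra_simps)
      also have "\<dots> = of_int m * f q - of_int s * (\<Sum>r\<in>D. of_int (occurrences r ?N) * f r)"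
        using fin q by (simp add: sum_subtractf sum_distrib_left)
      also have "(\<Sum>r\<in>D. of_int (occurrences r ?N) * f r) = (\<Sum>q'\<leftarrow>neighbours p q. f (cls q'))"
        using sum_occurrences[OF fin N, of f] by (simp add: o_def del: neighbours.simps)
      also have "\<dots> = (\<Sum>q'\<leftarrow>neighbours p q. f q')"
        using cls[OF q] by (intro arg_cong[of _ _ sum_list] map_cong refl) auto
      finally show ?thesis by (simp add: eigen[OF q])
    qed
    show ?thesis
      using fin D by (simp add: 0 1 g cong: sum.cong) (simp add: g_def)
  qed
  also have "\<dots> = of_int s * t * (\<Sum>q\<in>D. f q) + (\<Sum>q\<in>D. (of_int m - of_int s * \<kappa>) * (f q)\<^sup>2)"
    by (simp add: mean power2_eq_square algebra_simps sum.distrib sum_subtractf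
        flip: sum_distrib_left)
  also have "\<dots> = (of_int m - of_int s * \<kappa>) * (\<Sum>q\<in>D. (f q)\<^sup>2)"
    by (simp add: mean sum_distrib_left)
  finally have "(\<Sum>q\<in>D. (f q)\<^sup>2) \<le> 0"
    using gap by (simp add: zero_le_mult_iff)
  then have "(\<Sum>q\<in>D. (f q)\<^sup>2) = 0"
    by (simp add: order_antisym sum_nonneg)
  then show ?thesis
    using fin q by (simp add: sum_nonneg_eq_0_iff)
qed

section \<open>Finite Fourier analysis for an isometry of finite order\<close>

lemma sum_shift_periodic:
  fixes g :: "nat \<Rightarrow> 'a::ab_group_add"
  assumes "\<And>k. g (k + p) = g k"
  shows "(\<Sum>k<p. g (k + m)) = (\<Sum>k<p. g k)"
proof (induction m)
  case (Suc m)
  have "(\<Sum>k<p. g (k + Suc m)) = (\<Sum>k<p. g (Suc k + m))" by simp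
  also have "\<dots> = (\<Sum>k<Suc p. g (k + m)) - g m"
    by (subst sum.lessThan_Suc_shift) simp
  also have "\<dots> = (\<Sum>k<p. g (k + m))"
    using assms[of m] by (simp add: add.commute)
  finally show ?case using Suc by simp
qed simp

lemma sum_cis_multiples:
  fixes m :: int and p :: nat
  assumes "p > 0"
  shows "(\<Sum>k<p. cis (2 * pi * m * k / p)) = (if int p dvd m then of_nat p else 0)"
proof -
  let ?z = "cis (2 * pi * m / p)"
  have pow: "cis (2 * pi * m * k / p) = ?z ^ k" for k :: nat
  proof -
    have "?z ^ k = cis (real k * (2 * pi * m / p))" by (rule Complex.DeMoivre)
    also have "real k * (2 * pi * m / p) = 2 * pi * m * k / p" by simp
    finally show ?thesis by (rule sym)
  qed
  have "?z ^ p = cis (2 * pi * m)"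
    using assms by (simp add: Complex.DeMoivre)
  then have zp: "?z ^ p = 1" by simp
  show ?thesis
  proof (cases "int p dvd m")
    case True
    then obtain l where "m = int p * l" by auto
    then have "?z = cis (2 * pi * l)" using assms by (simp add: mult_ac)
    then have "?z = 1" by simp
    then show ?thesis using True by (simp add: pow)
  next
    case False
    have "?z \<noteq> 1"
    proof
      assume "?z = 1"
      then have "cos (2 * pi * m / p) = 1" by (simp add: complex_eq_iff)
      then obtain l :: int where "2 * pi * m / p = l * 2 * pi"
        by (auto simp: cos_one_2pi_int)
      then have "real_of_int m = real_of_int (l * int p)"
        using assms by (simp add: field_simps)
      then have "m = l * int p" by linarith
      then show False using False by simp
    qed
    then show ?thesis using zp False by (simp add: pow geometric_sum)
  qed
qed

lemma sum_cos_multiples: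
  fixes m :: int and p :: nat
  assumes "p > 0"
  shows "(\<Sum>k<p. cos (2 * pi * m * k / p)) = (if int p dvd m then real p else 0)"
    and "(\<Sum>k<p. sin (2 * pi * m * k / p)) = 0"
  using arg_cong[OF sum_cis_multiples[OF assms, of m], of Re]
    arg_cong[OF sum_cis_multiples[OF assms, of m], of Im]
  by (auto split: if_splits)

lemma cos_sin_add_period:
  fixes p j k m :: nat
  assumes "p > 0"
  shows "cos (2 * pi * real j * (real k + real p - real m) / p) = cos (2 * pi * real j * (real k - real m) / p)"
    and "sin (2 * pi * real j * (real k + real p - real m) / p) = sin (2 * pi * real j * (real k - real m) / p)"
proof -
  have "2 * pi * real j * (real k + real p - real m) / p
      = 2 * pi * real j * (real k - real m) / p + 2 * pi * of_int (int j)"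
    using assms by (simp add: field_simps)
  then show "cos (2 * pi * real j * (real k + real p - real m) / p) = cos (2 * pi * real j * (real k - real m) / p)"
    "sin (2 * pi * real j * (real k + real p - real m) / p) = sin (2 * pi * real j * (real k - real m) / p)"
    by (simp_all add: cos_add sin_add del: of_int_of_nat_eq)
qed

text \<open>
  The eigenspace decomposition of an isometry \<open>r\<close> with \<open>r ^ p = 1\<close>, carried out in the real space:
  instead of complex eigenvectors only the squared lengths \<open>weight x j\<close> of the components of \<open>x\<close> of
  frequency \<open>2 \<pi> j / p\<close> are used.
\<close>

locale finite_order_isometry =
  fixes r :: "'h::real_inner \<Rightarrow> 'h" and p :: nat
  assumes orth: "orthogonal_transformation r"
    and order: "\<And>x. (r ^^ p) x = x"
    and pos: "p > 0"
begin

lemma iter_orth: "orthogonal_transformation (r ^^ k)"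
proof (induction k)
  case (Suc k)
  then show ?case
    using orthogonal_transformation_compose[OF orth Suc] by (simp add: o_def)
qed (simp add: id_def)

lemma linear_iter: "linear (r ^^ k)"
  using iter_orth by (rule orthogonal_transformation_linear)

lemma iter_inner [simp]: "(r ^^ k) x \<bullet> (r ^^ k) y = x \<bullet> y"
  using iter_orth by (simp add: orthogonal_transformation_def)

lemma iter_norm [simp]: "norm ((r ^^ k) x) = norm x"
  using iter_orth by (rule orthogonal_transformation_norm)

definition cos_part :: "'h \<Rightarrow> nat \<Rightarrow> 'h" where
  "cos_part x j = (\<Sum>k<p. cos (2 * pi * j * k / p) *\<^sub>R (r ^^ k) x)"

definition sin_part :: "'h \<Rightarrow> nat \<Rightarrow> 'h" where
  "sin_part x j = (\<Sum>k<p. sin (2 * pi * j * k / p) *\<^sub>R (r ^^ k) x)"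

definition weight :: "'h \<Rightarrow> nat \<Rightarrow> real" where
  "weight x j = ((norm (cos_part x j))\<^sup>2 + (norm (sin_part x j))\<^sup>2) / (real p)\<^sup>2"

lemma weight_nonneg: "0 \<le> weight x j"
  by (simp add: weight_def)

lemma parts_iter:
  "cos_part ((r ^^ m) x) j
     = cos (2 * pi * j * m / p) *\<^sub>R cos_part x j + sin (2 * pi * j * m / p) *\<^sub>R sin_part x j"
  "sin_part ((r ^^ m) x) j
     = cos (2 * pi * j * m / p) *\<^sub>R sin_part x j - sin (2 * pi * j * m / p) *\<^sub>R cos_part x j"
proof -
  let ?c = "\<lambda>n. cos (2 * pi * real j * (real n - real m) / p)"
  let ?s = "\<lambda>n. sin (2 * pi * real j * (real n - real m) / p)"
  have split: "2 * pi * real j * (real n - real m) / p = 2 * pi * j * n / p - 2 * pi * j * m / p" for n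
    by (simp add: algebra_simps diff_divide_distrib)
  have iter: "(r ^^ (k + p)) x = (r ^^ k) x" for k
    by (simp add: funpow_add order)
  have "cos_part ((r ^^ m) x) j = (\<Sum>k<p. ?c (k + m) *\<^sub>R (r ^^ (k + m)) x)"
    by (simp add: cos_part_def funpow_add)
  also have "\<dots> = (\<Sum>k<p. ?c k *\<^sub>R (r ^^ k) x)"
    using sum_shift_periodic[of "\<lambda>k. ?c k *\<^sub>R (r ^^ k) x" p m]
    by (simp only: iter of_nat_add cos_sin_add_period[OF pos])
  also have "\<dots> = cos (2 * pi * j * m / p) *\<^sub>R cos_part x j + sin (2 * pi * j * m / p) *\<^sub>R sin_part x j"
    by (simp only: split cos_diff cos_part_def sin_part_def scaleR_sum_right)
       (simp add: sum.distrib scaleR_add_left mult.commute)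
  finally show "cos_part ((r ^^ m) x) j
     = cos (2 * pi * j * m / p) *\<^sub>R cos_part x j + sin (2 * pi * j * m / p) *\<^sub>R sin_part x j" .
  have "sin_part ((r ^^ m) x) j = (\<Sum>k<p. ?s (k + m) *\<^sub>R (r ^^ (k + m)) x)"
    by (simp add: sin_part_def funpow_add)
  also have "\<dots> = (\<Sum>k<p. ?s k *\<^sub>R (r ^^ k) x)"
    using sum_shift_periodic[of "\<lambda>k. ?s k *\<^sub>R (r ^^ k) x" p m]
    by (simp only: iter of_nat_add cos_sin_add_period[OF pos])
  also have "\<dots> = cos (2 * pi * j * m / p) *\<^sub>R sin_part x j - sin (2 * pi * j * m / p) *\<^sub>R cos_part x j"
    by (simp only: split sin_diff cos_part_def sin_part_def scaleR_sum_right)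
       (simp add: sum_subtractf scaleR_diff_left mult.commute)
  finally show "sin_part ((r ^^ m) x) j
     = cos (2 * pi * j * m / p) *\<^sub>R sin_part x j - sin (2 * pi * j * m / p) *\<^sub>R cos_part x j" .
qed

lemma parts_sum:
  "cos_part (\<Sum>i\<in>I. c i *\<^sub>R y i) j = (\<Sum>i\<in>I. c i *\<^sub>R cos_part (y i) j)"
  "sin_part (\<Sum>i\<in>I. c i *\<^sub>R y i) j = (\<Sum>i\<in>I. c i *\<^sub>R sin_part (y i) j)"
  by (simp_all add: cos_part_def sin_part_def linear_sum[OF linear_iter] linear_cmul[OF linear_iter]
      scaleR_sum_right mult.commute) (subst sum.swap, rule refl)+

text \<open>
  A polynomial in \<open>r\<close> acts on the component of frequency \<open>j\<close> as multiplication by a complex number;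
  the factor is its squared modulus. The exponents are arbitrary so that polynomials in powers of \<open>r\<close>
  are covered.
\<close>

lemma weight_combination:
  "weight (\<Sum>i\<in>I. c i *\<^sub>R (r ^^ e i) x) j
    = ((\<Sum>i\<in>I. c i * cos (2 * pi * j * e i / p))\<^sup>2 + (\<Sum>i\<in>I. c i * sin (2 * pi * j * e i / p))\<^sup>2)
      * weight x j"
proof -
  let ?A = "\<Sum>i\<in>I. c i * cos (2 * pi * j * e i / p)"
  let ?B = "\<Sum>i\<in>I. c i * sin (2 * pi * j * e i / p)"
  let ?C = "cos_part x j" and ?S = "sin_part x j"
  have 1: "cos_part (\<Sum>i\<in>I. c i *\<^sub>R (r ^^ e i) x) j = ?A *\<^sub>R ?C + ?B *\<^sub>R ?S"
    by (simp add: parts_sum parts_iter scaleR_add_right sum.distrib scaleR_sum_left)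
  have 2: "sin_part (\<Sum>i\<in>I. c i *\<^sub>R (r ^^ e i) x) j = ?A *\<^sub>R ?S - ?B *\<^sub>R ?C"
    by (simp add: parts_sum parts_iter scaleR_diff_right sum_subtractf scaleR_sum_left)
  have "(norm (?A *\<^sub>R ?C + ?B *\<^sub>R ?S))\<^sup>2 + (norm (?A *\<^sub>R ?S - ?B *\<^sub>R ?C))\<^sup>2
      = (?A\<^sup>2 + ?B\<^sup>2) * ((norm ?C)\<^sup>2 + (norm ?S)\<^sup>2)"
    unfolding power2_norm_eq_inner
    by (simp add: inner_add_left inner_add_right inner_diff_left inner_diff_right
        inner_commute power2_eq_square algebra_simps)
  then show ?thesis
    by (simp add: weight_def 1 2)
qed

lemma plancherel: "(\<Sum>j<p. weight x j) = (norm x)\<^sup>2"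
proof -
  have "(norm (cos_part x j))\<^sup>2 + (norm (sin_part x j))\<^sup>2
      = (\<Sum>k<p. \<Sum>l<p. cos (2 * pi * real_of_int (int k - int l) * j / p) * ((r ^^ k) x \<bullet> (r ^^ l) x))" for j
  proof -
    have "cos (2 * pi * real_of_int (int k - int l) * j / p)
      = cos (2 * pi * j * k / p) * cos (2 * pi * j * l / p) + sin (2 * pi * j * k / p) * sin (2 * pi * j * l / p)" for k l
      unfolding cos_diff[symmetric] by (simp add: algebra_simps diff_divide_distrib)
    note cs = this
    show ?thesis
      unfolding power2_norm_eq_inner cos_part_def sin_part_def inner_sum_left
      unfolding inner_sum_right inner_scaleR_left inner_scaleR_right sum.distrib[symmetric]
      unfolding cs by (intro sum.cong refl) (simp only: ring_distribs mult_ac)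
  qed
  then have "(\<Sum>j<p. weight x j) * (real p)\<^sup>2
      = (\<Sum>j<p. \<Sum>k<p. \<Sum>l<p. cos (2 * pi * real_of_int (int k - int l) * j / p) * ((r ^^ k) x \<bullet> (r ^^ l) x))"
    using pos by (simp add: weight_def sum_divide_distrib[symmetric])
  also have "\<dots> = (\<Sum>k<p. \<Sum>j<p. \<Sum>l<p. cos (2 * pi * real_of_int (int k - int l) * j / p) * ((r ^^ k) x \<bullet> (r ^^ l) x))"
    by (rule sum.swap)
  also have "\<dots> = (\<Sum>k<p. \<Sum>l<p. \<Sum>j<p. cos (2 * pi * real_of_int (int k - int l) * j / p) * ((r ^^ k) x \<bullet> (r ^^ l) x))"
    by (intro sum.cong refl sum.swap)
  also have "\<dots> = (\<Sum>k<p. \<Sum>l<p. (if k = l then real p * (norm x)\<^sup>2 else 0))"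
  proof (intro sum.cong refl)
    fix k l assume "k \<in> {..<p}" "l \<in> {..<p}"
    then have "int p dvd int k - int l \<longleftrightarrow> k = l"
      by (auto dest!: zdvd_imp_le[rotated] simp: mod_eq_dvd_iff[symmetric] simp flip: of_nat_mod)
    then show "(\<Sum>j<p. cos (2 * pi * real_of_int (int k - int l) * j / p) * ((r ^^ k) x \<bullet> (r ^^ l) x))
        = (if k = l then real p * (norm x)\<^sup>2 else 0)"
      using sum_cos_multiples(1)[OF pos, of "int k - int l"]
      by (simp add: sum_distrib_right[symmetric] power2_norm_eq_inner)
  qed
  also have "\<dots> = (norm x)\<^sup>2 * (real p)\<^sup>2"
    by (simp add: power2_eq_square)
  finally show ?thesis using pos by simp
qed

lemma inner_iter: "(r ^^ m) x \<bullet> x = (\<Sum>j<p. weight x j * cos (2 * pi * j * m / p))"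
proof -
  \<comment> \<open>polarisation: compare the two expressions for the length of this vector\<close>
  define y where "y = x + (r ^^ m) x"
  have y: "y = (\<Sum>i\<in>{0, 1::nat}. 1 *\<^sub>R (r ^^ (i * m)) x)" by (simp add: y_def)
  have w: "weight y j = (2 + 2 * cos (2 * pi * j * m / p)) * weight x j" for j
  proof -
    have "(1 + c)\<^sup>2 + s\<^sup>2 = 2 + 2 * c" if "s\<^sup>2 + c\<^sup>2 = 1" for c s :: real
      using that by (simp add: power2_eq_square algebra_simps)
    then show ?thesis unfolding y weight_combination by simp
  qed
  have "(norm y)\<^sup>2 = 2 * (norm x)\<^sup>2 + 2 * ((r ^^ m) x \<bullet> x)"
    unfolding y_def power2_norm_eq_inner
    by (simp add: inner_add_left inner_add_right inner_commute)
  moreover have "(norm y)\<^sup>2 = (\<Sum>j<p. (2 + 2 * cos (2 * pi * j * m / p)) * weight x j)"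
    by (simp add: plancherel[symmetric] w)
  moreover have "\<dots> = 2 * (norm x)\<^sup>2 + 2 * (\<Sum>j<p. weight x j * cos (2 * pi * j * m / p))"
    by (simp add: plancherel[symmetric] algebra_simps sum.distrib sum_distrib_left)
  ultimately show ?thesis by simp
qed

lemma weight_zero:
  assumes "(\<Sum>k<p. (r ^^ k) x) = 0"
  shows "weight x 0 = 0"
  using assms by (simp add: weight_def cos_part_def sin_part_def)

text \<open>
  The projection onto the frequencies \<open>\<plusminus>1\<close>, \<open>\<plusminus>2\<close>, \<open>\<plusminus>3\<close>, as a polynomial in \<open>r\<close>. With \<open>r ^ e\<close> in place
  of \<open>r\<close> it selects the frequencies \<open>j\<close> for which \<open>e j\<close> is one of these modulo \<open>p\<close>.
\<close>

definition pass_coeff :: "nat \<Rightarrow> real" where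
  "pass_coeff k = (\<Sum>i\<in>{1,2,3::nat}. 2 / p * cos (2 * pi * i * k / p))"

definition pass_mult :: "nat \<Rightarrow> real" where
  "pass_mult n = (\<Sum>i\<in>{1,2,3::nat}. (if int p dvd int n + int i then 1 else 0) + (if int p dvd int n - int i then 1 else 0))"

definition low_pass :: "nat \<Rightarrow> 'h \<Rightarrow> 'h" where
  "low_pass e x = (\<Sum>k<p. pass_coeff k *\<^sub>R (r ^^ (e * k)) x)"

definition high_pass :: "'h \<Rightarrow> 'h" where
  "high_pass x = x - low_pass 1 x"

lemma sum_pass_coeff:
  "(\<Sum>k<p. pass_coeff k * cos (2 * pi * n * k / p)) = pass_mult n"
  "(\<Sum>k<p. pass_coeff k * sin (2 * pi * n * k / p)) = 0"
proof -
  have cc: "(\<Sum>k<p. cos (2 * pi * i * k / p) * cos (2 * pi * n * k / p))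
      = real p / 2 * ((if int p dvd int n + int i then 1 else 0) + (if int p dvd int n - int i then 1 else 0))"
    and cs: "(\<Sum>k<p. cos (2 * pi * i * k / p) * sin (2 * pi * n * k / p)) = 0" for i :: nat
  proof -
    have arg: "2 * pi * real_of_int (int n + int i) * k / p = 2 * pi * n * k / p + 2 * pi * i * k / p"
      "2 * pi * real_of_int (int n - int i) * k / p = 2 * pi * n * k / p - 2 * pi * i * k / p" for k :: nat
      by (simp_all add: algebra_simps add_divide_distrib diff_divide_distrib)
    have "(\<Sum>k<p. cos (2 * pi * i * k / p) * cos (2 * pi * n * k / p))
      = (\<Sum>k<p. (cos (2 * pi * real_of_int (int n + int i) * k / p) + cos (2 * pi * real_of_int (int n - int i) * k / p)) / 2)"
      by (simp only: arg cos_add cos_diff) (simp add: mult.commute)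
    also have "\<dots> = ((\<Sum>k<p. cos (2 * pi * real_of_int (int n + int i) * k / p))
        + (\<Sum>k<p. cos (2 * pi * real_of_int (int n - int i) * k / p))) / 2"
      by (simp only: sum.distrib sum_divide_distrib[symmetric])
    finally show "(\<Sum>k<p. cos (2 * pi * i * k / p) * cos (2 * pi * n * k / p))
      = real p / 2 * ((if int p dvd int n + int i then 1 else 0) + (if int p dvd int n - int i then 1 else 0))"
      unfolding sum_cos_multiples[OF pos] by (auto simp: field_simps)
    have "(\<Sum>k<p. cos (2 * pi * i * k / p) * sin (2 * pi * n * k / p))
      = (\<Sum>k<p. (sin (2 * pi * real_of_int (int n + int i) * k / p) + sin (2 * pi * real_of_int (int n - int i) * k / p)) / 2)"
      by (simp only: arg sin_add sin_diff) (simp add: mult.commute)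
    also have "\<dots> = ((\<Sum>k<p. sin (2 * pi * real_of_int (int n + int i) * k / p))
        + (\<Sum>k<p. sin (2 * pi * real_of_int (int n - int i) * k / p))) / 2"
      by (simp only: sum.distrib sum_divide_distrib[symmetric])
    finally show "(\<Sum>k<p. cos (2 * pi * i * k / p) * sin (2 * pi * n * k / p)) = 0"
      by (simp only: sum_cos_multiples[OF pos]) auto
  qed
  have swap: "(\<Sum>k<p. pass_coeff k * g k) = (\<Sum>i\<in>{1,2,3::nat}. 2 / p * (\<Sum>k<p. cos (2 * pi * i * k / p) * g k))"
    for g :: "nat \<Rightarrow> real"
    unfolding pass_coeff_def sum_distrib_right sum_distrib_left
    by (subst sum.swap) (simp only: mult.assoc)
  show "(\<Sum>k<p. pass_coeff k * cos (2 * pi * n * k / p)) = pass_mult n"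
    using pos unfolding swap cc pass_mult_def by (intro sum.cong refl) auto
  show "(\<Sum>k<p. pass_coeff k * sin (2 * pi * n * k / p)) = 0"
    unfolding swap cs by simp
qed

lemma weight_low_pass: "weight (low_pass e x) j = (pass_mult (j * e))\<^sup>2 * weight x j"
  using sum_pass_coeff[of "j * e"]
  unfolding low_pass_def weight_combination by (simp add: mult_ac)

lemma weight_high_pass: "weight (high_pass x) j = (1 - pass_mult j)\<^sup>2 * weight x j"
proof -
  let ?c = "\<lambda>k. (if k = 0 then 1 else 0) - pass_coeff k"
  have "high_pass x = (\<Sum>k<p. ?c k *\<^sub>R (r ^^ k) x)"
    using pos by (simp add: high_pass_def low_pass_def scaleR_diff_left sum_subtractf if_distrib[of "\<lambda>c. c *\<^sub>R _"] cong: if_cong)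
  moreover have "(\<Sum>k<p. ?c k * cos (2 * pi * j * k / p)) = 1 - pass_mult j"
    using pos sum_pass_coeff(1)[of j] by (simp add: left_diff_distrib sum_subtractf if_distrib[of "\<lambda>c. c * _"] cong: if_cong)
  moreover have "(\<Sum>k<p. ?c k * sin (2 * pi * j * k / p)) = 0"
    using pos sum_pass_coeff(2)[of j] by (simp add: left_diff_distrib sum_subtractf sum_negf if_distrib[of "\<lambda>c. c * _"] cong: if_cong)
  ultimately show ?thesis
    by (simp add: weight_combination)
qed

end

section \<open>Vectors of low frequency\<close>

lemma cos_multiple_le:
  fixes p i j :: nat
  assumes "i \<le> j" "i + j \<le> p" "j < p"
  shows "cos (2 * pi * j / p) \<le> cos (2 * pi * i / p)"
proof (cases "2 * j \<le> p")
  case True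
  then show ?thesis
    using assms by (intro cos_monotone_0_pi_le) (auto simp: field_simps simp flip: of_nat_mult)
next
  case False
  have eq: "2 * pi * (p - j) / p = 2 * pi - 2 * pi * j / p"
    using assms by (simp add: field_simps)
  have "cos (2 * pi * (p - j) / p) \<le> cos (2 * pi * i / p)"
  proof (intro cos_monotone_0_pi_le)
    show "2 * pi * real i / real p \<le> 2 * pi * real (p - j) / real p"
      using assms by (intro divide_right_mono mult_left_mono) (auto simp del: of_nat_diff)
    have "2 * real (p - j) \<le> real p"
      using False by linarith
    then show "2 * pi * real (p - j) / real p \<le> pi"
      using assms by (simp add: field_simps del: of_nat_diff)
  qed auto
  moreover have "cos (2 * pi * (p - j) / p) = cos (2 * pi * j / p)"
    unfolding eq by (simp add: cos_diff)
  ultimately show ?thesis by simp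
qed

lemma cos_multiple_mod:
  assumes "p > 0"
  shows "cos (2 * pi * real (j mod p) / real p) = cos (2 * pi * real j / real p)"
proof -
  have "real j = real p * real (j div p) + real (j mod p)"
    by (metis of_nat_add of_nat_mult mult_div_mod_eq)
  then have "2 * pi * real j / real p = 2 * pi * real (j mod p) / real p + 2 * pi * of_int (int (j div p))"
    using assms by (simp add: field_simps)
  then show ?thesis by (simp add: cos_add del: of_int_of_nat_eq)
qed

lemma cos_le_cos_first:
  assumes "\<not> p dvd j"
  shows "cos (2 * pi * real j / real p) \<le> cos (2 * pi / real p)"
proof (cases "p = 0")
  case False
  then have "0 < j mod p" "j mod p < p" using assms by (auto simp: dvd_eq_mod_eq_0)
  then show ?thesis
    using cos_multiple_le[of 1 "j mod p" p] cos_multiple_mod[of p j] False by simp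
qed simp

context finite_order_isometry
begin

lemma weighted_sum_nonneg:
  assumes "(\<Sum>k<p. (r ^^ k) x) = 0" "\<And>j. 0 < j \<Longrightarrow> j < p \<Longrightarrow> 0 \<le> g j"
  shows "0 \<le> (\<Sum>j<p. weight x j * g j)"
proof (rule sum_nonneg)
  fix j assume "j \<in> {..<p}"
  then show "0 \<le> weight x j * g j"
    using assms weight_nonneg[of x j] weight_zero[OF assms(1)] by (cases "j = 0") auto
qed

lemma weighted_trig_sum:
  "(\<Sum>j<p. weight x j * (a + b * cos (2 * pi * j * real m / p) + c * cos (2 * pi * j * real n / p)))
    = a * (norm x)\<^sup>2 + b * ((r ^^ m) x \<bullet> x) + c * ((r ^^ n) x \<bullet> x)"
  unfolding inner_iter plancherel[symmetric]
  by (simp add: distrib_left sum.distrib sum_distrib_left mult_ac)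

lemma inner_le_cos:
  assumes "(\<Sum>k<p. (r ^^ k) x) = 0"
  shows "r x \<bullet> x \<le> cos (2 * pi / p) * (norm x)\<^sup>2"
proof -
  have "0 \<le> (\<Sum>j<p. weight x j * (cos (2 * pi / p) - cos (2 * pi * j / p)))"
    using assms by (rule weighted_sum_nonneg) (auto intro!: cos_le_cos_first dest: dvd_imp_le)
  also have "\<dots> = cos (2 * pi / p) * (norm x)\<^sup>2 - r x \<bullet> x"
    using inner_iter[of 1 x]
    by (simp add: right_diff_distrib sum_subtractf plancherel[symmetric] sum_distrib_right[symmetric] mult.commute)
  finally show ?thesis by simp
qed

lemma pass_mult_mod: "pass_mult (n mod p) = pass_mult n"
proof -
  have "int p dvd int (n mod p) + k \<longleftrightarrow> int p dvd int n + k" for k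
    unfolding zmod_int by (metis dvd_eq_mod_eq_0 mod_add_left_eq)
  from this this[of "- _"] show ?thesis
    unfolding pass_mult_def by (simp only: diff_conv_add_uminus)
qed

lemma pass_mult_eq:
  assumes "j < p" "6 < p"
  shows "pass_mult j = (if j \<in> {1, 2, 3, p - 1, p - 2, p - 3} then 1 else 0)"
proof -
  have 1: "int p dvd int j + int i \<longleftrightarrow> j = p - i" if "i \<in> {1,2,3}" for i
  proof
    assume "int p dvd int j + int i"
    then obtain k where k: "int j + int i = int p * k" by auto
    have "0 < int p * k" using k that by auto
    then have "0 < k" by (simp add: zero_less_mult_iff)
    moreover have "k < 2"
    proof (rule ccontr)
      assume "\<not> k < 2"
      then have "int p * 2 \<le> int p * k" by (intro mult_left_mono) auto
      moreover have "int j + int i < int p * 2" using that assms by auto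
      ultimately show False using k by linarith
    qed
    ultimately have "k = 1" by simp
    then show "j = p - i" using k by simp
  next
    assume "j = p - i"
    then show "int p dvd int j + int i" using assms that by auto
  qed
  have 2: "int p dvd int j - int i \<longleftrightarrow> j = i" if "i \<in> {1,2,3}" for i
  proof
    assume "int p dvd int j - int i"
    moreover have "\<bar>int j - int i\<bar> < int p" using that assms by auto
    ultimately have "int j - int i = 0"
      using dvd_imp_le_int[of "int j - int i" "int p"] by linarith
    then show "j = i" by simp
  qed auto
  have "int p dvd int j + 1 \<longleftrightarrow> j = p - 1" "int p dvd int j + 2 \<longleftrightarrow> j = p - 2"
    "int p dvd int j + 3 \<longleftrightarrow> j = p - 3" "int p dvd int j - 1 \<longleftrightarrow> j = 1"
    "int p dvd int j - 2 \<longleftrightarrow> j = 2" "int p dvd int j - 3 \<longleftrightarrow> j = 3"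
    using 1[of 1] 1[of 2] 1[of 3] 2[of 1] 2[of 2] 2[of 3] by simp_all
  then have eq: "pass_mult j = (if j = p - 1 then 1 else 0) + (if j = 1 then 1 else 0)
      + ((if j = p - 2 then 1 else 0) + (if j = 2 then 1 else 0)
      + ((if j = p - 3 then 1 else 0) + (if j = 3 then 1 else 0)))"
    by (simp add: pass_mult_def)
  consider "j = 1" | "j = 2" | "j = 3" | "j = p - 1" | "j = p - 2" | "j = p - 3"
    | "j \<notin> {1, 2, 3, p - 1, p - 2, p - 3}" by blast
  then show ?thesis
    unfolding eq using assms by cases auto
qed

lemma norm_low_pass_le:
  assumes "6 < p"
  shows "norm (low_pass e x) \<le> norm x"
proof -
  have "(norm (low_pass e x))\<^sup>2 = (\<Sum>j<p. (pass_mult ((j * e) mod p))\<^sup>2 * weight x j)"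
    by (simp add: plancherel[symmetric] weight_low_pass pass_mult_mod)
  also have "\<dots> \<le> (\<Sum>j<p. 1 * weight x j)"
  proof (intro sum_mono mult_right_mono weight_nonneg)
    fix j
    show "(pass_mult ((j * e) mod p))\<^sup>2 \<le> 1"
      using pass_mult_eq[of "(j * e) mod p"] pos assms by simp
  qed
  also have "\<dots> = (norm x)\<^sup>2"
    by (simp add: plancherel)
  finally show ?thesis by (rule power2_le_imp_le) simp
qed

lemma low_pass_low_pass_eq_0:
  assumes "\<And>j. j < p \<Longrightarrow> pass_mult (j * e) * pass_mult j = 0"
  shows "low_pass e (low_pass 1 x) = 0"
proof -
  have "(norm (low_pass e (low_pass 1 x)))\<^sup>2
      = (\<Sum>j<p. (pass_mult (j * e) * pass_mult j)\<^sup>2 * weight x j)"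
    by (simp add: plancherel[symmetric] weight_low_pass power_mult_distrib mult.assoc)
  also have "\<dots> = 0"
    using assms by (intro sum.neutral) simp
  finally show ?thesis by simp
qed

lemma high_pass_iter: "high_pass ((r ^^ m) x) = (r ^^ m) (high_pass x)"
proof -
  have "(r ^^ (1 * k)) ((r ^^ m) x) = (r ^^ m) ((r ^^ (1 * k)) x)" for k
    by (metis add.commute comp_apply funpow_add)
  then show ?thesis
    by (simp only: high_pass_def low_pass_def linear_diff[OF linear_iter] linear_sum[OF linear_iter]
        linear_cmul[OF linear_iter])
qed

lemma linear_high_pass: "linear high_pass"
  unfolding high_pass_def[abs_def] low_pass_def
  by (intro linear_compose_sub linear_id[unfolded id_def] linear_compose_sum linear_compose_scale_right
      ballI linear_iter)

text \<open>
  A vector whose \<open>r x \<bullet> x\<close> is nearly maximal can have little weight on the frequencies from 4 on,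
  since each unit of such weight lowers \<open>r x \<bullet> x\<close> by at least \<open>D\<close>.
\<close>

lemma norm_high_pass_le:
  assumes zero: "(\<Sum>k<p. (r ^^ k) x) = 0" and p: "8 < p"
    and D: "D \<le> cos (2 * pi / p) - cos (2 * pi * 4 / p)" "0 \<le> D"
  shows "D * (norm (high_pass x))\<^sup>2 \<le> cos (2 * pi / p) * (norm x)\<^sup>2 - r x \<bullet> x"
proof -
  let ?C = "cos (2 * pi / p)"
  have "0 \<le> (\<Sum>j<p. weight x j * (?C - cos (2 * pi * j / p) - D * (1 - pass_mult j)\<^sup>2))"
  proof (rule weighted_sum_nonneg[OF zero])
    fix j assume j: "0 < j" "j < p"
    then have 1: "cos (2 * pi * j / p) \<le> ?C"
      by (intro cos_le_cos_first) (auto dest: dvd_imp_le)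
    show "0 \<le> ?C - cos (2 * pi * j / p) - D * (1 - pass_mult j)\<^sup>2"
    proof (cases "j \<in> {1, 2, 3, p - 1, p - 2, p - 3}")
      case True
      then show ?thesis using 1 pass_mult_eq[of j] j p by simp
    next
      case False
      then have "4 \<le> j" "4 + j \<le> p" using j by auto
      then have "cos (2 * pi * j / p) \<le> cos (2 * pi * 4 / p)"
        using cos_multiple_le[of 4 j p] j by simp
      then show ?thesis using False pass_mult_eq[of j] j p D by simp
    qed
  qed
  also have "\<dots> = ?C * (norm x)\<^sup>2 - r x \<bullet> x - D * (norm (high_pass x))\<^sup>2"
    using inner_iter[of 1 x]
    by (simp add: right_diff_distrib sum_subtractf plancherel[symmetric] weight_high_pass
        sum_distrib_left sum_distrib_right mult_ac)
  finally show ?thesis by simp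
qed

text \<open>
  With \<open>m = (p + 1) / 2\<close> the power \<open>r ^ m\<close> is the square root of \<open>r\<close> in the cyclic group. At frequency
  \<open>\<plusminus>1\<close> it rotates by nearly half a turn, so \<open>x + r ^ m x\<close> is short if \<open>r x \<bullet> x\<close> is nearly maximal.
  With \<open>y\<close> the cosine of the angle of \<open>r ^ m\<close>, the claim is the inequality \<open>E y \<ge> 0\<close> for a concave
  quadratic polynomial \<open>E\<close>, needed at the admissible \<open>y\<close> only.
\<close>

lemma norm_half_turn_le:
  assumes zero: "(\<Sum>k<p. (r ^^ k) x) = 0" and p: "odd p" "1 < p"
    and c: "cos (2 * pi / p) \<le> 0.946" "0.931 \<le> cos (2 * pi / p)"
  shows "(norm (x + (r ^^ ((p + 1) div 2)) x))\<^sup>2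
    \<le> 0.035 * (norm x)\<^sup>2 + 24.8 * (cos (2 * pi / p) * (norm x)\<^sup>2 - r x \<bullet> x)"
proof -
  let ?C = "cos (2 * pi / p)" and ?m = "(p + 1) div 2"
  have "0 \<le> (\<Sum>j<p. weight x j * (0.035 + 24.8 * (?C - cos (2 * pi * j / p)) - 2 - 2 * cos (2 * pi * j * ?m / p)))"
  proof (rule weighted_sum_nonneg[OF zero])
    fix j assume j: "0 < j" "j < p"
    define y where "y = cos (2 * pi * j * ?m / p)"
    have two_m: "real ?m = (real p + 1) / 2"
      using p by (auto elim!: oddE)
    have "2 * (2 * pi * j * ?m / p) = 2 * pi * j / p + 2 * pi * of_int (int j)"
      unfolding two_m using p by (simp add: field_simps)
    then have dbl: "cos (2 * pi * j / p) = 2 * y\<^sup>2 - 1"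
      unfolding y_def cos_double_cos[symmetric] by (simp add: cos_add del: of_int_of_nat_eq)
    have "coprime p ?m"
    proof -
      have "2 * ?m = p + 1" using p by (auto elim!: oddE)
      then have "coprime (2 * ?m) p" by (metis coprime_Suc_left_nat Suc_eq_plus1)
      then have "coprime ?m p" by (metis coprime_mult_left_iff)
      then show ?thesis by (metis coprime_commute)
    qed
    then have "\<not> p dvd j * ?m"
      using j by (auto simp: coprime_dvd_mult_left_iff dest: dvd_imp_le)
    from cos_le_cos_first[OF this] have y1: "y \<le> ?C" by (simp add: y_def mult.assoc)
    define E where "E z = 24.8 * (?C + 1 - 2 * z\<^sup>2) - 1.965 - 2 * z" for z
    have "\<not> p dvd j" using j by (auto dest: dvd_imp_le)
    then have "2 * y\<^sup>2 - 1 \<le> ?C"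
      using cos_le_cos_first[of p j] dbl by simp
    then have E1: "0 \<le> E y" if "y \<le> - 0.9825"
      unfolding E_def using that by (simp add: field_simps)
    have E2: "0 \<le> E y" if "- 0.9825 \<le> y"
    proof -
      have 1: "0 \<le> E (- 0.9825)" using c by (simp add: E_def power2_eq_square)
      have "?C\<^sup>2 \<le> 0.946 * ?C" using c unfolding power2_eq_square by (intro mult_right_mono) auto
      then have 2: "0 \<le> E ?C" using c by (simp add: E_def field_simps)
      \<comment> \<open>concavity: the value lies above the chord between the end points\<close>
      have "(?C + 0.9825) * E y = E (- 0.9825) * (?C - y) + E ?C * (y + 0.9825)
          + 49.6 * ((?C - y) * (y + 0.9825) * (?C + 0.9825))"
        by (simp add: E_def power2_eq_square field_simps)
      moreover have n: "0 \<le> ?C - y" "0 \<le> y + 0.9825" "0 \<le> ?C + 0.9825"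
        using that y1 c by (simp_all add: field_simps)
      note mult_nonneg_nonneg[OF 1 n(1)] mult_nonneg_nonneg[OF 2 n(2)]
        mult_nonneg_nonneg[OF mult_nonneg_nonneg[OF n(1,2)] n(3)]
      ultimately have "0 \<le> (?C + 0.9825) * E y" by simp
      then show ?thesis using c by (simp add: zero_le_mult_iff)
    qed
    show "0 \<le> 0.035 + 24.8 * (?C - cos (2 * pi * j / p)) - 2 - 2 * cos (2 * pi * j * ?m / p)"
    proof -
      have "0.035 + 24.8 * (?C - cos (2 * pi * j / p)) - 2 - 2 * cos (2 * pi * j * ?m / p) = E y"
        unfolding dbl y_def[symmetric] E_def by (simp add: field_simps)
      then show ?thesis using E1 E2 by linarith
    qed
  qed
  also have "\<dots> = (\<Sum>j<p. weight x j * ((0.035 + 24.8 * ?C - 2) + (- 24.8) * cos (2 * pi * j * real 1 / p)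
      + (- 2) * cos (2 * pi * j * real ?m / p)))"
    by (intro sum.cong refl) (simp add: algebra_simps)
  also have "\<dots> = 0.035 * (norm x)\<^sup>2 + 24.8 * (?C * (norm x)\<^sup>2 - r x \<bullet> x)
      - (2 * (norm x)\<^sup>2 + 2 * ((r ^^ ?m) x \<bullet> x))"
    unfolding weighted_trig_sum by (simp add: field_simps)
  also have "2 * (norm x)\<^sup>2 + 2 * ((r ^^ ?m) x \<bullet> x) = (norm (x + (r ^^ ?m) x))\<^sup>2"
    unfolding power2_norm_eq_inner by (simp add: inner_add_left inner_add_right inner_commute)
  finally show ?thesis by simp
qed

lemma pass_coeff_reflect:
  assumes "k \<le> p"
  shows "pass_coeff (p - k) = pass_coeff k"
proof -
  have "cos (2 * pi * i * real (p - k) / p) = cos (2 * pi * i * k / p)" for i :: nat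
  proof -
    have "2 * pi * i * real (p - k) / p = 2 * pi * of_int (int i) - 2 * pi * i * k / p"
      using assms pos by (simp add: field_simps)
    then show ?thesis by (simp add: cos_diff del: of_int_of_nat_eq)
  qed
  then show ?thesis by (simp only: pass_coeff_def)
qed

lemma pass_coeff_period: "pass_coeff (k + p) = pass_coeff k"
proof -
  have "cos (2 * pi * i * real (k + p) / p) = cos (2 * pi * i * k / p)" for i :: nat
  proof -
    have "2 * pi * i * real (k + p) / p = 2 * pi * i * k / p + 2 * pi * of_int (int i)"
      using pos by (simp add: field_simps)
    then show ?thesis by (simp add: cos_add del: of_int_of_nat_eq)
  qed
  then show ?thesis by (simp only: pass_coeff_def)
qed

lemma inner_low_pass: "low_pass 1 a \<bullet> b = a \<bullet> low_pass 1 b"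
proof -
  define F where "F k = pass_coeff k * (a \<bullet> (r ^^ k) b)" for k
  have "pass_coeff k * ((r ^^ k) a \<bullet> b) = F (Suc (p - Suc k))" if "k < p" for k
  proof -
    have eq: "Suc (p - Suc k) = p - k" using that by simp
    have "(r ^^ k) a \<bullet> b = (r ^^ (p - k)) ((r ^^ k) a) \<bullet> (r ^^ (p - k)) b"
      by simp
    also have "(r ^^ (p - k)) ((r ^^ k) a) = (r ^^ (p - k + k)) a"
      by (simp only: funpow_add comp_apply)
    also have "\<dots> = a" using that by (simp add: order)
    finally show ?thesis using that by (simp add: F_def eq pass_coeff_reflect)
  qed
  then have "low_pass 1 a \<bullet> b = (\<Sum>k<p. F (Suc (p - Suc k)))"
    by (simp add: low_pass_def inner_sum_left)
  also have "\<dots> = (\<Sum>k<p. F (Suc k))"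
    by (rule sum.nat_diff_reindex)
  also have "\<dots> = (\<Sum>k<p. F k)"
    using sum_shift_periodic[of F p 1] by (simp add: F_def pass_coeff_period funpow_add order)
  also have "\<dots> = a \<bullet> low_pass 1 b"
    by (simp add: F_def low_pass_def inner_sum_right)
  finally show ?thesis .
qed

end

text \<open>
  The isometry \<open>n\<close> carries \<open>v ^ (-4)\<close> to \<open>u\<close>, so it sends the \<open>v\<close>-frequencies \<open>\<plusminus>1\<close>, \<open>\<plusminus>2\<close>, \<open>\<plusminus>3\<close> to the
  \<open>u\<close>-frequencies \<open>\<plusminus>4\<close>, \<open>\<plusminus>8\<close>, \<open>\<plusminus>12\<close>. For \<open>p = 17\<close> and \<open>p = 19\<close> none of these is \<open>\<plusminus>1\<close>, \<open>\<plusminus>2\<close>, \<open>\<plusminus>3\<close>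
  modulo \<open>p\<close>; hence \<open>n x\<close> is orthogonal to \<open>y\<close> up to the high frequency parts of \<open>x\<close> and \<open>y\<close>.
\<close>

lemma nearly_orthogonal:
  assumes U: "finite_order_isometry u p" and V: "finite_order_isometry v p"
    and p: "p = 17 \<or> p = 19"
    and n: "orthogonal_transformation n" "\<And>y. u (n y) = n ((v ^^ (p - 4)) y)"
  shows "\<bar>n x \<bullet> y\<bar> \<le> norm (finite_order_isometry.high_pass v p x) * norm y
    + norm x * norm (finite_order_isometry.high_pass u p y)"
proof -
  interpret U: finite_order_isometry u p by fact
  interpret V: finite_order_isometry v p by fact
  have lin: "linear n" using n(1) by (rule orthogonal_transformation_linear)
  have nrm: "norm (n z) = norm z" for z using n(1) by (rule orthogonal_transformation_norm)
  have iter: "(u ^^ k) (n z) = n ((v ^^ ((p - 4) * k)) z)" for k z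
    by (induction k) (simp_all add: n(2) funpow_add)
  have mult: "V.pass_mult (j * (p - 4)) * V.pass_mult j = 0" if "j < p" for j
  proof (cases "j \<in> {1, 2, 3, p - 1, p - 2, p - 3}")
    case True
    then have "(j * (p - 4)) mod p \<notin> {1, 2, 3, p - 1, p - 2, p - 3}"
      using p by auto
    then have "V.pass_mult ((j * (p - 4)) mod p) = 0"
      using V.pass_mult_eq[of "(j * (p - 4)) mod p"] p by auto
    then show ?thesis by (simp add: V.pass_mult_mod)
  qed (use p that V.pass_mult_eq[of j] in auto)
  let ?z = "n (V.low_pass 1 x)"
  have "U.low_pass 1 ?z = n (V.low_pass (p - 4) (V.low_pass 1 x))"
    by (simp add: U.low_pass_def V.low_pass_def[of "p - 4"] iter linear_sum[OF lin] linear_cmul[OF lin])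
  also have "\<dots> = 0"
    by (simp only: V.low_pass_low_pass_eq_0[OF mult] linear_0[OF lin])
  finally have "?z \<bullet> U.low_pass 1 y = 0"
    unfolding U.inner_low_pass[symmetric] by simp
  moreover have "n x = ?z + n (V.high_pass x)" "y = U.low_pass 1 y + U.high_pass y"
    by (simp_all add: V.high_pass_def U.high_pass_def linear_diff[OF lin])
  ultimately have "n x \<bullet> y = n (V.high_pass x) \<bullet> y + ?z \<bullet> U.high_pass y"
    by (metis add.commute add_0 inner_add_left inner_add_right)
  moreover have "\<bar>n (V.high_pass x) \<bullet> y\<bar> \<le> norm (V.high_pass x) * norm y"
    using Cauchy_Schwarz_ineq2[of "n (V.high_pass x)" y] by (simp add: nrm)
  moreover have "\<bar>?z \<bullet> U.high_pass y\<bar> \<le> norm x * norm (U.high_pass y)"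
  proof -
    have "\<bar>?z \<bullet> U.high_pass y\<bar> \<le> norm (V.low_pass 1 x) * norm (U.high_pass y)"
      using Cauchy_Schwarz_ineq2[of ?z "U.high_pass y"] by (simp add: nrm)
    also have "\<dots> \<le> norm x * norm (U.high_pass y)"
      using p by (intro mult_right_mono V.norm_low_pass_le) auto
    finally show ?thesis .
  qed
  ultimately show ?thesis by linarith
qed

text \<open>
  Suppose \<open>x\<close> were concentrated at the frequencies \<open>\<plusminus>1\<close> of both \<open>u\<close> and \<open>v\<close>. In \<open>v\<^sup>2 = t n t\<close>, where \<open>t\<close>
  is the square root of \<open>u\<close>, the isometry \<open>t\<close> is nearly \<open>-1\<close> on \<open>x\<close>, so \<open>v\<^sup>2 x \<bullet> x\<close> is nearly
  \<open>n x \<bullet> x\<close>, which is nearly zero. But \<open>v\<^sup>2\<close> rotates \<open>x\<close> by the small angle \<open>4 \<pi> / p\<close>, so \<open>v\<^sup>2 x \<bullet> x\<close> is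
  far from zero. The constants make this quantitative: a deficit \<open>cos (2 \<pi> / p) - u x \<bullet> x\<close> of at most
  0.00735 bounds both high frequency parts by \<open>\<epsilon>\<close> and \<open>a = x + t x\<close> by 0.4662, and then
  \<open>v\<^sup>2 x \<bullet> x\<close> is at most \<open>4 \<epsilon> + 0.4662 \<epsilon> + 0.21728\<close>, while it is at least 0.7055.
\<close>

lemma no_common_low_frequency_vector:
  assumes U: "finite_order_isometry u p" and V: "finite_order_isometry v p"
    and p: "p = 17 \<or> p = 19"
    and zero: "(\<Sum>k<p. (u ^^ k) x) = 0" "(\<Sum>k<p. (v ^^ k) x) = 0"
    and n: "orthogonal_transformation n" "\<And>y. u (n y) = n ((v ^^ (p - 4)) y)"
    and n': "orthogonal_transformation n'" "\<And>y. u (n' y) = n' ((v ^^ (p - 4)) y)"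
    and adj: "\<And>a b. n a \<bullet> b = a \<bullet> n' b"
    and rel: "v (v x) = (u ^^ ((p + 1) div 2)) (n ((u ^^ ((p + 1) div 2)) x))"
    and sym: "u x \<bullet> x = v x \<bullet> x"
    and x: "norm x = 1"
    and C: "cos (2 * pi / p) \<le> 0.946" "0.931 \<le> cos (2 * pi / p)"
  shows "cos (2 * pi / p) - u x \<bullet> x > 0.00735"
proof (rule ccontr)
  interpret U: finite_order_isometry u p by fact
  interpret V: finite_order_isometry v p by fact
  let ?C = "cos (2 * pi / p)" and ?m = "(p + 1) div 2"
  assume "\<not> ?thesis"
  then have near: "?C - u x \<bullet> x \<le> 0.00735" by simp
  define \<epsilon> where "\<epsilon> = (0.1044 :: real)"
  define a where "a = x + (u ^^ ?m) x"
  define y where "y = (u ^^ (p - ?m)) x"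
  define b where "b = x + y"
  have m: "?m \<le> p" using p by auto
  have uy: "(u ^^ ?m) y = x"
  proof -
    have "(u ^^ ?m) y = (u ^^ (?m + (p - ?m))) x"
      unfolding y_def by (simp only: funpow_add comp_apply)
    then show ?thesis using m by (simp add: U.order)
  qed
  have C4: "cos (2 * pi * 4 / p) \<le> 0.2477"
  proof -
    have "cos (4 * t) = 2 * (2 * (cos t)\<^sup>2 - 1)\<^sup>2 - 1" for t :: real
      using cos_double_cos[of "2 * t"] cos_double_cos[of t] by simp
    from this[of "2 * pi / p"] have eq: "cos (2 * pi * 4 / p) = 2 * (2 * ?C\<^sup>2 - 1)\<^sup>2 - 1"
      by (simp add: mult.commute)
    have "0.931\<^sup>2 \<le> ?C\<^sup>2" "?C\<^sup>2 \<le> 0.946\<^sup>2" using C by (auto intro!: power_mono)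
    then have "(2 * ?C\<^sup>2 - 1)\<^sup>2 \<le> 0.789832\<^sup>2" by (intro power_mono) (auto simp: power2_eq_square)
    then show ?thesis unfolding eq by (simp add: power2_eq_square)
  qed
  have high: "norm h \<le> \<epsilon>" if "0.68 * (norm h)\<^sup>2 \<le> 0.00735" for h :: 'a
  proof (rule power2_le_imp_le)
    show "(norm h)\<^sup>2 \<le> \<epsilon>\<^sup>2" using that by (simp add: \<epsilon>_def power2_eq_square)
  qed (simp add: \<epsilon>_def)
  have D: "0.68 \<le> ?C - cos (2 * pi * 4 / p)" using C C4 by simp
  have hu: "norm (U.high_pass x) \<le> \<epsilon>" and hv: "norm (V.high_pass x) \<le> \<epsilon>"
    using U.norm_high_pass_le[OF zero(1) _ D] V.norm_high_pass_le[OF zero(2) _ D] p near sym x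
    by (auto intro!: high)
  have "(norm a)\<^sup>2 \<le> 0.035 + 24.8 * 0.00735"
  proof -
    have "odd p" "1 < p" using p by auto
    from U.norm_half_turn_le[OF zero(1) this C]
    have "(norm a)\<^sup>2 \<le> 0.035 * 1 + 24.8 * (?C * 1 - u x \<bullet> x)"
      unfolding a_def[symmetric] x by simp
    then show ?thesis using near by (simp add: field_simps)
  qed
  then have a2: "(norm a)\<^sup>2 \<le> 0.21728" by simp
  have a1: "norm a \<le> 0.4662"
    by (rule power2_le_imp_le) (use a2 in \<open>auto simp: power2_eq_square\<close>)
  have b: "norm b = norm a"
  proof -
    have "(u ^^ ?m) b = a"
      unfolding a_def b_def linear_add[OF U.linear_iter] uy by (rule add.commute)
    then show ?thesis by (metis U.iter_norm)
  qed
  have ny: "norm y = 1" "norm (U.high_pass y) \<le> \<epsilon>"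
    using x hu by (simp_all add: y_def U.high_pass_iter)
  have ha: "norm (U.high_pass a) \<le> 2 * \<epsilon>"
    using norm_triangle_ineq[of "U.high_pass x" "(u ^^ ?m) (U.high_pass x)"] hu
    by (simp add: a_def linear_add[OF U.linear_high_pass] U.high_pass_iter)
  have lin: "linear n" using n(1) by (rule orthogonal_transformation_linear)
  have "v (v x) \<bullet> x = n ((u ^^ ?m) x) \<bullet> y"
    unfolding rel by (metis uy U.iter_inner)
  also have "(u ^^ ?m) x = a - x" by (simp add: a_def)
  also have "n (a - x) \<bullet> y = - (n x \<bullet> y) - (n a \<bullet> x) + (n a \<bullet> b)"
    by (simp add: b_def linear_diff[OF lin] inner_diff_left inner_add_right)
  also have "n a \<bullet> x = n' x \<bullet> a" unfolding adj by (rule inner_commute)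
  finally have "v (v x) \<bullet> x = - (n x \<bullet> y) - (n' x \<bullet> a) + (n a \<bullet> b)" .
  moreover have "\<bar>n x \<bullet> y\<bar> \<le> \<epsilon> + \<epsilon>"
    using nearly_orthogonal[OF U V p n, of x y] hv ny x by simp
  moreover have "\<bar>n' x \<bullet> a\<bar> \<le> \<epsilon> * 0.4662 + 2 * \<epsilon>"
  proof -
    have "norm (V.high_pass x) * norm a \<le> \<epsilon> * 0.4662"
      using hv a1 by (intro mult_mono) (auto simp: \<epsilon>_def)
    then show ?thesis
      using nearly_orthogonal[OF U V p n', of x a] ha x by simp
  qed
  moreover have "\<bar>n a \<bullet> b\<bar> \<le> 0.21728"
    using Cauchy_Schwarz_ineq2[of "n a" b] a2 b n(1)
    by (simp add: orthogonal_transformation_norm power2_eq_square)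
  moreover have "0.7055 \<le> v (v x) \<bullet> x"
  proof -
    have "0 \<le> (\<Sum>j<p. V.weight x j * (cos (2 * pi * j * 2 / p) - (2 * ?C\<^sup>2 - 1) + 3.8 * (?C - cos (2 * pi * j / p))))"
    proof (rule V.weighted_sum_nonneg[OF zero(2)])
      fix j assume j: "0 < j" "j < p"
      let ?c = "cos (2 * pi * j / p)"
      have "?c \<le> ?C" using j by (intro cos_le_cos_first) (auto dest: dvd_imp_le)
      moreover have "cos (2 * pi * j * 2 / p) = 2 * ?c\<^sup>2 - 1"
        using cos_double_cos[of "2 * pi * j / p"] by (simp add: mult.commute mult.left_commute)
      moreover have "0 \<le> (?C - ?c) * (3.8 - 2 * (?C + ?c))"
        using calculation(1) C by (intro mult_nonneg_nonneg) auto
      ultimately show "0 \<le> cos (2 * pi * j * 2 / p) - (2 * ?C\<^sup>2 - 1) + 3.8 * (?C - ?c)"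
        by (simp add: power2_eq_square algebra_simps)
    qed
    also have "\<dots> = (\<Sum>j<p. V.weight x j * ((3.8 * ?C - (2 * ?C\<^sup>2 - 1)) + (- 3.8) * cos (2 * pi * j * real 1 / p)
        + 1 * cos (2 * pi * j * real 2 / p)))"
      by (intro sum.cong refl) (simp add: algebra_simps)
    also have "\<dots> = v (v x) \<bullet> x - (2 * ?C\<^sup>2 - 1) + 3.8 * (?C - v x \<bullet> x)"
      unfolding V.weighted_trig_sum x by (simp add: numeral_2_eq_2)
    finally have "2 * ?C\<^sup>2 - 1 - 3.8 * 0.00735 \<le> v (v x) \<bullet> x"
      using near sym by (simp add: field_simps)
    moreover have "0.931\<^sup>2 \<le> ?C\<^sup>2" using C by (auto intro!: power_mono)
    ultimately show ?thesis by (simp add: power2_eq_square)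
  qed
  ultimately show False by (simp add: \<epsilon>_def)
qed

section \<open>Numerical bounds for the cosine\<close>

lemma cos_upper:
  fixes x :: real
  shows "cos x \<le> 1 - x\<^sup>2 / 2 + x ^ 4 / 24"
proof -
  obtain t where "cos x = (\<Sum>m<4. cos_coeff m * x ^ m) + cos (t + 1/2 * real 4 * pi) / fact 4 * x ^ 4"
    using Maclaurin_cos_expansion[of x 4] by blast
  moreover have "cos (t + 1/2 * real 4 * pi) / fact 4 * x ^ 4 \<le> 1 / fact 4 * x ^ 4"
    by (intro mult_right_mono divide_right_mono) auto
  moreover have "{..<4::nat} = {0, 1, 2, 3}" by auto
  ultimately show ?thesis
    by (simp add: cos_coeff_def fact_numeral)
qed

lemma cos_lower:
  fixes x :: real
  shows "1 - x\<^sup>2 / 2 \<le> cos x"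
proof -
  obtain t where "cos x = (\<Sum>m<2. cos_coeff m * x ^ m) + cos (t + 1/2 * real 2 * pi) / fact 2 * x ^ 2"
    using Maclaurin_cos_expansion[of x 2] by blast
  moreover have "(- 1) / fact 2 * x ^ 2 \<le> cos (t + 1/2 * real 2 * pi) / fact 2 * x ^ 2"
    by (intro mult_right_mono divide_right_mono) auto
  ultimately show ?thesis
    by (simp add: cos_coeff_def eval_nat_numeral)
qed

lemma cos_2pi_div_le:
  fixes x p :: real
  assumes "0 \<le> x" "x \<le> 6.28 / p" "2 \<le> p"
  shows "cos (2 * pi / p) \<le> 1 - x\<^sup>2 / 2 + x ^ 4 / 24"
proof -
  have "6.28 / p \<le> 2 * pi / p" using pi_approx assms by (intro divide_right_mono) auto
  then have "cos (2 * pi / p) \<le> cos x"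
    using assms by (intro cos_monotone_0_pi_le) (auto simp: field_simps)
  then show ?thesis using cos_upper[of x] by simp
qed

text \<open>
  The proof needs sharp values for 17 and 19 only; for the smaller primes there is ample room.
\<close>

lemma cos_2pi_div_bounds:
  "cos (2 * pi / 3) \<le> 0.6" "cos (2 * pi / 5) \<le> 0.6" "cos (2 * pi / 7) \<le> 0.7"
  "cos (2 * pi / 11) \<le> 0.9" "cos (2 * pi / 13) \<le> 0.9"
  "cos (2 * pi / 17) \<le> 0.9326" "cos (2 * pi / 19) \<le> 0.946"
  "0.931 \<le> cos (2 * pi / 17)" "0.931 \<le> cos (2 * pi / 19)"
proof -
  show "cos (2 * pi / 3) \<le> 0.6" "cos (2 * pi / 5) \<le> 0.6" "cos (2 * pi / 7) \<le> 0.7"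
    "cos (2 * pi / 11) \<le> 0.9" "cos (2 * pi / 13) \<le> 0.9"
    "cos (2 * pi / 17) \<le> 0.9326" "cos (2 * pi / 19) \<le> 0.946"
    using cos_2pi_div_le[of "1" "3"] cos_2pi_div_le[of "1" "5"] cos_2pi_div_le[of "0.85" "7"]
      cos_2pi_div_le[of "0.5" "11"] cos_2pi_div_le[of "0.48" "13"] cos_2pi_div_le[of "0.3694" "17"]
      cos_2pi_div_le[of "0.3305" "19"]
    by (simp_all add: power2_eq_square power4_eq_xxxx)
  have "(2 * pi / q)\<^sup>2 \<le> (6.284 / q)\<^sup>2" if "0 < q" for q :: real
    using pi_approx that by (intro power_mono divide_right_mono) auto
  from this[of 17] this[of 19] show "0.931 \<le> cos (2 * pi / 17)" "0.931 \<le> cos (2 * pi / 19)"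
    using cos_lower[of "2 * pi / 17"] cos_lower[of "2 * pi / 19"]
    by (simp_all add: power2_eq_square)
qed

section \<open>Symmetric operators\<close>

text \<open>
  The ambient space may be infinite-dimensional; compactness of the unit sphere of the span of a finite
  set comes from that of a cube of coefficients with respect to an orthonormal basis.
\<close>

lemma compact_coefficient_box:
  fixes B :: "'h::real_normed_vector set"
  assumes "finite B"
  shows "compact ((\<lambda>c. \<Sum>b\<in>B. c b *\<^sub>R b) ` {c. \<forall>b\<in>B. \<bar>c b\<bar> \<le> (1::real)})"
  using assms
proof (induction B)
  case empty
  have "(\<lambda>c. \<Sum>b\<in>{}. c b *\<^sub>R b) ` {c. \<forall>b\<in>{}. \<bar>c b\<bar> \<le> (1::real)} = {0::'h}" by auto
  then show ?case by simp
next
  case (insert a B)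
  let ?K = "\<lambda>B. (\<lambda>c. \<Sum>b\<in>B. c b *\<^sub>R b) ` {c. \<forall>b\<in>B. \<bar>c b\<bar> \<le> (1::real)}"
  have "?K (insert a B) = (\<lambda>(t, x). t *\<^sub>R a + x) ` ({-1..1} \<times> ?K B)"
  proof (intro equalityI subsetI)
    fix x assume "x \<in> ?K (insert a B)"
    then obtain c where c: "\<forall>b\<in>insert a B. \<bar>c b\<bar> \<le> 1" "x = (\<Sum>b\<in>insert a B. c b *\<^sub>R b)" by auto
    then have "(c a, \<Sum>b\<in>B. c b *\<^sub>R b) \<in> {-1..1} \<times> ?K B" by auto
    moreover have "x = (\<lambda>(t, x). t *\<^sub>R a + x) (c a, \<Sum>b\<in>B. c b *\<^sub>R b)"
      using c insert by simp
    ultimately show "x \<in> (\<lambda>(t, x). t *\<^sub>R a + x) ` ({-1..1} \<times> ?K B)" by blast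
  next
    fix x assume "x \<in> (\<lambda>(t, x). t *\<^sub>R a + x) ` ({-1..1} \<times> ?K B)"
    then obtain t c where tc: "-1 \<le> t" "t \<le> 1" "\<forall>b\<in>B. \<bar>c b\<bar> \<le> 1" "x = t *\<^sub>R a + (\<Sum>b\<in>B. c b *\<^sub>R b)"
      by auto
    let ?c = "c(a := t)"
    have "(\<Sum>b\<in>B. c b *\<^sub>R b) = (\<Sum>b\<in>B. ?c b *\<^sub>R b)"
      using insert by (intro sum.cong) auto
    then have "x = (\<Sum>b\<in>insert a B. ?c b *\<^sub>R b)" using tc insert by simp
    moreover have "\<forall>b\<in>insert a B. \<bar>?c b\<bar> \<le> 1" using tc by auto
    ultimately show "x \<in> ?K (insert a B)" by blast
  qed
  moreover have "compact ((\<lambda>(t, x). t *\<^sub>R a + x) ` ({-1..1::real} \<times> ?K B))"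
    unfolding case_prod_unfold
    by (intro compact_continuous_image compact_Times insert.IH compact_Icc
        continuous_on_add continuous_on_scaleR continuous_on_fst continuous_on_snd
        continuous_on_id continuous_on_const)
  ultimately show ?case by simp
qed

lemma compact_unit_sphere_span:
  fixes S :: "'h::real_inner set"
  assumes "finite S"
  shows "compact {x \<in> span S. norm x = 1}"
proof -
  obtain C where C: "finite C" "span C = span S" "pairwise orthogonal C"
    using basis_orthogonal[OF assms] by auto
  let ?n = "\<lambda>b. b /\<^sub>R norm b"
  define B where "B = ?n ` (C - {0})"
  have B: "finite B" using C by (simp add: B_def)
  have one: "norm b = 1" if "b \<in> B" for b
  proof -
    obtain c where "c \<noteq> 0" "b = ?n c" using \<open>b \<in> B\<close> by (auto simp: B_def)
    then show ?thesis by simp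
  qed
  have orth: "a \<bullet> b = 0" if ab: "a \<in> B" "b \<in> B" "a \<noteq> b" for a b
  proof -
    obtain c d where cd: "c \<in> C" "d \<in> C" "a = ?n c" "b = ?n d" using ab by (auto simp: B_def)
    then have "orthogonal c d" using ab C(3) by (auto simp: pairwise_def)
    then show ?thesis using cd by (simp add: orthogonal_def)
  qed
  have "span B = span C"
  proof (rule span_eq[THEN iffD2], intro conjI subsetI)
    fix b assume "b \<in> B"
    then show "b \<in> span C" by (auto simp: B_def intro: span_mul span_base)
  next
    fix c assume c: "c \<in> C"
    show "c \<in> span B"
    proof (cases "c = 0")
      case False
      then have "?n c \<in> B" using c by (auto simp: B_def)
      then have "norm c *\<^sub>R ?n c \<in> span B" by (intro span_mul span_base)
      then show ?thesis using False by simp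
    qed (simp add: span_zero)
  qed
  let ?K = "(\<lambda>c. \<Sum>b\<in>B. c b *\<^sub>R b) ` {c. \<forall>b\<in>B. \<bar>c b\<bar> \<le> (1::real)}"
  have "{x \<in> span S. norm x = 1} = ?K \<inter> {x. norm x = 1}"
  proof (intro equalityI subsetI)
    fix x assume x: "x \<in> {x \<in> span S. norm x = 1}"
    then have "x \<in> span B" using C \<open>span B = span C\<close> by simp
    then obtain c where c: "x = (\<Sum>b\<in>B. c b *\<^sub>R b)"
      using span_finite[OF B] by auto
    have "\<bar>c b\<bar> \<le> 1" if b: "b \<in> B" for b
    proof -
      have "x \<bullet> b = (\<Sum>a\<in>B. if a = b then c b else 0)"
        unfolding c inner_sum_left using orth b one
        by (intro sum.cong) (auto simp: power2_norm_eq_inner[symmetric])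
      then have "x \<bullet> b = c b" using b B by simp
      then show ?thesis using Cauchy_Schwarz_ineq2[of x b] one[OF b] x by simp
    qed
    then show "x \<in> ?K \<inter> {x. norm x = 1}" using c x by auto
  next
    fix x assume x: "x \<in> ?K \<inter> {x. norm x = 1}"
    then obtain c where "x = (\<Sum>b\<in>B. c b *\<^sub>R b)" by auto
    then have "x \<in> span B" by (simp add: span_sum span_mul span_base)
    then show "x \<in> {x \<in> span S. norm x = 1}" using x C \<open>span B = span C\<close> by simp
  qed
  moreover have "closed {x::'h. norm x = 1}"
    by (rule closed_Collect_eq[OF continuous_on_norm[OF continuous_on_id] continuous_on_const])
  ultimately show ?thesis
    using compact_Int_closed[OF compact_coefficient_box[OF B]] by simp
qed

lemma quadratic_nonneg_linear_coeff:
  fixes b c :: real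
  assumes "\<And>t. 0 \<le> 2 * t * b + t\<^sup>2 * c"
  shows "b = 0"
proof (rule ccontr)
  assume b: "b \<noteq> 0"
  define d where "d = \<bar>c\<bar> + 1"
  have d: "d > 0" "c \<le> d" by (auto simp: d_def)
  have "2 * (- b / d) * b + (- b / d)\<^sup>2 * c \<le> 2 * (- b / d) * b + (- b / d)\<^sup>2 * d"
    using d by (intro add_left_mono mult_left_mono) auto
  also have "\<dots> = - (b\<^sup>2 / d)" using d by (simp add: field_simps power2_eq_square)
  also have "\<dots> < 0" using d b by simp
  finally show False using assms[of "- b / d"] by simp
qed

text \<open>
  The first variation of the Rayleigh quotient vanishes at its minimiser on the unit sphere of the
  invariant finite-dimensional subspace.
\<close>

lemma least_eigenvector:
  fixes T :: "'h::real_inner \<Rightarrow> 'h" and S :: "'h set"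
  assumes S: "finite S" and T: "bounded_linear T" "\<And>x. x \<in> span S \<Longrightarrow> T x \<in> span S"
    and sym: "\<And>x y. T x \<bullet> y = x \<bullet> T y"
    and \<xi>: "\<xi> \<in> span S" "\<xi> \<noteq> 0"
  obtains x l where "x \<in> span S" "norm x = 1" "T x = l *\<^sub>R x" "l * (norm \<xi>)\<^sup>2 \<le> T \<xi> \<bullet> \<xi>"
proof -
  interpret T: bounded_linear T by fact
  let ?U = "{x \<in> span S. norm x = 1}"
  have unit: "y /\<^sub>R norm y \<in> ?U" if "y \<in> span S" "y \<noteq> 0" for y
    using that by (auto intro: span_mul)
  have cont: "continuous_on ?U (\<lambda>x. T x \<bullet> x)"
    by (rule continuous_on_inner[OF T.continuous_on[OF continuous_on_id] continuous_on_id])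
  have "?U \<noteq> {}" using unit[OF \<xi>] by blast
  from continuous_attains_inf[OF compact_unit_sphere_span[OF S] this cont]
  obtain x where x: "x \<in> ?U" and least: "\<forall>y\<in>?U. T x \<bullet> x \<le> T y \<bullet> y" by (elim bexE)
  have min: "T x \<bullet> x \<le> T y \<bullet> y" if "y \<in> ?U" for y
    using least that by (rule bspec)
  define l where "l = T x \<bullet> x"
  have low: "l * (norm y)\<^sup>2 \<le> T y \<bullet> y" if "y \<in> span S" for y
  proof (cases "y = 0")
    case False
    have "l \<le> T (y /\<^sub>R norm y) \<bullet> (y /\<^sub>R norm y)"
      unfolding l_def by (rule min[OF unit[OF that False]])
    also have "\<dots> = (T y \<bullet> y) / (norm y)\<^sup>2"
      by (simp add: T.scaleR power2_eq_square field_simps)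
    finally show ?thesis using False by (simp add: field_simps)
  qed (simp add: T.zero)
  have "T x - l *\<^sub>R x = 0"
  proof -
    define y where "y = T x - l *\<^sub>R x"
    have y: "y \<in> span S" using x T(2) by (auto simp: y_def intro: span_diff span_mul)
    have e: "T y \<bullet> x = T x \<bullet> y" "y \<bullet> x = x \<bullet> y"
      using sym[of y x] by (simp_all add: inner_commute)
    have xy: "T x \<bullet> y - l * (x \<bullet> y) = y \<bullet> y"
      by (simp add: y_def inner_diff_left)
    have xx: "T x \<bullet> x = l * (x \<bullet> x)"
      using x by (simp add: l_def flip: power2_norm_eq_inner)
    have "0 \<le> 2 * t * (y \<bullet> y) + t\<^sup>2 * (T y \<bullet> y - l * (y \<bullet> y))" for t
    proof -
      have "x + t *\<^sub>R y \<in> span S" using x y by (auto intro: span_add span_mul)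
      from low[OF this] have "l * ((x + t *\<^sub>R y) \<bullet> (x + t *\<^sub>R y)) \<le> T (x + t *\<^sub>R y) \<bullet> (x + t *\<^sub>R y)"
        by (simp add: power2_norm_eq_inner)
      then have "0 \<le> 2 * t * (T x \<bullet> y - l * (x \<bullet> y)) + t\<^sup>2 * (T y \<bullet> y - l * (y \<bullet> y))"
        by (simp add: T.add T.scaleR inner_add_left inner_add_right e xx power2_eq_square algebra_simps)
      then show ?thesis by (simp only: xy)
    qed
    then have "y \<bullet> y = 0" by (rule quadratic_nonneg_linear_coeff)
    then show ?thesis by (simp add: y_def)
  qed
  then show thesis
    using that[of x l] x low[OF \<xi>(1)] by simp
qed

text \<open>
  For small \<open>r\<close> the map \<open>x \<mapsto> x - r T x + r y\<close> is a contraction, and its fixed point solves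
  \<open>T x = y\<close>.
\<close>

lemma coercive_invertible:
  fixes T :: "'h::{real_inner, complete_space} \<Rightarrow> 'h"
  assumes T: "bounded_linear T" and c: "0 < c" "\<And>x. c * (norm x)\<^sup>2 \<le> T x \<bullet> x"
  shows "\<exists>R. bounded_linear R \<and> (\<forall>x. R (T x) = x) \<and> (\<forall>x. T (R x) = x)"
proof -
  interpret T: bounded_linear T by fact
  obtain K where K: "0 < K" "\<And>x. norm (T x) \<le> norm x * K"
    using T.pos_bounded by auto
  have inj: "c * norm x \<le> norm (T x)" for x
  proof (cases "x = 0")
    case False
    have "c * norm x * norm x \<le> norm (T x) * norm x"
      using c(2)[of x] norm_cauchy_schwarz[of "T x" x] by (simp add: power2_eq_square mult.assoc)
    then show ?thesis using False by simp
  qed simp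
  define L where "L = K + c"
  have L: "K \<le> L" "c < L" "0 < L" using K c by (auto simp: L_def)
  define r where "r = c / L\<^sup>2"
  define q where "q = sqrt (1 - (c / L)\<^sup>2)"
  have r: "0 < r" using c L by (simp add: r_def)
  have cL: "0 < c / L" "c / L < 1" using c L by auto
  have q: "0 \<le> q" "q < 1" "q\<^sup>2 = 1 - (c / L)\<^sup>2"
  proof -
    have "(c / L)\<^sup>2 \<le> 1" using cL by (intro power_le_one) auto
    moreover have "0 < (c / L)\<^sup>2" using cL(1) by (rule zero_less_power)
    ultimately show "0 \<le> q" "q < 1" "q\<^sup>2 = 1 - (c / L)\<^sup>2"
      unfolding q_def by (simp_all only: real_sqrt_ge_0_iff real_sqrt_lt_1_iff real_sqrt_pow2 diff_ge_0_iff_ge)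
  qed
  have contr: "norm (x - r *\<^sub>R T x) \<le> q * norm x" for x
  proof (rule power2_le_imp_le)
    have "(norm (x - r *\<^sub>R T x))\<^sup>2 = (norm x)\<^sup>2 - 2 * r * (T x \<bullet> x) + r\<^sup>2 * (norm (T x))\<^sup>2"
      unfolding power2_norm_eq_inner
      by (simp add: inner_diff_left inner_diff_right inner_commute power2_eq_square algebra_simps)
    also have "\<dots> \<le> (norm x)\<^sup>2 - 2 * r * (c * (norm x)\<^sup>2) + r\<^sup>2 * (norm x * L)\<^sup>2"
    proof -
      have "2 * r * (c * (norm x)\<^sup>2) \<le> 2 * r * (T x \<bullet> x)"
        using c(2)[of x] r by simp
      moreover have "norm (T x) \<le> norm x * L"
        using K(2)[of x] mult_left_mono[OF L(1) norm_ge_zero[of x]] by linarith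
      then have "r\<^sup>2 * (norm (T x))\<^sup>2 \<le> r\<^sup>2 * (norm x * L)\<^sup>2"
        by (intro mult_left_mono power_mono) auto
      ultimately show ?thesis by linarith
    qed
    also have "\<dots> = (1 - 2 * (r * c) + r\<^sup>2 * L\<^sup>2) * (norm x)\<^sup>2"
      by (simp add: algebra_simps power_mult_distrib)
    also have "1 - 2 * (r * c) + r\<^sup>2 * L\<^sup>2 = 1 - (c / L)\<^sup>2"
    proof -
      have "r * c = (c / L)\<^sup>2" "r\<^sup>2 * L\<^sup>2 = (c / L)\<^sup>2"
        using L by (simp_all add: r_def power2_eq_square)
      then show ?thesis by simp
    qed
    also have "(1 - (c / L)\<^sup>2) * (norm x)\<^sup>2 = (q * norm x)\<^sup>2"
      by (simp only: power_mult_distrib q(3))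
    finally show "(norm (x - r *\<^sub>R T x))\<^sup>2 \<le> (q * norm x)\<^sup>2" .
  qed (use q in simp)
  have "\<exists>x. T x = y" for y
  proof -
    have "\<exists>!x. x - r *\<^sub>R T x + r *\<^sub>R y = x"
    proof (rule banach_fix_type[OF q(1,2)], intro allI)
      fix a b
      have eq: "(a - r *\<^sub>R T a + r *\<^sub>R y) - (b - r *\<^sub>R T b + r *\<^sub>R y) = (a - b) - r *\<^sub>R T (a - b)"
        by (simp add: T.diff scaleR_diff_right)
      show "dist (a - r *\<^sub>R T a + r *\<^sub>R y) (b - r *\<^sub>R T b + r *\<^sub>R y) \<le> q * dist a b"
        unfolding dist_norm eq by (rule contr)
    qed
    then obtain x where x: "x - r *\<^sub>R T x + r *\<^sub>R y = x" by blast
    have "r *\<^sub>R y - r *\<^sub>R T x = (x - r *\<^sub>R T x + r *\<^sub>R y) - x" by simp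
    also have "\<dots> = 0" unfolding x by simp
    finally have "T x = y" using r by simp
    then show ?thesis by blast
  qed
  then have "\<forall>y. \<exists>x. T x = y" by blast
  from choice[OF this] obtain R where R: "\<And>y. T (R y) = y" by blast
  have inj': "x = y" if "T x = T y" for x y
  proof -
    have "c * norm (x - y) \<le> 0" using inj[of "x - y"] that by (simp add: T.diff)
    then show ?thesis using c(1) by (simp add: mult_le_0_iff)
  qed
  have "bounded_linear R"
  proof (rule bounded_linear_intro)
    show "R (x + y) = R x + R y" for x y by (rule inj') (simp add: R T.add)
    show "R (a *\<^sub>R x) = a *\<^sub>R R x" for a x by (rule inj') (simp add: R T.scaleR)
    show "norm (R x) \<le> norm x * (1 / c)" for x
      using inj[of "R x"] c by (simp add: R field_simps)
  qed
  moreover have "R (T x) = x" for x by (rule inj') (simp add: R)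
  ultimately show ?thesis using R by blast
qed

section \<open>Prime fields\<close>

lemma CHAR_prime_field:
  assumes "prime p" "CARD('k::{field,finite}) = p"
  shows "CHAR('k) = p"
proof -
  have "CHAR('k) dvd p" using CHAR_dvd_CARD[where 'a = 'k] assms by simp
  moreover have "CHAR('k) \<noteq> 1" by simp
  ultimately show ?thesis using assms by (metis prime_nat_iff)
qed

lemma of_nat_eq_iff_prime_field:
  assumes "prime p" "CARD('k::{field,finite}) = p" "a < p" "b < p"
  shows "(of_nat a :: 'k) = of_nat b \<longleftrightarrow> a = b"
  using assms CHAR_prime_field[OF assms(1,2)]
  by (simp add: of_nat_eq_iff_cong_CHAR cong_def)

lemma of_nat_bij_prime_field:
  assumes "prime p" "CARD('k::{field,finite}) = p"
  shows "bij_betw (of_nat :: nat \<Rightarrow> 'k) {..<p} UNIV"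
proof -
  have inj: "inj_on (of_nat :: nat \<Rightarrow> 'k) {..<p}"
    using of_nat_eq_iff_prime_field[OF assms] by (auto intro: inj_onI)
  then have "card ((of_nat :: nat \<Rightarrow> 'k) ` {..<p}) = CARD('k)"
    using assms by (simp add: card_image)
  then have "(of_nat :: nat \<Rightarrow> 'k) ` {..<p} = UNIV"
    by (intro card_subset_eq) auto
  with inj show ?thesis by (simp add: bij_betw_def)
qed

lemma of_nat_prime_field:
  assumes "prime p" "CARD('k::{field,finite}) = p"
  obtains n where "n < p" "x = (of_nat n :: 'k)"
  using of_nat_bij_prime_field[OF assms] by (metis UNIV_I bij_betw_iff_bijections lessThan_iff)

lemma of_nat_mod_prime_field:
  assumes "prime p" "CARD('k::{field,finite}) = p"
  shows "(of_nat (n mod p) :: 'k) = of_nat n"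
  using CHAR_prime_field[OF assms] by (simp add: of_nat_eq_iff_cong_CHAR cong_def)

lemma of_nat_card_prime_field:
  assumes "prime p" "CARD('k::{field,finite}) = p"
  shows "(of_nat p :: 'k) = 0"
  using CHAR_prime_field[OF assms] by (metis of_nat_CHAR)

section \<open>Eigenfunctions on the nonzero vectors\<close>

text \<open>
  The quarter turn \<open>(a, b) \<mapsto> (b, -a)\<close> acts freely on the nonzero vectors. The representative of an
  orbit is the element with both coordinates in \<open>{0..p div 2}\<close> and the first one nonzero.
\<close>

fun quadrant :: "nat \<Rightarrow> nat \<times> nat \<Rightarrow> nat \<times> nat" where
  "quadrant p (a, b) =
     (let h = p div 2 in
      if 0 < a \<and> a \<le> h \<and> b \<le> h then (a, b)
      else if 0 < b \<and> b \<le> h then (b, (p - a) mod p)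
      else if h < a then (p - a, (p - b) mod p)
      else (p - b, a))"

definition grid :: "nat \<Rightarrow> (nat \<times> nat) set" where
  "grid p = {..<p} \<times> {..<p}"

definition quarter :: "nat \<Rightarrow> (nat \<times> nat) set" where
  "quarter p = {1..p div 2} \<times> {0..p div 2}"

lemma quadrant_in_quarter:
  assumes "odd p" "q \<in> grid p" "q \<noteq> (0, 0)"
  shows "quadrant p q \<in> quarter p"
proof -
  obtain a b where ab: "q = (a, b)" by (cases q)
  then have q: "q = (a, b)" "a < p" "b < p" "a \<noteq> 0 \<or> b \<noteq> 0"
    using assms by (auto simp: grid_def)
  obtain h where h: "p = 2 * h + 1" using assms(1) by (auto elim: oddE)
  have "(p - a) mod p = (if a = 0 then 0 else p - a)" "(p - b) mod p = (if b = 0 then 0 else p - b)"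
    using q by auto
  then show ?thesis using q h by (auto simp: Let_def quarter_def)
qed

lemma sum_quarter_turns:
  fixes f :: "nat \<times> nat \<Rightarrow> real"
  assumes p: "odd p" and f0: "f (0, 0) = 0"
    and rot: "\<And>a b. a < p \<Longrightarrow> b < p \<Longrightarrow> f (b, (p - a) mod p) = f (a, b)"
  shows "(\<Sum>q\<in>grid p. f q) = 4 * (\<Sum>q\<in>quarter p. f q)"
proof -
  obtain h where h: "p = 2 * h + 1" using p by (auto elim: oddE)
  define \<rho> where "\<rho> q = (snd q, (p - fst q) mod p)" for q :: "nat \<times> nat"
  define g where "g q = (if q \<in> quarter p then f q else 0)" for q
  have fin: "finite (grid p)" by (simp add: grid_def)
  have sub: "quarter p \<subseteq> grid p" using h by (auto simp: quarter_def grid_def)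
  have md: "(p - a) mod p = (if a = 0 then 0 else p - a)" if "a < p" for a
    using that by auto
  have p0: "0 < p" using h by simp
  have neg: "(p - (p - a) mod p) mod p = a" if "a < p" for a
    using that by (cases "a = 0") auto
  have \<rho>_grid: "\<rho> q \<in> grid p" if "q \<in> grid p" for q
    using that h by (auto simp: \<rho>_def grid_def)
  have f\<rho>: "f (\<rho> q) = f q" if "q \<in> grid p" for q
    using that rot by (auto simp: \<rho>_def grid_def)
  have shift: "(\<Sum>q\<in>grid p. k (\<rho> q)) = (\<Sum>q\<in>grid p. k q)" for k :: "nat \<times> nat \<Rightarrow> real"
    by (rule sum.reindex_bij_witness[of _ "\<lambda>q. ((p - snd q) mod p, fst q)" \<rho>])
       (auto simp: \<rho>_def grid_def neg p0)
  have split: "f q = g q + g (\<rho> q) + g (\<rho> (\<rho> q)) + g (\<rho> (\<rho> (\<rho> q)))" if q: "q \<in> grid p" for q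
  proof (cases "q = (0, 0)")
    case True
    then show ?thesis using f0 by (simp add: g_def \<rho>_def quarter_def)
  next
    case False
    obtain a b where ab: "q = (a, b)" "a < p" "b < p" using q by (auto simp: grid_def)
    have "(if q \<in> quarter p then 1 else 0) + (if \<rho> q \<in> quarter p then 1 else 0)
      + (if \<rho> (\<rho> q) \<in> quarter p then 1 else 0) + (if \<rho> (\<rho> (\<rho> q)) \<in> quarter p then 1 else 0) = (1 :: real)"
      using False ab h by (cases "a = 0"; cases "b = 0"; cases "a \<le> h"; cases "b \<le> h")
        (auto simp: \<rho>_def quarter_def)
    then have "f q = f q * ((if q \<in> quarter p then 1 else 0) + (if \<rho> q \<in> quarter p then 1 else 0)
      + (if \<rho> (\<rho> q) \<in> quarter p then 1 else 0) + (if \<rho> (\<rho> (\<rho> q)) \<in> quarter p then 1 else 0))"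
      by simp
    moreover have "g q = f q * (if q \<in> quarter p then 1 else 0)"
      "g (\<rho> q) = f q * (if \<rho> q \<in> quarter p then 1 else 0)"
      "g (\<rho> (\<rho> q)) = f q * (if \<rho> (\<rho> q) \<in> quarter p then 1 else 0)"
      "g (\<rho> (\<rho> (\<rho> q))) = f q * (if \<rho> (\<rho> (\<rho> q)) \<in> quarter p then 1 else 0)"
      using q by (simp_all add: g_def f\<rho> \<rho>_grid)
    ultimately show ?thesis by (simp only: distrib_left)
  qed
  have "(\<Sum>q\<in>grid p. f q)
      = (\<Sum>q\<in>grid p. g q) + (\<Sum>q\<in>grid p. g (\<rho> q)) + (\<Sum>q\<in>grid p. g (\<rho> (\<rho> q))) + (\<Sum>q\<in>grid p. g (\<rho> (\<rho> (\<rho> q))))"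
    by (simp only: sum.distrib[symmetric]) (intro sum.cong refl split)
  also have "\<dots> = 4 * (\<Sum>q\<in>grid p. g q)"
    using shift[of g] shift[of "\<lambda>q. g (\<rho> q)"] shift[of "\<lambda>q. g (\<rho> (\<rho> q))"] by simp
  also have "(\<Sum>q\<in>grid p. g q) = (\<Sum>q\<in>quarter p. f q)"
    unfolding g_def using sub fin by (simp add: sum.If_cases Int_absorb1)
  finally show ?thesis .
qed

text \<open>
  The positivity check succeeded at the threshold \<open>m / s \<le> 4 - 2 c\<^sup>2\<close>: on the whole graph for the
  smallest primes, and on its quotient by quarter turns from 11 on, which is four times smaller.
\<close>

definition gap_certificate :: "nat \<Rightarrow> real \<Rightarrow> bool" where
  "gap_certificate p c \<longleftrightarrow> (\<exists>m s K i rs. of_int m \<le> of_int s * (4 - 2 * c\<^sup>2) \<and> 0 < s \<and>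
     (if p < 11 then gap_check id p m s K i rs \<and> set rs = grid p
      else gap_check (quadrant p) p m s K i rs \<and> set rs = insert (0, 0) (quarter p)))"

text \<open>
  Transport to the coordinates \<open>{..<p}\<close> and to the quotient by quarter turns. Summing the eigenvalue
  equation over all vectors gives \<open>\<kappa> \<Sum> F = 4 \<Sum> F\<close>; this is why \<open>\<kappa> \<noteq> 4\<close> provides the sum zero that
  the check requires.
\<close>

lemma no_eigenfunction:
  fixes F :: "'k::{field,finite} \<Rightarrow> 'k \<Rightarrow> real" and \<kappa> c :: real
  assumes p: "prime p" "CARD('k) = p" "odd p"
    and cert: "gap_certificate p c"
    and eigen: "\<And>a b. (a, b) \<noteq> (0, 0) \<Longrightarrow>
      F (a + b) b + F (a - b) b + F a (b + a) + F a (b - a) = \<kappa> * F a b"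
    and rot: "\<And>a b. (a, b) \<noteq> (0, 0) \<Longrightarrow> 11 \<le> p \<Longrightarrow> F b (- a) = F a b"
    and \<kappa>: "4 - 2 * c\<^sup>2 < \<kappa>" "\<kappa> \<noteq> 4"
    and ab: "(a, b) \<noteq> (0, 0)"
  shows "F a b = 0"
proof -
  have p0: "0 < p" using p by (simp add: prime_gt_0_nat)
  define G where "G q = (if q = (0, 0) then 0 else F (fst q) (snd q))" for q
  define f where "f q = G (of_nat (fst q), of_nat (snd q))" for q :: "nat \<times> nat"
  note card0 = of_nat_card_prime_field[OF p(1,2)]
  note modp = of_nat_mod_prime_field[OF p(1,2)]
  have minus: "of_nat (p - n) = - (of_nat n :: 'k)" if "n \<le> p" for n
    using that of_nat_card_prime_field[OF p(1,2)] by (simp add: of_nat_diff)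
  have zero_iff: "((of_nat x, of_nat y) = (0 :: 'k, 0 :: 'k)) \<longleftrightarrow> (x, y) = (0, 0)" if "x < p" "y < p" for x y
    using of_nat_eq_iff_prime_field[OF p(1,2), of x 0] of_nat_eq_iff_prime_field[OF p(1,2), of y 0] that p0 by simp
  have mean: "(\<Sum>q\<in>UNIV. G q) = 0"
  proof -
    have s: "(\<Sum>q\<in>UNIV. G (\<phi> q)) = (\<Sum>q\<in>UNIV. G q)" if "\<And>q. \<psi> (\<phi> q) = q" "\<And>q. \<phi> (\<psi> q) = q" for \<phi> \<psi>
      by (rule sum.reindex_bij_witness[of _ \<psi> \<phi>]) (auto simp: that)
    have e: "\<kappa> * G q = G (fst q + snd q, snd q) + G (fst q - snd q, snd q)
        + G (fst q, snd q + fst q) + G (fst q, snd q - fst q)" for q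
    proof (cases "q = (0, 0)")
      case True
      then show ?thesis by (simp add: G_def)
    next
      case False
      then have nz: "(fst q, snd q) \<noteq> (0, 0)" "(fst q + snd q, snd q) \<noteq> (0, 0)" "(fst q - snd q, snd q) \<noteq> (0, 0)"
        "(fst q, snd q + fst q) \<noteq> (0, 0)" "(fst q, snd q - fst q) \<noteq> (0, 0)"
        by (auto simp: prod_eq_iff)
      show ?thesis
        using eigen[OF nz(1)] False unfolding G_def if_not_P[OF nz(2)] if_not_P[OF nz(3)]
          if_not_P[OF nz(4)] if_not_P[OF nz(5)] by simp
    qed
    have "\<kappa> * (\<Sum>q\<in>UNIV. G q) = 4 * (\<Sum>q\<in>UNIV. G q)"
      unfolding sum_distrib_left[of \<kappa>] e sum.distrib
      using s[of "\<lambda>q. (fst q - snd q, snd q)" "\<lambda>q. (fst q + snd q, snd q)"]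
        s[of "\<lambda>q. (fst q + snd q, snd q)" "\<lambda>q. (fst q - snd q, snd q)"]
        s[of "\<lambda>q. (fst q, snd q - fst q)" "\<lambda>q. (fst q, snd q + fst q)"]
        s[of "\<lambda>q. (fst q, snd q + fst q)" "\<lambda>q. (fst q, snd q - fst q)"]
      by simp
    then show ?thesis using \<kappa> by simp
  qed
  have mean_grid: "(\<Sum>q\<in>grid p. f q) = 0"
  proof -
    have "bij_betw (map_prod of_nat of_nat :: _ \<Rightarrow> 'k \<times> 'k) (grid p) UNIV"
      using bij_betw_map_prod[OF of_nat_bij_prime_field[OF p(1,2)] of_nat_bij_prime_field[OF p(1,2)]]
      by (simp add: grid_def)
    from sum.reindex_bij_betw[OF this, of G] show ?thesis
      using mean by (simp add: f_def map_prod_def case_prod_unfold)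
  qed
  have nb_grid: "q' \<in> grid p - {(0, 0)}"
    if q: "q \<in> grid p" "q \<noteq> (0, 0)" and q': "q' \<in> set (neighbours p q)" for q q'
  proof -
    obtain x y where xy: "q = (x, y)" "x < p" "y < p" using q by (auto simp: grid_def)
    have 1: "q' \<in> grid p" using q' xy p0 by (auto simp: grid_def)
    moreover have "(of_nat (fst q'), of_nat (snd q')) \<noteq> (0 :: 'k, 0 :: 'k)"
      using q' xy zero_iff[of x y] q by (auto simp: modp minus card0 less_imp_le)
    ultimately show ?thesis by auto
  qed
  have eigen_f: "(\<Sum>q'\<leftarrow>neighbours p q. f q') = \<kappa> * f q" if q: "q \<in> grid p" "q \<noteq> (0, 0)" for q
  proof -
    obtain x y where xy: "q = (x, y)" "x < p" "y < p" using q by (auto simp: grid_def)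
    have "(of_nat x, of_nat y) \<noteq> (0 :: 'k, 0 :: 'k)" using zero_iff[of x y] xy q by simp
    from eigen[OF this] this show ?thesis
      using xy by (auto simp: f_def G_def modp minus card0 less_imp_le)
  qed
  obtain x y where xy: "x < p" "y < p" "a = of_nat x" "b = of_nat y"
    using of_nat_prime_field[OF p(1,2)] by metis
  then have xy0: "(x, y) \<in> grid p" "(x, y) \<noteq> (0, 0)"
    using ab zero_iff[of x y] by (auto simp: grid_def)
  have Ff: "F a b = f (x, y)" using xy ab by (auto simp: f_def G_def)
  obtain m s K i rs where cert': "of_int m \<le> of_int s * (4 - 2 * c\<^sup>2)" "0 < s"
    "if p < 11 then gap_check id p m s K i rs \<and> set rs = grid p
      else gap_check (quadrant p) p m s K i rs \<and> set rs = insert (0, 0) (quarter p)"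
    using cert unfolding gap_certificate_def by blast
  have gap: "of_int m < of_int s * \<kappa>"
    using cert'(1,2) \<kappa>(1) by (meson le_less_trans mult_strict_left_mono of_int_0_less_iff)
  show ?thesis
  proof (cases "p < 11")
    case True
    let ?D = "grid p - {(0, 0)}"
    have "(0, 0) \<in> grid p" using p0 by (simp add: grid_def)
    then have D: "set rs = insert (0, 0) ?D" "(0, 0) \<notin> ?D" using cert'(3) True by auto
    have "(\<Sum>q\<in>?D. f q) = 0"
      using mean_grid \<open>(0, 0) \<in> grid p\<close> by (simp add: sum_diff1 grid_def f_def G_def)
    note mean_D = this
    have chk: "gap_check id p m s K i rs" using cert'(3) True by simp
    have "f (x, y) = 0"
    proof (rule gap_check_sound[OF chk D _ _ mean_D gap])
      fix q q' assume q: "q \<in> ?D" "q' \<in> set (neighbours p q)"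
      then have "q' \<in> ?D" by (intro nb_grid[of q]) auto
      then show "id q' \<in> ?D \<and> f (id q') = f q'" by simp
    next
      fix q assume "q \<in> ?D"
      then show "(\<Sum>q'\<leftarrow>neighbours p q. f q') = \<kappa> * f q" by (intro eigen_f) auto
    next
      show "(x, y) \<in> ?D" using xy0 by simp
    qed
    then show ?thesis by (simp add: Ff)
  next
    case False
    have rot_f: "f (v, (p - u) mod p) = f (u, v)" if "u < p" "v < p" for u v
    proof (cases "(u, v) = (0, 0)")
      case True
      then show ?thesis by simp
    next
      case uv: False
      then have "(of_nat u, of_nat v) \<noteq> (0 :: 'k, 0 :: 'k)" using zero_iff[of u v] that by simp
      then show ?thesis using rot[of "of_nat u" "of_nat v"] False that
        by (auto simp: f_def G_def modp minus card0 less_imp_le)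
    qed
    have quad: "f (quadrant p q) = f q" if "q \<in> grid p" "q \<noteq> (0, 0)" for q
    proof -
      obtain u v where "q = (u, v)" by (cases q)
      then have uv: "q = (u, v)" "u < p" "v < p" using that by (simp_all add: grid_def)
      have 1: "f (v, (p - u) mod p) = f (u, v)" using rot_f uv by simp
      have 2: "f ((p - u) mod p, (p - v) mod p) = f (u, v)"
        using rot_f[of v "(p - u) mod p"] uv p0 1 by simp
      have 3: "f ((p - v) mod p, (p - (p - u) mod p) mod p) = f (u, v)"
        using rot_f[of "(p - u) mod p" "(p - v) mod p"] p0 2 by simp
      have "(p - (p - u) mod p) mod p = u"
        using uv by (cases "u = 0") auto
      then show ?thesis
        using 1 2 3 uv that by (auto simp: Let_def)
    qed
    have sub: "q \<in> grid p" "q \<noteq> (0, 0)" if "q \<in> quarter p" for q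
      using that p(3) p0 by (auto simp: quarter_def grid_def elim!: oddE)
    have "(\<Sum>q\<in>quarter p. f q) = 0"
      using sum_quarter_turns[OF p(3), of f] rot_f mean_grid by (simp add: f_def G_def)
    note mean_D = this
    have chk: "gap_check (quadrant p) p m s K i rs" and D: "set rs = insert (0, 0) (quarter p)"
      using cert'(3) False by simp_all
    have D0: "(0, 0) \<notin> quarter p" by (simp add: quarter_def)
    have "f (quadrant p (x, y)) = 0"
    proof (rule gap_check_sound[OF chk D D0 _ _ mean_D gap])
      fix q q' assume q: "q \<in> quarter p" "q' \<in> set (neighbours p q)"
      then have "q' \<in> grid p - {(0, 0)}" by (intro nb_grid[of q] sub)
      then show "quadrant p q' \<in> quarter p \<and> f (quadrant p q') = f q'"
        using quad[of q'] quadrant_in_quarter[OF p(3), of q'] by blast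
    next
      fix q assume "q \<in> quarter p"
      then show "(\<Sum>q'\<leftarrow>neighbours p q. f q') = \<kappa> * f q" by (intro eigen_f sub)
    next
      show "quadrant p (x, y) \<in> quarter p" using xy0 by (rule quadrant_in_quarter[OF p(3)])
    qed
    then show ?thesis using quad[OF xy0] by (simp add: Ff del: quadrant.simps)
  qed
qed

section \<open>Two by two matrices\<close>

definition mat2 :: "'k::zero \<Rightarrow> 'k \<Rightarrow> 'k \<Rightarrow> 'k \<Rightarrow> 'k ^ 2 ^ 2" where
  "mat2 a b c d = vector [vector [a, b], vector [c, d]]"

lemma mat2_nth [simp]:
  "mat2 a b c d $ 1 $ 1 = a" "mat2 a b c d $ 1 $ 2 = b"
  "mat2 a b c d $ 2 $ 1 = c" "mat2 a b c d $ 2 $ 2 = d"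
  by (simp_all add: mat2_def)

lemma mat2_eqI:
  assumes "A $ 1 $ 1 = a" "A $ 1 $ 2 = b" "A $ 2 $ 1 = c" "A $ 2 $ 2 = d"
  shows "A = mat2 a b c d"
  using assms by (simp add: vec_eq_iff forall_2)

lemma mat2_eq_iff: "mat2 a b c d = mat2 a' b' c' d' \<longleftrightarrow> a = a' \<and> b = b' \<and> c = c' \<and> d = d'"
  by (auto simp: vec_eq_iff forall_2)

lemma mat2_mult:
  fixes a :: "'k::comm_ring_1"
  shows "mat2 a b c d ** mat2 a' b' c' d' = mat2 (a * a' + b * c') (a * b' + b * d') (c * a' + d * c') (c * b' + d * d')"
  by (rule mat2_eqI) (simp_all add: matrix_matrix_mult_def sum_2)

lemma mat_1_eq_mat2: "(mat 1 :: 'k::comm_ring_1 ^ 2 ^ 2) = mat2 1 0 0 1"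
  by (rule mat2_eqI) (simp_all add: mat_def)

lemma mat2_in_SL: "mat2 a b c d \<in> carrier SL \<longleftrightarrow> a * d - b * c = 1"
  by (simp add: SL_def det_2)

lemma elementary_matrices_eq:
  "(elementary_matrices :: ('k::comm_ring_1 ^ 2 ^ 2) set)
    = {mat2 1 1 0 1, mat2 1 (-1) 0 1, mat2 1 0 1 1, mat2 1 0 (-1) 1}"
proof (intro equalityI subsetI)
  fix A :: "'k ^ 2 ^ 2"
  assume "A \<in> elementary_matrices"
  then obtain i j where ij: "i \<noteq> j" "A $ i $ j = 1 \<or> A $ i $ j = -1"
    and A: "\<And>k l. (k, l) \<noteq> (i, j) \<Longrightarrow> A $ k $ l = mat 1 $ k $ l"
    unfolding elementary_matrices_def by blast
  consider "i = 1" "j = 2" | "i = 2" "j = 1"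
    using ij(1) exhaust_2[of i] exhaust_2[of j] by auto
  then show "A \<in> {mat2 1 1 0 1, mat2 1 (-1) 0 1, mat2 1 0 1 1, mat2 1 0 (-1) 1}"
  proof cases
    case 1
    then have "A = mat2 1 (A $ 1 $ 2) 0 1"
      using A[of 1 1] A[of 2 2] A[of 2 1] by (intro mat2_eqI) (auto simp: mat_def)
    then show ?thesis using ij(2) 1 by auto
  next
    case 2
    then have "A = mat2 1 0 (A $ 2 $ 1) 1"
      using A[of 1 1] A[of 2 2] A[of 1 2] by (intro mat2_eqI) (auto simp: mat_def)
    then show ?thesis using ij(2) 2 by auto
  qed
next
  fix A :: "'k ^ 2 ^ 2"
  assume A: "A \<in> {mat2 1 1 0 1, mat2 1 (-1) 0 1, mat2 1 0 1 1, mat2 1 0 (-1) 1}"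
  have upper: "mat2 1 s 0 1 \<in> elementary_matrices" if "s = 1 \<or> s = (-1 :: 'k)" for s
    unfolding elementary_matrices_def
    by (rule CollectI, rule exI[of _ 1], rule exI[of _ 2]) (use that in \<open>auto simp: forall_2 mat_def\<close>)
  have lower: "mat2 1 0 s 1 \<in> elementary_matrices" if "s = 1 \<or> s = (-1 :: 'k)" for s
    unfolding elementary_matrices_def
    by (rule CollectI, rule exI[of _ 2], rule exI[of _ 1]) (use that in \<open>auto simp: forall_2 mat_def\<close>)
  show "A \<in> elementary_matrices" using A upper lower by auto
qed

section \<open>Orthogonal representations\<close>

locale sl2_rep =
  fixes \<pi> :: "'k::{field,finite} ^ 2 ^ 2 \<Rightarrow> 'h::real_inner \<Rightarrow> 'h" and p :: nat
  assumes hom: "\<pi> \<in> orthogonal_reps SL"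
    and prime: "prime p" and card: "CARD('k) = p" and odd: "odd p"
begin

definition \<rho> :: "'k \<Rightarrow> 'k \<Rightarrow> 'k \<Rightarrow> 'k \<Rightarrow> 'h \<Rightarrow> 'h" where
  "\<rho> a b c d = \<pi> (mat2 a b c d)"

lemma \<rho>_mult:
  assumes "a * d - b * c = 1" "a' * d' - b' * c' = 1"
  shows "\<rho> a b c d (\<rho> a' b' c' d' x)
    = \<rho> (a * a' + b * c') (a * b' + b * d') (c * a' + d * c') (c * b' + d * d') x"
proof -
  have "\<pi> (mat2 a b c d \<otimes>\<^bsub>SL\<^esub> mat2 a' b' c' d') = \<pi> (mat2 a b c d) \<otimes>\<^bsub>orthogonal_group\<^esub> \<pi> (mat2 a' b' c' d')"
    using hom assms by (intro hom_mult) (auto simp: mat2_in_SL)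
  then show ?thesis by (simp add: \<rho>_def SL_def orthogonal_group_def mat2_mult)
qed

lemma \<pi>_orth: "g \<in> carrier SL \<Longrightarrow> orthogonal_transformation (\<pi> g)"
  using hom_in_carrier[OF hom] by (simp add: orthogonal_group_def)

lemma \<rho>_orth: "a * d - b * c = 1 \<Longrightarrow> orthogonal_transformation (\<rho> a b c d)"
  by (simp add: \<rho>_def \<pi>_orth mat2_in_SL)

lemma \<rho>_inner: "a * d - b * c = 1 \<Longrightarrow> \<rho> a b c d x \<bullet> \<rho> a b c d y = x \<bullet> y"
  using \<rho>_orth by (auto simp: orthogonal_transformation_def)

lemma \<rho>_one [simp]: "\<rho> 1 0 0 1 x = x"
proof -
  have "\<rho> 1 0 0 1 (\<rho> 1 0 0 1 x) = \<rho> 1 0 0 1 x"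
    by (subst \<rho>_mult) auto
  moreover have "inj (\<rho> 1 0 0 1)"
    by (intro orthogonal_transformation_inj \<rho>_orth) simp
  ultimately show ?thesis by (auto dest: injD)
qed

lemma \<rho>_adjoint:
  assumes "a * d - b * c = 1"
  shows "\<rho> a b c d x \<bullet> y = x \<bullet> \<rho> d (-b) (-c) a y"
proof -
  have "\<rho> a b c d (\<rho> d (-b) (-c) a y) = y"
    using assms by (subst \<rho>_mult) (auto simp: algebra_simps)
  then show ?thesis by (metis \<rho>_inner[OF assms])
qed

definition U :: "'k \<Rightarrow> 'h \<Rightarrow> 'h" where "U s = \<rho> 1 s 0 1"
definition V :: "'k \<Rightarrow> 'h \<Rightarrow> 'h" where "V s = \<rho> 1 0 s 1"
definition W :: "'h \<Rightarrow> 'h" where "W = \<rho> 0 1 (-1) 0"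

lemma U_add: "U s (U t x) = U (s + t) x"
  unfolding U_def by (subst \<rho>_mult) (simp_all add: add.commute)

lemma V_add: "V s (V t x) = V (s + t) x"
  unfolding V_def by (subst \<rho>_mult) (simp_all add: add.commute)

lemma U_0 [simp]: "U 0 x = x" and V_0 [simp]: "V 0 x = x"
  by (simp_all add: U_def V_def)

lemma UV_orth: "orthogonal_transformation (U s)" "orthogonal_transformation (V s)"
  "orthogonal_transformation W"
  by (simp_all add: U_def V_def W_def \<rho>_orth)

lemma UV_linear: "linear (U s)" "linear (V s)" "linear W"
  using UV_orth by (simp_all add: orthogonal_transformation_def)

lemma UV_norm [simp]: "norm (U s x) = norm x" "norm (V s x) = norm x" "norm (W x) = norm x"
  using UV_orth by (simp_all add: orthogonal_transformation)

lemma W_inner [simp]: "W x \<bullet> W y = x \<bullet> y"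
  using UV_orth(3) by (simp add: orthogonal_transformation_def)

lemma U_adjoint: "U s x \<bullet> y = x \<bullet> U (- s) y"
  unfolding U_def by (subst \<rho>_adjoint) simp_all

lemma V_adjoint: "V s x \<bullet> y = x \<bullet> V (- s) y"
  unfolding V_def by (subst \<rho>_adjoint) simp_all

lemma U_self: "U (- s) x \<bullet> x = U s x \<bullet> x" and V_self: "V (- s) x \<bullet> x = V s x \<bullet> x"
  by (metis U_adjoint inner_commute) (metis V_adjoint inner_commute)

lemma W_U: "W (U s x) = V (- s) (W x)"
proof -
  have "W (U s x) = \<rho> 0 1 (-1) (- s) x" unfolding W_def U_def by (subst \<rho>_mult) simp_all
  moreover have "V (- s) (W x) = \<rho> 0 1 (-1) (- s) x" unfolding W_def V_def by (subst \<rho>_mult) simp_all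
  ultimately show ?thesis by simp
qed

lemma W_V: "W (V s x) = U (- s) (W x)"
proof -
  have "W (V s x) = \<rho> s 1 (-1) 0 x" unfolding W_def V_def by (subst \<rho>_mult) simp_all
  moreover have "U (- s) (W x) = \<rho> s 1 (-1) 0 x" unfolding W_def U_def by (subst \<rho>_mult) simp_all
  ultimately show ?thesis by simp
qed

lemma W_four: "W (W (W (W x))) = x"
proof -
  have "W (W y) = \<rho> (-1) 0 0 (-1) y" for y unfolding W_def by (subst \<rho>_mult) simp_all
  then have "W (W (W (W x))) = \<rho> (-1) 0 0 (-1) (\<rho> (-1) 0 0 (-1) x)" by simp
  also have "\<dots> = x" by (subst \<rho>_mult) simp_all
  finally show ?thesis .
qed

lemma W_words: "W x = U 1 (V (-1) (U 1 x))" "W x = V (-1) (U 1 (V (-1) x))"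
proof -
  have "V (-1) (U 1 x) = \<rho> 1 1 (-1) 0 x" unfolding U_def V_def by (subst \<rho>_mult) simp_all
  then show "W x = U 1 (V (-1) (U 1 x))" unfolding U_def W_def by (simp, subst \<rho>_mult) simp_all
  have "U 1 (V (-1) x) = \<rho> 0 1 (-1) 1 x" unfolding U_def V_def by (subst \<rho>_mult) simp_all
  then show "W x = V (-1) (U 1 (V (-1) x))" unfolding V_def W_def by (simp, subst \<rho>_mult) simp_all
qed

lemma U_iter: "(U s ^^ k) x = U (of_nat k * s) x"
  by (induction k) (simp_all add: U_add algebra_simps)

lemma V_iter: "(V s ^^ k) x = V (of_nat k * s) x"
  by (induction k) (simp_all add: V_add algebra_simps)

lemma finite_order_U: "finite_order_isometry (U 1) p" and finite_order_V: "finite_order_isometry (V 1) p"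
  using UV_orth prime of_nat_card_prime_field[OF prime card]
  by (unfold_locales, auto simp: U_iter V_iter prime_gt_0_nat)+

lemma sum_field:
  fixes g :: "'k \<Rightarrow> 'h"
  shows "(\<Sum>k<p. g (of_nat k)) = (\<Sum>s\<in>UNIV. g s)"
  using sum.reindex_bij_betw[OF of_nat_bij_prime_field[OF prime card], of g] .

definition adjacency_op :: "'h \<Rightarrow> 'h" where
  "adjacency_op x = U 1 x + U (-1) x + V 1 x + V (-1) x"

lemma bounded_linear_U: "bounded_linear (U s)" and bounded_linear_V: "bounded_linear (V s)"
  using UV_linear(1,2) by (auto simp: bounded_linear_def bounded_linear_axioms_def intro!: exI[of _ 1])

lemma bounded_linear_adjacency_op: "bounded_linear adjacency_op"
  unfolding adjacency_op_def[abs_def]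
  by (intro bounded_linear_add bounded_linear_U bounded_linear_V)

lemma linear_adjacency_op: "linear adjacency_op"
  using bounded_linear_adjacency_op by (rule bounded_linear.linear)

lemma adjacency_op_sym: "adjacency_op x \<bullet> y = x \<bullet> adjacency_op y"
  using U_adjoint[of 1 x y] U_adjoint[of "-1" x y] V_adjoint[of 1 x y] V_adjoint[of "-1" x y]
  by (simp add: adjacency_op_def inner_add_left inner_add_right)

lemma adjacency_op_inner: "adjacency_op x \<bullet> x = 2 * (U 1 x \<bullet> x) + 2 * (V 1 x \<bullet> x)"
  using U_self[of 1 x] V_self[of 1 x] by (simp add: adjacency_op_def inner_add_left)

lemma W_adjacency_op: "W (adjacency_op x) = adjacency_op (W x)"
  by (simp add: adjacency_op_def linear_add[OF UV_linear(3)] W_U W_V)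

lemma displacement: "(norm (U s x - x))\<^sup>2 = 2 * (norm x)\<^sup>2 - 2 * (U s x \<bullet> x)"
  "(norm (V s x - x))\<^sup>2 = 2 * (norm x)\<^sup>2 - 2 * (V s x \<bullet> x)"
  using UV_orth(1,2)[of s]
  by (simp_all add: power2_norm_eq_inner inner_diff_left inner_diff_right inner_commute
      orthogonal_transformation_def)

lemma displacement_sum:
  "(norm (U 1 x - x))\<^sup>2 + (norm (V 1 x - x))\<^sup>2 = 4 * (norm x)\<^sup>2 - adjacency_op x \<bullet> x"
  by (simp add: displacement adjacency_op_inner)

text \<open>
  The elementary matrices generate: a matrix whose lower left entry \<open>c\<close> is nonzero is a product
  upper, lower, upper with middle factor determined by \<open>c\<close>, and otherwise a lower factor makes \<open>c\<close> nonzero.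
\<close>

lemma generated:
  assumes "U 1 x = x" "V 1 x = x"
  shows "x \<in> invariant_vectors SL \<pi>"
proof -
  have U: "U s x = x" for s
  proof -
    obtain n where "s = of_nat n" using of_nat_prime_field[OF prime card] by metis
    moreover have "(U 1 ^^ n) x = x" by (induction n) (simp_all add: assms)
    ultimately show ?thesis by (simp add: U_iter)
  qed
  have V: "V s x = x" for s
  proof -
    obtain n where "s = of_nat n" using of_nat_prime_field[OF prime card] by metis
    moreover have "(V 1 ^^ n) x = x" by (induction n) (simp_all add: assms)
    ultimately show ?thesis by (simp add: V_iter)
  qed
  have big: "\<rho> a b c d x = x" if det: "a * d - b * c = 1" and c: "c \<noteq> 0" for a b c d
  proof -
    have "V c (U ((d - 1) / c) x) = \<rho> 1 ((d - 1) / c) c d x"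
      unfolding U_def V_def using c by (subst \<rho>_mult) (simp_all)
    then have "U ((a - 1) / c) (V c (U ((d - 1) / c) x)) = U ((a - 1) / c) (\<rho> 1 ((d - 1) / c) c d x)"
      by simp
    also have "\<dots> = \<rho> a b c d x"
    proof -
      have "(d - 1) / c + (a - 1) / c * d = b"
        using det c by (simp add: field_simps)
      then show ?thesis unfolding U_def using c by (subst \<rho>_mult) simp_all
    qed
    finally show ?thesis by (simp add: U V)
  qed
  have "\<pi> g x = x" if g: "g \<in> carrier SL" for g
  proof -
    obtain a b c d where abcd: "g = mat2 a b c d" using mat2_eqI by metis
    then have det: "a * d - b * c = 1" using g by (simp add: mat2_in_SL)
    have "\<rho> a b c d x = x"
    proof (cases "c = 0")
      case True
      then have a: "a \<noteq> 0" using det by auto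
      have "V 1 (\<rho> a b c d x) = \<rho> a b a (b + d) x"
        unfolding V_def using det True by (subst \<rho>_mult) simp_all
      also have "\<dots> = x" using a det True by (intro big) (simp_all add: algebra_simps)
      finally have "V (-1) (V 1 (\<rho> a b c d x)) = V (-1) x" by simp
      then show ?thesis by (simp add: V_add V)
    qed (use big det in auto)
    then show ?thesis by (simp add: \<rho>_def abcd)
  qed
  then show ?thesis by (simp add: invariant_vectors_def)
qed

section \<open>Eigenvectors of the adjacency operator\<close>

text \<open>
  The orbit of \<open>\<xi>\<close> is finite, so its span is a finite-dimensional subrepresentation, on which the
  largest eigenvalue is attained. It is not 4: that would force an invariant vector orthogonal
  to all invariant vectors.
\<close>

lemma exists_eigenvector:
  assumes \<xi>: "\<xi> \<in> orth_complement (invariant_vectors SL \<pi>)" and big: "\<mu> * (norm \<xi>)\<^sup>2 < adjacency_op \<xi> \<bullet> \<xi>"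
  obtains x \<kappa> where "norm x = 1" "adjacency_op x = \<kappa> *\<^sub>R x" "\<mu> < \<kappa>" "\<kappa> \<noteq> 4"
proof -
  define S where "S = (\<lambda>g. \<pi> g \<xi>) ` carrier SL"
  let ?I = "invariant_vectors SL \<pi>"
  interpret SL: group "SL :: ('k ^ 2 ^ 2) monoid" by (rule group_SL)
  have fin: "finite S" by (simp add: S_def)
  have \<xi>0: "\<xi> \<noteq> 0" using big by auto
  have one: "mat2 1 0 0 1 \<in> carrier (SL :: ('k ^ 2 ^ 2) monoid)" by (simp add: mat2_in_SL)
  have "\<pi> (mat2 1 0 0 1) \<xi> = \<xi>" using \<rho>_one[of \<xi>] by (simp add: \<rho>_def)
  then have \<xi>S: "\<xi> \<in> span S" using one by (metis S_def image_eqI span_base)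
  have Sinv: "\<pi> h y \<in> span S" if h: "h \<in> carrier SL" and y: "y \<in> span S" for h y
    using y
  proof (induction rule: span_induct_alt)
    case base
    then show ?case using linear_0[OF orthogonal_transformation_linear[OF \<pi>_orth[OF h]]]
      by (simp add: span_zero)
  next
    case (step c z y)
    obtain g where g: "g \<in> carrier SL" "z = \<pi> g \<xi>" using step by (auto simp: S_def)
    have "\<pi> (h \<otimes>\<^bsub>SL\<^esub> g) = \<pi> h \<otimes>\<^bsub>orthogonal_group\<^esub> \<pi> g"
      using hom h g by (intro hom_mult) auto
    then have "\<pi> h z = \<pi> (h \<otimes>\<^bsub>SL\<^esub> g) \<xi>" using g by (simp add: orthogonal_group_def)
    then have "\<pi> h z \<in> span S" using h g by (auto simp: S_def intro!: span_base)
    then show ?case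
      using step linear_add[OF orthogonal_transformation_linear[OF \<pi>_orth[OF h]]]
        linear_cmul[OF orthogonal_transformation_linear[OF \<pi>_orth[OF h]]]
      by (simp add: span_add span_mul)
  qed
  have UVS: "U s y \<in> span S" "V s y \<in> span S" if "y \<in> span S" for s y
    unfolding U_def V_def \<rho>_def using that by (auto intro!: Sinv simp: mat2_in_SL)
  have adjS: "adjacency_op y \<in> span S" if "y \<in> span S" for y
    unfolding adjacency_op_def using that by (intro span_add UVS)
  obtain x l where x: "x \<in> span S" "norm x = 1" and l: "- adjacency_op x = l *\<^sub>R x"
    and min: "l * (norm \<xi>)\<^sup>2 \<le> - adjacency_op \<xi> \<bullet> \<xi>"
  proof (rule least_eigenvector[OF fin _ _ _ \<xi>S \<xi>0])
    show "bounded_linear (\<lambda>x. - adjacency_op x)"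
      by (intro bounded_linear_minus bounded_linear_adjacency_op)
    show "- adjacency_op x \<in> span S" if "x \<in> span S" for x
      using that by (intro span_neg adjS)
    show "- adjacency_op x \<bullet> y = x \<bullet> - adjacency_op y" for x y
      using adjacency_op_sym by simp
  qed
  have eig: "adjacency_op x = (- l) *\<^sub>R x" using l by (metis minus_minus scaleR_minus_left)
  have "\<mu> * (norm \<xi>)\<^sup>2 < (- l) * (norm \<xi>)\<^sup>2" using min big by simp
  then have "\<mu> < - l" using \<xi>0 by (simp only: mult_less_cancel_right) auto
  moreover have "- l \<noteq> 4"
  proof
    assume "- l = 4"
    then have "adjacency_op x \<bullet> x = 4" using eig x by (simp flip: power2_norm_eq_inner)
    then have "(norm (U 1 x - x))\<^sup>2 + (norm (V 1 x - x))\<^sup>2 = 0"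
      unfolding displacement_sum using x by simp
    then have "U 1 x = x" "V 1 x = x" by (simp_all add: sum_power2_eq_zero_iff)
    then have "x \<in> ?I" by (rule generated)
    moreover have "x \<in> orth_complement ?I"
    proof -
      have "S \<subseteq> {x. \<forall>\<eta>\<in>?I. \<eta> \<bullet> x = 0}"
      proof
        fix z assume "z \<in> S"
        then obtain g where g: "g \<in> carrier SL" "z = \<pi> g \<xi>" by (auto simp: S_def)
        have "\<eta> \<bullet> z = 0" if \<eta>: "\<eta> \<in> ?I" for \<eta>
        proof -
          have "\<eta> \<bullet> z = \<pi> g \<eta> \<bullet> \<pi> g \<xi>" using g \<eta> by (simp add: invariant_vectors_def)
          also have "\<dots> = \<eta> \<bullet> \<xi>" using \<pi>_orth[OF g(1)] by (simp add: orthogonal_transformation_def)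
          finally show ?thesis using \<xi> \<eta> by (simp add: orth_complement_def orthogonal_def)
        qed
        then show "z \<in> {x. \<forall>\<eta>\<in>?I. \<eta> \<bullet> x = 0}" by simp
      qed
      moreover have "subspace {x. \<forall>\<eta>\<in>?I. \<eta> \<bullet> x = 0}"
        by (auto simp: subspace_def inner_add_right)
      ultimately have "span S \<subseteq> {x. \<forall>\<eta>\<in>?I. \<eta> \<bullet> x = 0}" by (rule span_minimal)
      then show ?thesis using x by (auto simp: orth_complement_def orthogonal_def)
    qed
    ultimately have "x \<bullet> x = 0" by (auto simp: orth_complement_def orthogonal_def)
    then show False using x by simp
  qed
  ultimately show thesis using that eig x by blast
qed

text \<open>
  The quarter turn is \<open>u v\<^sup>-\<^sup>1 u\<close> and also \<open>v\<^sup>-\<^sup>1 u v\<^sup>-\<^sup>1\<close>. If it moves \<open>y\<close> far, then \<open>u\<close> and \<open>v\<close>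
  together move \<open>y\<close> far, by the triangle inequality.
\<close>

lemma quarter_turn_displacement:
  assumes eig: "adjacency_op y = \<kappa> *\<^sub>R y" and far: "2 * (norm y)\<^sup>2 \<le> (norm (W y - y))\<^sup>2" and y: "y \<noteq> 0"
  shows "\<kappa> \<le> 4 - 4 / 9"
proof -
  define a where "a = norm (U 1 y - y)"
  define b where "b = norm (V 1 y - y)"
  have b': "norm (V (-1) y - y) = b"
  proof -
    have "V (-1) (V 1 y - y) = - (V (-1) y - y)" by (simp add: linear_diff[OF UV_linear(2)] V_add)
    then show ?thesis by (metis UV_norm(2) b_def norm_minus_cancel)
  qed
  have "norm (W y - y) \<le> norm (U 1 (V (-1) (U 1 y - y))) + norm (U 1 (V (-1) y - y)) + norm (U 1 y - y)"
  proof -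
    have "W y - y = U 1 (V (-1) (U 1 y - y)) + U 1 (V (-1) y - y) + (U 1 y - y)"
      by (simp add: W_words(1) linear_diff[OF UV_linear(1)] linear_diff[OF UV_linear(2)])
    then show ?thesis by (metis norm_triangle_mono norm_triangle_ineq order_refl)
  qed
  then have 1: "norm (W y - y) \<le> 2 * a + b" by (simp add: a_def b')
  have "norm (W y - y) \<le> norm (V (-1) (U 1 (V (-1) y - y))) + norm (V (-1) (U 1 y - y)) + norm (V (-1) y - y)"
  proof -
    have "W y - y = V (-1) (U 1 (V (-1) y - y)) + V (-1) (U 1 y - y) + (V (-1) y - y)"
      by (simp add: W_words(2) linear_diff[OF UV_linear(1)] linear_diff[OF UV_linear(2)])
    then show ?thesis by (metis norm_triangle_mono norm_triangle_ineq order_refl)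
  qed
  then have 2: "norm (W y - y) \<le> a + 2 * b" by (simp add: a_def b')
  have "4 * (norm y)\<^sup>2 \<le> (norm (W y - y))\<^sup>2 + (norm (W y - y))\<^sup>2" using far by simp
  also have "\<dots> \<le> (2 * a + b)\<^sup>2 + (a + 2 * b)\<^sup>2"
    using 1 2 by (intro add_mono power_mono) auto
  also have "\<dots> \<le> 9 * (a\<^sup>2 + b\<^sup>2)"
    using sum_squares_bound[of a b] by (simp add: power2_eq_square algebra_simps)
  also have "a\<^sup>2 + b\<^sup>2 = (4 - \<kappa>) * (norm y)\<^sup>2"
    unfolding a_def b_def displacement_sum eig by (simp add: power2_norm_eq_inner algebra_simps)
  finally have "4 * (norm y)\<^sup>2 \<le> (9 * (4 - \<kappa>)) * (norm y)\<^sup>2" by (simp add: algebra_simps)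
  then have "4 \<le> 9 * (4 - \<kappa>)" using y by (simp only: mult_le_cancel_right) auto
  then show ?thesis by simp
qed

text \<open>
  The quarter turn commutes with the adjacency operator, so parts of \<open>x\<close> on which it squares to \<open>-1\<close>, or
  acts as \<open>-1\<close>, would be eigenvectors as well. It moves both by at least \<open>\<surd>2\<close> times their length.
\<close>

lemma eigenvector_quarter_turn:
  assumes eig: "adjacency_op x = \<kappa> *\<^sub>R x" and \<kappa>: "4 - 4 / 9 < \<kappa>"
  shows "W x = x"
proof -
  have WW: "W (W x) = x"
  proof (rule ccontr)
    assume ne: "W (W x) \<noteq> x"
    define y where "y = x - W (W x)"
    have "adjacency_op y = \<kappa> *\<^sub>R y"
      by (simp add: y_def linear_diff[OF linear_adjacency_op] W_adjacency_op[symmetric] eig linear_cmul[OF UV_linear(3)] scaleR_diff_right)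
    moreover have "W (W y) = - y"
      by (simp add: y_def linear_diff[OF UV_linear(3)] W_four)
    then have "W y \<bullet> y = 0" by (metis W_inner inner_commute inner_minus_left neg_equal_zero)
    then have "2 * (norm y)\<^sup>2 \<le> (norm (W y - y))\<^sup>2"
      by (simp add: power2_norm_eq_inner inner_diff_left inner_diff_right inner_commute)
    ultimately show False using quarter_turn_displacement[of y \<kappa>] \<kappa> ne by (simp add: y_def)
  qed
  show ?thesis
  proof (rule ccontr)
    assume ne: "W x \<noteq> x"
    define y where "y = x - W x"
    have "adjacency_op y = \<kappa> *\<^sub>R y"
      by (simp add: y_def linear_diff[OF linear_adjacency_op] W_adjacency_op[symmetric] eig linear_cmul[OF UV_linear(3)] scaleR_diff_right)
    moreover have "W y = - y" by (simp add: y_def linear_diff[OF UV_linear(3)] WW)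
    then have "2 * (norm y)\<^sup>2 \<le> (norm (W y - y))\<^sup>2"
      by (simp add: power2_norm_eq_inner inner_diff_left inner_diff_right)
    ultimately show False using quarter_turn_displacement[of y \<kappa>] \<kappa> ne by (simp add: y_def)
  qed
qed

text \<open>
  A vector \<open>\<eta>\<close> fixed by \<open>u\<close> is fixed by all upper unitriangular matrices, so \<open>g \<eta>\<close> depends only on the
  first column of \<open>g\<close>. Thus \<open>g \<mapsto> x \<bullet> g \<eta>\<close> is a function on the nonzero vectors, and it is an
  eigenfunction of the graph with the eigenvalue of \<open>x\<close>.
\<close>

lemma eigenvector_orthogonal_to_induced:
  assumes eig: "adjacency_op x = \<kappa> *\<^sub>R x" and \<kappa>: "4 - 2 * c\<^sup>2 < \<kappa>" "\<kappa> \<noteq> 4"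
    and cert: "gap_certificate p c"
    and W: "11 \<le> p \<Longrightarrow> W x = x"
    and \<eta>: "U 1 \<eta> = \<eta>" and det: "a * d - b * e = 1"
  shows "x \<bullet> \<rho> a b e d \<eta> = 0"
proof -
  have U\<eta>: "U s \<eta> = \<eta>" for s
  proof -
    obtain n where "s = of_nat n" using of_nat_prime_field[OF prime card] by metis
    moreover have "(U 1 ^^ n) \<eta> = \<eta>" by (induction n) (simp_all add: \<eta>)
    ultimately show ?thesis by (simp add: U_iter)
  qed
  define F where "F a e = (if a \<noteq> 0 then x \<bullet> \<rho> a 0 e (1 / a) \<eta> else x \<bullet> \<rho> 0 (- 1 / e) e 0 \<eta>)" for a e
  have F: "x \<bullet> \<rho> a b e d \<eta> = F a e" if det: "a * d - b * e = 1" for a b e d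
  proof (cases "a = 0")
    case True
    then have "b * e = - 1" using det by (metis diff_0 minus_minus mult_zero_left)
    moreover from this have "e \<noteq> 0" by auto
    ultimately have e: "e \<noteq> 0" "b = - 1 / e"
      using nonzero_eq_divide_eq[of e b "- 1"] by blast+
    have "\<rho> 0 (- 1 / e) e 0 (U (d / e) \<eta>) = \<rho> 0 (- 1 / e) e d \<eta>"
      unfolding U_def using e by (subst \<rho>_mult) simp_all
    then show ?thesis using True e by (simp add: F_def U\<eta>)
  next
    case False
    have "d = e * (b / a) + 1 / a" using det False by (simp add: field_simps)
    then have "\<rho> a 0 e (1 / a) (U (b / a) \<eta>) = \<rho> a b e d \<eta>"
      unfolding U_def using False by (subst \<rho>_mult) simp_all
    then show ?thesis using False by (simp add: F_def U\<eta>)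
  qed
  have ex: "\<exists>b d. a * d - b * e = 1" if "(a, e) \<noteq> (0, 0)" for a e :: 'k
  proof (cases "a = 0")
    case True
    then have "a * 0 - (- 1 / e) * e = 1" using that by simp
    then show ?thesis by blast
  next
    case False
    then have "a * (1 / a) - 0 * e = 1" by simp
    then show ?thesis by blast
  qed
  have "F a e = 0"
  proof (rule no_eigenfunction[OF prime card odd cert _ _ \<kappa>])
    show "(a, e) \<noteq> (0, 0)" using det by auto
  next
    fix a e :: 'k assume "(a, e) \<noteq> (0, 0)"
    then obtain b d where det: "a * d - b * e = 1" using ex by blast
    let ?g = "\<rho> a b e d \<eta>"
    have U: "U s ?g = \<rho> (a + s * e) (b + s * d) e d \<eta>" for s
      unfolding U_def using det by (subst \<rho>_mult) simp_all
    have V: "V s ?g = \<rho> a b (s * a + e) (s * b + d) \<eta>" for s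
      unfolding V_def using det by (subst \<rho>_mult) simp_all
    have FU: "x \<bullet> U s ?g = F (a + s * e) e" for s
      unfolding U using det by (intro F) (simp add: algebra_simps)
    have FV: "x \<bullet> V s ?g = F a (s * a + e)" for s
      unfolding V using det by (intro F) (simp add: algebra_simps)
    have "\<kappa> * F a e = adjacency_op x \<bullet> ?g" using F[OF det] by (simp add: eig)
    also have "\<dots> = x \<bullet> U (-1) ?g + x \<bullet> U 1 ?g + x \<bullet> V (-1) ?g + x \<bullet> V 1 ?g"
      using U_adjoint[of 1 x ?g] U_adjoint[of "-1" x ?g] V_adjoint[of 1 x ?g] V_adjoint[of "-1" x ?g]
      by (simp add: adjacency_op_def inner_add_left)
    also have "\<dots> = F (a + (-1) * e) e + F (a + 1 * e) e + F a ((-1) * a + e) + F a (1 * a + e)"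
      by (simp only: FU FV)
    finally show "F (a + e) e + F (a - e) e + F a (e + a) + F a (e - a) = \<kappa> * F a e"
      by (simp add: algebra_simps)
  next
    fix a e :: 'k assume "(a, e) \<noteq> (0, 0)" "11 \<le> p"
    then obtain b d where det: "a * d - b * e = 1" using ex by blast
    have "F a e = W x \<bullet> W (\<rho> a b e d \<eta>)" using F[OF det] by simp
    also have "W (\<rho> a b e d \<eta>) = \<rho> e d (- a) (- b) \<eta>"
      unfolding W_def using det by (subst \<rho>_mult) simp_all
    also have "W x \<bullet> \<dots> = F e (- a)"
      using F[of e "- b" d "- a"] det W[OF \<open>11 \<le> p\<close>] by (simp add: algebra_simps)
    finally show "F e (- a) = F a e" by simp
  qed
  then show ?thesis using F[OF det] by simp
qed

text \<open>
  Apply the preceding orthogonality to the averages of \<open>x\<close> itself over the two unipotent subgroups,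
  the lower one being conjugate to the upper one by the quarter turn.
\<close>

lemma eigenvector_no_fixed_part:
  assumes eig: "adjacency_op x = \<kappa> *\<^sub>R x" and \<kappa>: "4 - 2 * c\<^sup>2 < \<kappa>" "\<kappa> \<noteq> 4"
    and cert: "gap_certificate p c"
    and W: "11 \<le> p \<Longrightarrow> W x = x"
  shows "(\<Sum>k<p. (U 1 ^^ k) x) = 0" "(\<Sum>k<p. (V 1 ^^ k) x) = 0"
proof -
  define N where "N y = (\<Sum>s\<in>UNIV. U s y)" for y
  have fixed: "U t (N y) = N y" for t y
  proof -
    have "U t (N y) = (\<Sum>s\<in>UNIV. U (t + s) y)"
      by (simp add: N_def linear_sum[OF UV_linear(1)] U_add)
    also have "\<dots> = N y"
      unfolding N_def by (rule sum.reindex_bij_witness[of _ "\<lambda>s. s - t" "\<lambda>s. t + s"]) auto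
    finally show ?thesis .
  qed
  have zero: "N y = 0" if "y \<bullet> N y = 0" for y
  proof -
    have "N y \<bullet> N y = (\<Sum>s\<in>UNIV. U s y \<bullet> N y)" by (simp add: N_def[of y] inner_sum_left)
    also have "\<dots> = 0" using that by (simp add: U_adjoint fixed)
    finally show ?thesis by simp
  qed
  note orth = eigenvector_orthogonal_to_induced[OF eig \<kappa> cert W fixed]
  have "N x = 0"
    using orth[of 1 1 0 0] by (intro zero) simp
  then show "(\<Sum>k<p. (U 1 ^^ k) x) = 0"
    using sum_field[of "\<lambda>s. U s x"] by (simp add: U_iter N_def)
  obtain y where y: "W y = x" using W_four[of x] by blast
  have "x \<bullet> W (N y) = 0" unfolding W_def by (rule orth) simp_all
  then have "y \<bullet> N y = 0" using y by (metis W_inner)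
  then have "N y = 0" by (rule zero)
  then have "W (N y) = 0" using linear_0[OF UV_linear(3)] by simp
  then have "(\<Sum>s\<in>UNIV. V (- s) x) = 0"
    by (simp add: N_def linear_sum[OF UV_linear(3)] W_U y)
  moreover have "(\<Sum>s\<in>UNIV. V (- s) x) = (\<Sum>s\<in>UNIV. V s x)"
    by (rule sum.reindex_bij_witness[of _ uminus uminus]) auto
  ultimately show "(\<Sum>k<p. (V 1 ^^ k) x) = 0"
    using sum_field[of "\<lambda>s. V s x"] by (simp add: V_iter)
qed

lemma cuspidal_bound:
  assumes zero: "(\<Sum>k<p. (U 1 ^^ k) x) = 0" "(\<Sum>k<p. (V 1 ^^ k) x) = 0" and x: "norm x = 1"
  shows "adjacency_op x \<bullet> x \<le> 4 * cos (2 * pi / p)"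
  using finite_order_isometry.inner_le_cos[OF finite_order_U zero(1)]
    finite_order_isometry.inner_le_cos[OF finite_order_V zero(2)] x
  by (simp add: adjacency_op_inner)

lemma cuspidal_bound_strong:
  assumes zero: "(\<Sum>k<p. (U 1 ^^ k) x) = 0" "(\<Sum>k<p. (V 1 ^^ k) x) = 0" and x: "norm x = 1"
    and W: "W x = x" and p: "p = 17 \<or> p = 19"
    and C: "cos (2 * pi / p) \<le> 0.946" "0.931 \<le> cos (2 * pi / p)"
  shows "adjacency_op x \<bullet> x < 4 * (cos (2 * pi / p) - 0.00735)"
proof -
  have two: "(2 :: 'k) \<noteq> 0"
    using of_nat_eq_iff_prime_field[OF prime card, of 2 0] p by auto
  have four: "(4 :: 'k) / 2 = 2" using two by (simp add: divide_eq_eq)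
  have minus: "(of_nat (p - 4) :: 'k) = - 4"
    using of_nat_card_prime_field[OF prime card] p by (auto simp: of_nat_diff)
  have half: "(of_nat ((p + 1) div 2) :: 'k) = 1 / 2"
  proof -
    have "(of_nat (2 * ((p + 1) div 2)) :: 'k) = of_nat (p + 1)" using p by auto
    then have "2 * (of_nat ((p + 1) div 2) :: 'k) = 1"
      unfolding of_nat_mult of_nat_add of_nat_card_prime_field[OF prime card] by simp
    then show ?thesis using two by (simp add: field_simps)
  qed
  let ?n = "\<rho> 0 (- 1 / 2) 2 0" and ?n' = "\<rho> 0 (1 / 2) (- 2) 0"
  have n: "orthogonal_transformation ?n" "orthogonal_transformation ?n'"
    using two by (auto intro!: \<rho>_orth)
  have un: "U 1 (?n y) = ?n ((V 1 ^^ (p - 4)) y)" for y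
  proof -
    have "U 1 (?n y) = \<rho> 2 (- 1 / 2) 2 0 y" unfolding U_def using two by (subst \<rho>_mult) simp_all
    moreover have "?n (V (- 4) y) = \<rho> 2 (- 1 / 2) 2 0 y"
      unfolding V_def using two by (subst \<rho>_mult) (simp_all add: four)
    ultimately show ?thesis by (simp add: V_iter minus)
  qed
  have un': "U 1 (?n' y) = ?n' ((V 1 ^^ (p - 4)) y)" for y
  proof -
    have "U 1 (?n' y) = \<rho> (- 2) (1 / 2) (- 2) 0 y" unfolding U_def using two by (subst \<rho>_mult) simp_all
    moreover have "?n' (V (- 4) y) = \<rho> (- 2) (1 / 2) (- 2) 0 y"
      unfolding V_def using two by (subst \<rho>_mult) (simp_all add: four)
    ultimately show ?thesis by (simp add: V_iter minus)
  qed
  have adj: "?n a \<bullet> b = a \<bullet> ?n' b" for a b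
    using two by (subst \<rho>_adjoint) simp_all
  have rel: "V 1 (V 1 x) = (U 1 ^^ ((p + 1) div 2)) (?n ((U 1 ^^ ((p + 1) div 2)) x))"
  proof -
    have "?n (U (1 / 2) x) = \<rho> 0 (- 1 / 2) 2 1 x"
      unfolding U_def using two by (subst \<rho>_mult) simp_all
    moreover have "U (1 / 2) (\<rho> 0 (- 1 / 2) 2 1 x) = V 2 x"
      unfolding U_def V_def using two by (subst \<rho>_mult) simp_all
    ultimately show ?thesis by (simp only: U_iter half V_add mult_1_right one_add_one)
  qed
  have sym: "U 1 x \<bullet> x = V 1 x \<bullet> x"
  proof -
    have "V 1 x \<bullet> x = W (U (-1) x) \<bullet> W x" by (simp add: W_U W)
    then show ?thesis using U_self[of 1 x] by simp
  qed
  have "cos (2 * pi / p) - U 1 x \<bullet> x > 0.00735"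
    by (rule no_common_low_frequency_vector[OF finite_order_U finite_order_V p zero n(1) un n(2) un' adj rel sym x C])
  then show ?thesis unfolding adjacency_op_inner sym[symmetric] by (simp add: field_simps)
qed

lemma adjacency_op_upper_bound:
  assumes pc: "(p, c) \<in> {(3, 0.79622), (5, 0.61803), (7, 0.54119), (11, 0.43700),
                      (13, 0.40302), (17, 0.38119), (19, 0.35021)}"
    and cert: "gap_certificate p c"
    and \<xi>: "\<xi> \<in> orth_complement (invariant_vectors SL \<pi>)"
  shows "adjacency_op \<xi> \<bullet> \<xi> \<le> (4 - 2 * c\<^sup>2) * (norm \<xi>)\<^sup>2"
proof (rule ccontr)
  assume "\<not> ?thesis"
  then have "(4 - 2 * c\<^sup>2) * (norm \<xi>)\<^sup>2 < adjacency_op \<xi> \<bullet> \<xi>" by simp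
  then obtain x \<kappa> where x: "norm x = 1" and eig: "adjacency_op x = \<kappa> *\<^sub>R x"
    and \<kappa>: "4 - 2 * c\<^sup>2 < \<kappa>" "\<kappa> \<noteq> 4"
    by (rule exists_eigenvector[OF \<xi>])
  have W: "W x = x" if "11 \<le> p"
  proof (rule eigenvector_quarter_turn[OF eig])
    have "2 * c\<^sup>2 \<le> 4 / 9"
      using pc that unfolding insert_iff prod.inject empty_iff
      by (elim disjE conjE FalseE; hypsubst) (simp_all add: power2_eq_square)
    then show "4 - 4 / 9 < \<kappa>" using \<kappa> by linarith
  qed
  note zero = eigenvector_no_fixed_part[OF eig \<kappa> cert W]
  have \<kappa>': "adjacency_op x \<bullet> x = \<kappa>" using x by (simp add: eig flip: power2_norm_eq_inner)
  show False
  proof (cases "p = 17 \<or> p = 19")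
    case True
    have C: "cos (2 * pi / p) \<le> 0.946" "0.931 \<le> cos (2 * pi / p)"
      using True cos_2pi_div_bounds by auto
    have "\<kappa> < 4 * (cos (2 * pi / p) - 0.00735)"
      using cuspidal_bound_strong[OF zero x W True C] True \<kappa>' by auto
    moreover have "4 * (cos (2 * pi / p) - 0.00735) \<le> 4 - 2 * c\<^sup>2"
      using pc True cos_2pi_div_bounds(6,7) unfolding insert_iff prod.inject empty_iff
      by (elim disjE conjE FalseE; hypsubst) (simp_all add: power2_eq_square)
    ultimately show False using \<kappa> by linarith
  next
    case False
    have "\<kappa> \<le> 4 * cos (2 * pi / p)" using cuspidal_bound[OF zero x] \<kappa>' by simp
    moreover have "4 * cos (2 * pi / p) \<le> 4 - 2 * c\<^sup>2"
      using pc False cos_2pi_div_bounds(1-5) unfolding insert_iff prod.inject empty_iff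
      by (elim disjE conjE FalseE; hypsubst) (simp_all add: power2_eq_square)
    ultimately show False using \<kappa> by linarith
  qed
qed

end

text \<open>
  The displacement of a vector by an inverse equals that by the element, so of the four squared
  displacements, of total at least \<open>4 c\<^sup>2\<close>, one is at least \<open>c\<^sup>2\<close>. A real number below the gap
  makes the shifted Laplace operator coercive, hence invertible.
\<close>

lemma gap_of_certificate:
  fixes p :: nat and c :: real
  assumes pc: "(p, c) \<in> {(3, 0.79622), (5, 0.61803), (7, 0.54119), (11, 0.43700),
                      (13, 0.40302), (17, 0.38119), (19, 0.35021)}"
    and card: "CARD('k::{field, finite}) = p"
    and cert: "gap_certificate p c"
  shows "spectral_gap TYPE('h::{real_inner, complete_space})
           (SL :: ('k ^ 2 ^ 2) monoid) elementary_matrices \<ge> ereal (2 * c\<^sup>2)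
       \<and> kazhdan_constant TYPE('h)
           (SL :: ('k ^ 2 ^ 2) monoid) elementary_matrices \<ge> ereal c"
proof -
  let ?S = "elementary_matrices :: ('k ^ 2 ^ 2) set"
  have p: "prime p" "odd p" using pc by auto
  have c: "0 \<le> c" using pc by auto
  have two: "(1 :: 'k) \<noteq> - 1"
  proof
    assume "(1 :: 'k) = - 1"
    then have "(of_nat 2 :: 'k) = of_nat 0" by (metis add.right_inverse of_nat_0 of_nat_numeral one_add_one)
    then show False using of_nat_eq_iff_prime_field[OF p(1) card, of 2 0] pc by auto
  qed
  have S: "?S = {mat2 1 1 0 1, mat2 1 (-1) 0 1, mat2 1 0 1 1, mat2 1 0 (-1) 1}"
    by (rule elementary_matrices_eq)
  have sum_S: "(\<Sum>g\<in>?S. f g) = f (mat2 1 1 0 1) + f (mat2 1 (-1) 0 1) + f (mat2 1 0 1 1) + f (mat2 1 0 (-1) 1)"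
    for f :: "'k ^ 2 ^ 2 \<Rightarrow> 'a::comm_monoid_add"
    unfolding S using two by (simp add: mat2_eq_iff add.assoc)
  have card_S: "card ?S = 4" using sum_S[of "\<lambda>_. 1 :: nat"] by simp
  have spec: "ereal (2 * c\<^sup>2) \<le> ereal l"
    if \<pi>: "\<pi> \<in> orthogonal_reps SL" "invariant_vectors SL \<pi> = {0}"
      and l: "l \<in> spectrum (rep_group_ring SL \<pi> (laplacian SL ?S))" for \<pi> :: "'k ^ 2 ^ 2 \<Rightarrow> 'h \<Rightarrow> 'h" and l
  proof -
    interpret sl2_rep \<pi> p using \<pi> p card by unfold_locales auto
    have "\<pi> (mat 1) = id" using \<rho>_one by (auto simp: \<rho>_def mat_1_eq_mat2)
    then have T: "rep_group_ring SL \<pi> (laplacian SL ?S) = (\<lambda>\<xi>. 4 *\<^sub>R \<xi> - adjacency_op \<xi>)"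
      using rep_group_ring_laplacian[of ?S SL \<pi>] elementary_matrices_subset_SL[where 'k = 'k]
        group.is_monoid[OF group_SL] S
      by (auto simp: fun_eq_iff card_S sum_S adjacency_op_def U_def V_def \<rho>_def SL_def mat_1_eq_mat2 det_2)
    have "2 * c\<^sup>2 \<le> l"
    proof (rule ccontr)
      assume "\<not> 2 * c\<^sup>2 \<le> l"
      then have l': "0 < 2 * c\<^sup>2 - l" by simp
      have bl: "bounded_linear (\<lambda>\<xi>. (4 *\<^sub>R \<xi> - adjacency_op \<xi>) - l *\<^sub>R \<xi>)"
        by (intro bounded_linear_sub bounded_linear_scaleR_right bounded_linear_adjacency_op)
      have "(2 * c\<^sup>2 - l) * (norm \<xi>)\<^sup>2 \<le> ((4 *\<^sub>R \<xi> - adjacency_op \<xi>) - l *\<^sub>R \<xi>) \<bullet> \<xi>" for \<xi>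
      proof -
        have "\<xi> \<in> orth_complement (invariant_vectors SL \<pi>)"
          by (simp add: \<pi>(2) orth_complement_def orthogonal_def)
        from adjacency_op_upper_bound[OF pc cert this] show ?thesis
          by (simp add: inner_diff_left power2_norm_eq_inner algebra_simps)
      qed
      from coercive_invertible[OF bl l' this] have "l \<notin> spectrum (\<lambda>\<xi>. 4 *\<^sub>R \<xi> - adjacency_op \<xi>)"
        by (simp add: spectrum_def)
      then show False using l T by simp
    qed
    then show ?thesis by simp
  qed
  have kaz: "ereal c \<le> (SUP g\<in>?S. ereal (norm (\<pi> g \<xi> - \<xi>)))"
    if \<pi>: "\<pi> \<in> orthogonal_reps SL" and \<xi>: "\<xi> \<in> orth_complement (invariant_vectors SL \<pi>)" "norm \<xi> = 1"
    for \<pi> :: "'k ^ 2 ^ 2 \<Rightarrow> 'h \<Rightarrow> 'h" and \<xi>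
  proof -
    interpret sl2_rep \<pi> p using \<pi> p card by unfold_locales auto
    have "2 * c\<^sup>2 \<le> (norm (U 1 \<xi> - \<xi>))\<^sup>2 + (norm (V 1 \<xi> - \<xi>))\<^sup>2"
      using adjacency_op_upper_bound[OF pc cert \<xi>(1)] \<xi>(2) unfolding displacement_sum by simp
    then have "c\<^sup>2 \<le> (norm (U 1 \<xi> - \<xi>))\<^sup>2 \<or> c\<^sup>2 \<le> (norm (V 1 \<xi> - \<xi>))\<^sup>2" by linarith
    then have "c \<le> norm (U 1 \<xi> - \<xi>) \<or> c \<le> norm (V 1 \<xi> - \<xi>)"
      by (auto dest: power2_le_imp_le)
    then obtain g where "g \<in> ?S" "c \<le> norm (\<pi> g \<xi> - \<xi>)"
      by (auto simp: S U_def V_def \<rho>_def)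
    then show ?thesis by (intro SUP_upper2[of g]) auto
  qed
  show ?thesis
    unfolding spectral_gap_def kazhdan_constant_def kazhdan_constant_rep_def
    by (intro conjI INF_greatest) (use spec kaz in auto)
qed

section \<open>Certificates and the theorem\<close>

text \<open>
  Distinct points of the right region, in the right number, exhaust it.
\<close>

lemma gap_certificateI:
  assumes p: "odd p"
    and m: "of_int m \<le> of_int s * (4 - 2 * c\<^sup>2)" "0 < s"
    and chk: "gap_check (if p < 11 then id else quadrant p) p m s K i rs"
    and rs: "list_all (\<lambda>(a, b). (a, b) = (0, 0) \<or>
      (if p < 11 then a < p \<and> b < p else 1 \<le> a \<and> a \<le> p div 2 \<and> b \<le> p div 2)) rs"
      "length rs = (if p < 11 then p * p else Suc (p div 2 * Suc (p div 2)))"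
  shows "gap_certificate p c"
proof -
  let ?D = "if p < 11 then grid p else insert (0, 0) (quarter p)"
  have "distinct rs" using chk by (simp add: gap_check_def)
  have "card ?D = length rs"
    using rs(2) by (simp add: grid_def quarter_def card_cartesian_product)
  moreover have "finite ?D" by (simp add: grid_def quarter_def)
  moreover have "set rs \<subseteq> ?D"
    using rs(1) odd_pos[OF p] by (auto simp: list_all_iff grid_def quarter_def split: if_splits)
  ultimately have "set rs = ?D"
    using distinct_card[OF \<open>distinct rs\<close>] by (intro card_subset_eq) simp_all
  then show ?thesis
    unfolding gap_certificate_def using m chk
    by (intro exI[of _ m] exI[of _ s] exI[of _ K] exI[of _ i] exI[of _ rs]) (auto split: if_splits)
qed

text \<open>
  The lists of points are elimination orders of small fill-in (at each step a vertex of minimal degree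
  in the current graph). The zero vector, at position \<open>i\<close>, marks where the multiplier is eliminated:
  it has to come late, since the form restricted to the points before it must be positive definite.
  The number \<open>m\<close> is \<open>s (4 - 2 c\<^sup>2)\<close> rounded down; the precision \<open>s\<close> and \<open>K\<close> has to resolve the
  margin between \<open>4 - 2 c\<^sup>2\<close> and the true eigenvalue, roughly \<open>10\<^sup>-\<^sup>5\<close> to \<open>10\<^sup>-\<^sup>4\<close>.
\<close>

lemma gap_certificate_3: "gap_certificate 3 0.79622"
proof (rule gap_certificateI[where m = 2732067 and s = 1000000 and K = 40 and i = 3 and rs = "
   [(0,1), (0,2), (1,0), (0,0), (1,1), (1,2), (2,0), (2,1), (2,2)]"])
qed (simp, simp add: power2_eq_square, simp, code_simp, code_simp, code_simp)

lemma gap_certificate_5: "gap_certificate 5 0.61803"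
proof (rule gap_certificateI[where m = 32360778 and s = 10000000 and K = 42 and i = 17 and rs = "
   [(0,1), (0,2), (0,3), (4,0), (1,0), (2,0), (3,0), (0,4), (3,1), (1,3), (4,2), (1,1), (2,3),
    (3,2), (4,4), (2,4), (3,4), (0,0), (4,1), (4,3), (1,4), (2,1), (2,2), (3,3), (1,2)]"])
qed (simp, simp add: power2_eq_square, simp, code_simp, code_simp, code_simp)

lemma gap_certificate_7: "gap_certificate 7 0.54119"
proof (rule gap_certificateI[where m = 3414226 and s = 1000000 and K = 44 and i = 37 and rs = "
   [(0,1), (1,0), (0,2), (0,6), (0,3), (5,0), (0,4), (2,0), (3,0), (4,0), (0,5), (6,0), (6,1),
    (5,2), (4,2), (1,2), (3,5), (4,1), (6,3), (5,6), (2,1), (3,6), (4,3), (5,3), (6,5), (1,4),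
    (2,4), (1,6), (2,5), (3,4), (5,5), (1,1), (4,4), (2,2), (6,6), (1,3), (3,1), (0,0), (3,3),
    (3,2), (4,6), (2,3), (5,1), (4,5), (2,6), (5,4), (1,5), (6,2), (6,4)]"])
qed (simp, simp add: power2_eq_square, simp, code_simp, code_simp, code_simp)

lemma gap_certificate_11: "gap_certificate 11 0.43700"
proof (rule gap_certificateI[where m = 3618062 and s = 1000000 and K = 38 and i = 25 and rs = "
   [(1,0), (2,0), (3,0), (4,0), (5,0), (2,2), (3,3), (4,4), (5,5), (1,1), (2,4), (3,4), (2,1),
    (5,1), (5,3), (1,2), (2,5), (4,1), (1,4), (5,2), (4,2), (3,5), (1,5), (4,3), (1,3), (0,0),
    (2,3), (3,1), (5,4), (4,5), (3,2)]"])
qed (simp, simp add: power2_eq_square, simp, code_simp, code_simp, code_simp)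

lemma gap_certificate_13: "gap_certificate 13 0.40302"
proof (rule gap_certificateI[where m = 3675149 and s = 1000000 and K = 40 and i = 34 and rs = "
   [(1,0), (5,0), (6,0), (3,0), (2,0), (4,0), (5,5), (2,2), (1,1), (3,3), (4,4), (6,6), (1,2),
    (6,3), (2,4), (6,1), (5,3), (4,5), (1,6), (4,3), (4,6), (3,5), (2,6), (2,1), (5,4), (2,3),
    (3,2), (6,2), (5,1), (1,5), (4,1), (6,4), (3,4), (5,6), (0,0), (3,1), (2,5), (1,3), (6,5),
    (3,6), (4,2), (5,2), (1,4)]"])
qed (simp, simp add: power2_eq_square, simp, code_simp, code_simp, code_simp)

lemma gap_certificate_17: "gap_certificate 17 0.38119"
proof (rule gap_certificateI[where m = 3709388 and s = 1000000 and K = 38 and i = 62 and rs = "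
   [(4,0), (2,0), (5,0), (8,0), (3,0), (6,0), (7,0), (1,0), (4,4), (1,1), (7,7), (2,2), (8,8),
    (3,3), (6,6), (5,5), (8,1), (8,4), (1,2), (6,5), (2,4), (3,7), (3,6), (5,7), (7,3), (2,1),
    (5,4), (8,2), (7,1), (8,6), (5,6), (4,6), (4,5), (5,2), (1,7), (2,5), (8,3), (6,4), (3,5),
    (1,3), (2,8), (4,1), (6,2), (7,6), (1,5), (5,3), (3,8), (7,2), (4,3), (6,7), (7,8), (5,1),
    (4,8), (2,6), (8,7), (2,7), (6,8), (3,1), (3,4), (1,4), (3,2), (8,5), (0,0), (6,1), (1,6),
    (2,3), (4,2), (4,7), (5,8), (7,5), (7,4), (6,3), (1,8)]"])
qed (simp, simp add: power2_eq_square, simp, code_simp, code_simp, code_simp)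

lemma gap_certificate_19: "gap_certificate 19 0.35021"
proof (rule gap_certificateI[where m = 3754705 and s = 1000000 and K = 38 and i = 77 and rs = "
   [(4,0), (2,0), (7,0), (5,0), (1,0), (3,0), (9,0), (6,0), (8,0), (8,8), (4,4), (9,9), (7,7),
    (3,3), (5,5), (2,2), (6,6), (1,1), (9,1), (6,3), (2,4), (9,5), (3,8), (8,4), (7,6), (7,5),
    (2,1), (1,5), (2,6), (5,6), (7,9), (5,2), (8,9), (8,7), (8,3), (9,4), (7,8), (7,3), (2,3),
    (6,2), (4,1), (6,7), (2,9), (1,3), (9,6), (9,8), (4,9), (3,7), (5,8), (2,5), (6,9), (3,2),
    (1,7), (4,7), (4,2), (5,1), (1,9), (5,9), (3,6), (6,5), (1,2), (5,7), (7,1), (4,8), (4,6),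
    (6,4), (3,4), (1,4), (5,3), (3,5), (8,1), (1,8), (9,7), (3,9), (2,8), (8,2), (9,3), (0,0),
    (4,5), (5,4), (1,6), (6,1), (3,1), (8,5), (9,2), (7,4), (7,2), (8,6), (6,8), (2,7), (4,3)]"])
qed (simp, simp add: power2_eq_square, simp, code_simp, code_simp, code_simp)

theorem mainTheorem3:
  fixes p :: nat and c :: real
  assumes "(p, c) \<in> {(3, 0.79622), (5, 0.61803), (7, 0.54119), (11, 0.43700),
                      (13, 0.40302), (17, 0.38119), (19, 0.35021)}"
    and "CARD('k::{field, finite}) = p"
  shows "spectral_gap TYPE('h::{real_inner, complete_space})
           (SL :: ('k ^ 2 ^ 2) monoid) elementary_matrices \<ge> ereal (2 * c\<^sup>2)
       \<and> kazhdan_constant TYPE('h)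
           (SL :: ('k ^ 2 ^ 2) monoid) elementary_matrices \<ge> ereal c"
proof (rule gap_of_certificate[OF assms])
  show "gap_certificate p c"
    using assms(1) gap_certificate_3 gap_certificate_5 gap_certificate_7 gap_certificate_11
      gap_certificate_13 gap_certificate_17 gap_certificate_19
    unfolding insert_iff prod.inject empty_iff by (elim disjE conjE FalseE; hypsubst)
qed

end
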